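(* Let $\Gamma$ be a finite simplicial graph with vertex set $V\Gamma$, let $\mathfrak{G}=\{G_v\mid v\in V\Gamma\}$ be a family of finitely generated groups, and let $G=\Gamma\mathfrak{G}$ be the graph product. Let $\mathcal{C}$ be the collection of subsets of $V\Gamma$ spanning a complete graph. Then $$\operatorname{adim} G\leq\max_{C\in\mathcal{C}}\sum_{v\in C}\max(1,\operatorname{adim} G_v).$$
   Context: A simplicial graph is a graph without loops or multiple edges; an edge is a 2-element subset of the vertex set. The graph product $\Gamma\mathfrak{G}$ of a collection of groups $\mathfrak{G}=\{G_v\mid v\in V\Gamma\}$ with respect to $\Gamma$ is the group obtained from the free product of the $G_v$ by adding the relations $[g_v,g_u]=1$ for all $g_v\in G_v$, $g_u\in G_u$ such that $\{v,u\}$ is an edge of $\Gamma$. A metric space $(M,d_M)$ has asymptotic dimension $\leq n$ if for every $d<\infty$ there is a uniformly bounded cover $\mathcal{V}$ of $M$ with $d$-multiplicity $\leq n+1$, i.e. $\sup_{x\in M}|\{V\in\mathcal{V}\mid V\cap B_d(x)\neq\emptyset\}|\leq n+1$, where $B_d(x)$ is the ball of radius $d$ and centre $x$. The asymptotic dimension is $n$ if it is $\leq n$ but not $\leq n-1$ (and $\infty$ if it is $\leq n$ for no $n$). The asymptotic dimension $\operatorname{adim}H$ of a finitely generated group $H$ is that of its Cayley graph with respect to a finite generating set; it is independent of this set. *)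

theory Defs
  imports
    "HOL-Library.Ramsey"
    "HOL-Library.Extended_Nat"
    "HOL-Algebra.Generated_Groups"
    "HOL-Analysis.Abstract_Metric_Spaces"
begin

section \<open>Simplicial graphs\<close>

text \<open>A set of \<open>2\<close>-element subsets of \<open>V\<close> excludes loops and multiple edges. A set of vertices
  spans a complete graph iff it satisfies \<^const>\<open>clique\<close>; the empty set does.\<close>

definition simplicial_graph :: "'v set \<Rightarrow> 'v set set \<Rightarrow> bool" where
  "simplicial_graph V E \<longleftrightarrow> E \<subseteq> [V]\<^bsup>2\<^esup>"


section \<open>Free products and graph products of groups\<close>

text \<open>The free product is the set of words in the letters \<open>(v, g)\<close> with \<open>g \<in> G\<^sub>v\<close>, modulo deleting a
  letter that is an identity element and multiplying adjacent letters from the same group, with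
  concatenation as multiplication.\<close>

definition fp_words :: "'v set \<Rightarrow> ('v \<Rightarrow> ('a, 'b) monoid_scheme) \<Rightarrow> ('v \<times> 'a) list set" where
  "fp_words V G = lists (SIGMA v:V. carrier (G v))"

inductive fp_step :: "'v set \<Rightarrow> ('v \<Rightarrow> ('a, 'b) monoid_scheme) \<Rightarrow> ('v \<times> 'a) list \<Rightarrow> ('v \<times> 'a) list \<Rightarrow> bool"
  for V G where
  one: "\<lbrakk>xs \<in> fp_words V G; ys \<in> fp_words V G; v \<in> V\<rbrakk>
    \<Longrightarrow> fp_step V G (xs @ [(v, \<one>\<^bsub>G v\<^esub>)] @ ys) (xs @ ys)"
| mult: "\<lbrakk>xs \<in> fp_words V G; ys \<in> fp_words V G; v \<in> V; g \<in> carrier (G v); h \<in> carrier (G v)\<rbrakk>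
    \<Longrightarrow> fp_step V G (xs @ [(v, g), (v, h)] @ ys) (xs @ [(v, g \<otimes>\<^bsub>G v\<^esub> h)] @ ys)"

definition fp_rel :: "'v set \<Rightarrow> ('v \<Rightarrow> ('a, 'b) monoid_scheme) \<Rightarrow> (('v \<times> 'a) list \<times> ('v \<times> 'a) list) set" where
  "fp_rel V G = {(x, y). x \<in> fp_words V G \<and> y \<in> fp_words V G \<and> equivclp (fp_step V G) x y}"

definition free_product :: "'v set \<Rightarrow> ('v \<Rightarrow> ('a, 'b) monoid_scheme) \<Rightarrow> ('v \<times> 'a) list set monoid" where
  "free_product V G =
    \<lparr>carrier = fp_words V G // fp_rel V G,
     mult = (\<lambda>A B. \<Union>a\<in>A. \<Union>b\<in>B. fp_rel V G `` {a @ b}),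
     one = fp_rel V G `` {[]}\<rparr>"

definition fp_inj :: "'v set \<Rightarrow> ('v \<Rightarrow> ('a, 'b) monoid_scheme) \<Rightarrow> 'v \<Rightarrow> 'a \<Rightarrow> ('v \<times> 'a) list set" where
  "fp_inj V G v g = fp_rel V G `` {[(v, g)]}"

definition commutator :: "('a, 'b) monoid_scheme \<Rightarrow> 'a \<Rightarrow> 'a \<Rightarrow> 'a" where
  "commutator H x y = x \<otimes>\<^bsub>H\<^esub> y \<otimes>\<^bsub>H\<^esub> inv\<^bsub>H\<^esub> x \<otimes>\<^bsub>H\<^esub> inv\<^bsub>H\<^esub> y"

definition normal_closure :: "('a, 'b) monoid_scheme \<Rightarrow> 'a set \<Rightarrow> 'a set" where
  "normal_closure H R = (\<lambda>N. N \<lhd> H) hull R"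

definition graph_product_relators ::
    "'v set \<Rightarrow> 'v set set \<Rightarrow> ('v \<Rightarrow> ('a, 'b) monoid_scheme) \<Rightarrow> ('v \<times> 'a) list set set" where
  "graph_product_relators V E G =
    {commutator (free_product V G) (fp_inj V G v g) (fp_inj V G u h) | v u g h.
       v \<in> V \<and> u \<in> V \<and> {v, u} \<in> E \<and> g \<in> carrier (G v) \<and> h \<in> carrier (G u)}"

definition graph_product ::
    "'v set \<Rightarrow> 'v set set \<Rightarrow> ('v \<Rightarrow> ('a, 'b) monoid_scheme) \<Rightarrow> ('v \<times> 'a) list set set monoid" where
  "graph_product V E G =
    free_product V G Mod normal_closure (free_product V G) (graph_product_relators V E G)"


section \<open>Asymptotic dimension of metric spaces\<close>

context Metric_space
begin

definition uniformly_bounded :: "'a set set \<Rightarrow> bool" where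
  "uniformly_bounded \<V> \<longleftrightarrow> (\<exists>B. \<forall>U\<in>\<V>. \<forall>x\<in>U. \<forall>y\<in>U. d x y \<le> B)"

definition multiplicity_le :: "real \<Rightarrow> 'a set set \<Rightarrow> nat \<Rightarrow> bool" where
  "multiplicity_le r \<V> k \<longleftrightarrow>
    (\<forall>x\<in>M. finite {U \<in> \<V>. U \<inter> mball x r \<noteq> {}} \<and> card {U \<in> \<V>. U \<inter> mball x r \<noteq> {}} \<le> k)"

definition asdim_le :: "nat \<Rightarrow> bool" where
  "asdim_le n \<longleftrightarrow> (\<forall>r. \<exists>\<V>. \<Union>\<V> = M \<and> uniformly_bounded \<V> \<and> multiplicity_le r \<V> (n + 1))"

definition asdim :: enat where
  "asdim = (if \<exists>n. asdim_le n then enat (LEAST n. asdim_le n) else \<infinity>)"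

end


section \<open>Asymptotic dimension of finitely generated groups\<close>

definition finite_generating_set :: "('a, 'b) monoid_scheme \<Rightarrow> 'a set \<Rightarrow> bool" where
  "finite_generating_set H S \<longleftrightarrow> finite S \<and> S \<subseteq> carrier H \<and> generate H S = carrier H"

definition finitely_generated :: "('a, 'b) monoid_scheme \<Rightarrow> bool" where
  "finitely_generated H \<longleftrightarrow> (\<exists>S. finite_generating_set H S)"

text \<open>The Cayley graph is regarded as the metric space consisting of its vertices with the path
  metric: the distance is the least length of an edge path, where edges may be traversed in both
  directions.\<close>

definition cayley_graph :: "('a, 'b) monoid_scheme \<Rightarrow> 'a set \<Rightarrow> 'a rel" where
  "cayley_graph H S = {(g, g \<otimes>\<^bsub>H\<^esub> s) | g s. g \<in> carrier H \<and> s \<in> S}"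

definition cayley_dist :: "('a, 'b) monoid_scheme \<Rightarrow> 'a set \<Rightarrow> 'a \<Rightarrow> 'a \<Rightarrow> real" where
  "cayley_dist H S g h = real (LEAST n. (g, h) \<in> (cayley_graph H S \<union> (cayley_graph H S)\<inverse>) ^^ n)"

text \<open>For finitely generated groups the choice of the finite generating set is irrelevant, see
  \<open>adim_eq\<close> below. If there is no finite generating set, the value is meaningless.\<close>

definition adim :: "('a, 'b) monoid_scheme \<Rightarrow> enat" where
  "adim H = Metric_space.asdim (carrier H) (cayley_dist H (SOME S. finite_generating_set H S))"


section \<open>Well-definedness\<close>

subsection \<open>The graph product is a finitely generated group\<close>

lemma fp_words_append [simp]: "xs @ ys \<in> fp_words V G \<longleftrightarrow> xs \<in> fp_words V G \<and> ys \<in> fp_words V G"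
  by (auto simp: fp_words_def)

lemma fp_words_Nil [simp]: "[] \<in> fp_words V G"
  by (auto simp: fp_words_def)

lemma fp_words_Cons [simp]:
  "(v, g) # xs \<in> fp_words V G \<longleftrightarrow> v \<in> V \<and> g \<in> carrier (G v) \<and> xs \<in> fp_words V G"
  by (auto simp: fp_words_def)

lemma equiv_fp_rel: "equiv (fp_words V G) (fp_rel V G)"
  by (rule equivI) (auto simp: fp_rel_def refl_on_def sym_def trans_def intro: equivclp_sym equivclp_trans)

lemma fp_rel_if_step:
  assumes "fp_step V G x y" "\<And>v. v \<in> V \<Longrightarrow> group (G v)"
  shows "(x, y) \<in> fp_rel V G"
proof -
  have "equivclp (fp_step V G) x y"
    using assms(1) by (rule r_into_equivclp)
  moreover have "x \<in> fp_words V G \<and> y \<in> fp_words V G"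
    using assms by (auto elim!: fp_step.cases simp: group.is_monoid monoid.one_closed monoid.m_closed)
  ultimately show ?thesis by (simp add: fp_rel_def)
qed

lemma fp_step_context:
  assumes "fp_step V G x y" "p \<in> fp_words V G" "q \<in> fp_words V G"
  shows "fp_step V G (p @ x @ q) (p @ y @ q)"
  using assms(1)
proof cases
  case (one xs ys v)
  then show ?thesis using fp_step.one[of "p @ xs" V G "ys @ q" v] assms by simp
next
  case (mult xs ys v g h)
  then show ?thesis using fp_step.mult[of "p @ xs" V G "ys @ q" v g h] assms by simp
qed

lemma fp_rel_context:
  assumes "(x, y) \<in> fp_rel V G" "p \<in> fp_words V G" "q \<in> fp_words V G"
  shows "(p @ x @ q, p @ y @ q) \<in> fp_rel V G"
proof -
  have "equivclp (fp_step V G) x y" using assms by (simp add: fp_rel_def)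
  then have "equivclp (fp_step V G) (p @ x @ q) (p @ y @ q)"
  proof (induction rule: equivclp_induct)
    case base then show ?case by simp
  next
    case (step y z)
    then have "equivclp (fp_step V G) (p @ y @ q) (p @ z @ q)"
      using fp_step_context assms by (metis r_into_equivclp equivclp_sym)
    with step show ?case by (meson equivclp_trans)
  qed
  then show ?thesis using assms by (simp add: fp_rel_def)
qed

lemma fp_congruent2:
  "congruent2 (fp_rel V G) (fp_rel V G) (\<lambda>a b. fp_rel V G `` {a @ b})"
proof (rule congruent2I[OF equiv_fp_rel equiv_fp_rel])
  show "fp_rel V G `` {y @ w} = fp_rel V G `` {z @ w}"
    if "(y, z) \<in> fp_rel V G" "w \<in> fp_words V G" for y z w
    using fp_rel_context[OF that(1), of "[]" w] that(2) equiv_class_eq[OF equiv_fp_rel] by fastforce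
  show "fp_rel V G `` {w @ y} = fp_rel V G `` {w @ z}"
    if "(y, z) \<in> fp_rel V G" "w \<in> fp_words V G" for y z w
    using fp_rel_context[OF that(1), of w "[]"] that(2) equiv_class_eq[OF equiv_fp_rel] by fastforce
qed

lemma fp_mult_class:
  assumes "x \<in> fp_words V G" "y \<in> fp_words V G"
  shows "(fp_rel V G `` {x}) \<otimes>\<^bsub>free_product V G\<^esub> (fp_rel V G `` {y}) = fp_rel V G `` {x @ y}"
  using UN_equiv_class2[OF equiv_fp_rel equiv_fp_rel fp_congruent2 assms]
  by (simp add: free_product_def)

lemma fp_class_closed: "x \<in> fp_words V G \<Longrightarrow> fp_rel V G `` {x} \<in> carrier (free_product V G)"
  by (simp add: free_product_def quotientI)

lemma fp_carrierE:
  assumes "A \<in> carrier (free_product V G)"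
  obtains x where "x \<in> fp_words V G" "A = fp_rel V G `` {x}"
  using assms by (auto simp: free_product_def elim: quotientE)

lemma fp_word_inverse:
  assumes grp: "\<And>v. v \<in> V \<Longrightarrow> group (G v)" and "x \<in> fp_words V G"
  shows "\<exists>y \<in> fp_words V G. (y @ x, []) \<in> fp_rel V G"
  using assms(2)
proof (induction x)
  case Nil
  then show ?case using equiv_fp_rel by (force simp: equiv_def refl_on_def intro!: bexI[of _ "[]"])
next
  case (Cons a x)
  obtain v g where a: "a = (v, g)" by fastforce
  with Cons have vg: "v \<in> V" "g \<in> carrier (G v)" "x \<in> fp_words V G" by auto
  interpret Gv: group "G v" by (rule grp[OF vg(1)])
  obtain y where y: "y \<in> fp_words V G" "(y @ x, []) \<in> fp_rel V G" using Cons vg by auto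
  let ?z = "y @ [(v, inv\<^bsub>G v\<^esub> g)]"
  have "(y @ [(v, inv\<^bsub>G v\<^esub> g), (v, g)] @ x, y @ [(v, \<one>\<^bsub>G v\<^esub>)] @ x) \<in> fp_rel V G"
    using fp_step.mult[of y V G x v "inv\<^bsub>G v\<^esub> g" g] y vg grp by (intro fp_rel_if_step) auto
  moreover have "(y @ [(v, \<one>\<^bsub>G v\<^esub>)] @ x, y @ x) \<in> fp_rel V G"
    using fp_step.one[of y V G x v] y vg grp by (intro fp_rel_if_step) auto
  ultimately have "(?z @ a # x, []) \<in> fp_rel V G"
    using y(2) equiv_fp_rel[of V G] a by (auto simp: equiv_def dest: transD)
  then show ?case using y vg by (intro bexI[of _ ?z]) auto
qed

lemma group_free_product:
  assumes grp: "\<And>v. v \<in> V \<Longrightarrow> group (G v)"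
  shows "group (free_product V G)"
proof (rule groupI)
  have one: "\<one>\<^bsub>free_product V G\<^esub> = fp_rel V G `` {[]}" by (simp add: free_product_def)
  show "\<one>\<^bsub>free_product V G\<^esub> \<in> carrier (free_product V G)"
    by (simp add: one fp_class_closed)
  fix x assume x: "x \<in> carrier (free_product V G)"
  show "\<one>\<^bsub>free_product V G\<^esub> \<otimes>\<^bsub>free_product V G\<^esub> x = x"
    using x by (auto elim!: fp_carrierE simp: one fp_mult_class)
  show "\<exists>y\<in>carrier (free_product V G). y \<otimes>\<^bsub>free_product V G\<^esub> x = \<one>\<^bsub>free_product V G\<^esub>"
  proof -
    obtain w where w: "w \<in> fp_words V G" "x = fp_rel V G `` {w}" using x by (elim fp_carrierE)
    obtain u where u: "u \<in> fp_words V G" "(u @ w, []) \<in> fp_rel V G"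
      using fp_word_inverse[OF grp w(1)] by auto
    show ?thesis
      using w u equiv_class_eq[OF equiv_fp_rel u(2)]
      by (intro bexI[of _ "fp_rel V G `` {u}"]) (auto simp: one fp_mult_class fp_class_closed)
  qed
  fix y assume y: "y \<in> carrier (free_product V G)"
  show "x \<otimes>\<^bsub>free_product V G\<^esub> y \<in> carrier (free_product V G)"
    using x y by (auto elim!: fp_carrierE simp: fp_mult_class fp_class_closed)
  fix z assume z: "z \<in> carrier (free_product V G)"
  show "x \<otimes>\<^bsub>free_product V G\<^esub> y \<otimes>\<^bsub>free_product V G\<^esub> z
      = x \<otimes>\<^bsub>free_product V G\<^esub> (y \<otimes>\<^bsub>free_product V G\<^esub> z)"
    using x y z by (auto elim!: fp_carrierE simp: fp_mult_class)
qed

lemma fp_inj_hom: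
  assumes grp: "\<And>v. v \<in> V \<Longrightarrow> group (G v)" and v: "v \<in> V"
  shows "fp_inj V G v \<in> hom (G v) (free_product V G)"
proof (rule homI)
  fix g h assume gh: "g \<in> carrier (G v)" "h \<in> carrier (G v)"
  show "fp_inj V G v g \<in> carrier (free_product V G)"
    using gh v by (simp add: fp_inj_def fp_class_closed)
  have "([(v, g), (v, h)], [(v, g \<otimes>\<^bsub>G v\<^esub> h)]) \<in> fp_rel V G"
    using fp_step.mult[of "[]" V G "[]" v g h] gh v grp by (intro fp_rel_if_step) auto
  from equiv_class_eq[OF equiv_fp_rel this]
  show "fp_inj V G v (g \<otimes>\<^bsub>G v\<^esub> h) = fp_inj V G v g \<otimes>\<^bsub>free_product V G\<^esub> fp_inj V G v h"
    using gh v by (simp add: fp_inj_def fp_mult_class)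
qed

lemma normal_normal_closure:
  assumes "group H" "R \<subseteq> carrier H"
  shows "normal_closure H R \<lhd> H"
proof -
  interpret group H by fact
  let ?\<N> = "{N. N \<lhd> H \<and> R \<subseteq> N}"
  have car: "carrier H \<in> ?\<N>"
    using assms subgroup_self by (auto simp: normal_inv_iff)
  have "\<Inter>?\<N> \<lhd> H"
  proof (subst normal_inv_iff, intro conjI ballI)
    show "subgroup (\<Inter>?\<N>) H"
      using car by (intro subgroups_Inter) (auto simp: normal_imp_subgroup)
    show "x \<otimes>\<^bsub>H\<^esub> h \<otimes>\<^bsub>H\<^esub> inv\<^bsub>H\<^esub> x \<in> \<Inter>?\<N>"
      if "x \<in> carrier H" "h \<in> \<Inter>?\<N>" for x h
      using that by (auto simp: normal_inv_iff)
  qed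
  then show ?thesis by (simp add: normal_closure_def hull_def)
qed

lemma graph_product_relators_subset:
  assumes "\<And>v. v \<in> V \<Longrightarrow> group (G v)"
  shows "graph_product_relators V E G \<subseteq> carrier (free_product V G)"
proof -
  interpret F: group "free_product V G" using assms by (rule group_free_product)
  show ?thesis
    using fp_inj_hom[of V G] assms by (auto simp: graph_product_relators_def commutator_def hom_def Pi_iff)
qed

lemma normal_graph_product:
  assumes "\<And>v. v \<in> V \<Longrightarrow> group (G v)"
  shows "normal_closure (free_product V G) (graph_product_relators V E G) \<lhd> free_product V G"
  using assms by (intro normal_normal_closure group_free_product graph_product_relators_subset)

theorem group_graph_product:
  assumes "\<And>v. v \<in> V \<Longrightarrow> group (G v)"
  shows "group (graph_product V E G)"
  unfolding graph_product_def using normal_graph_product[OF assms] by (rule normal.factorgroup_is_group)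

lemma finitely_generated_free_product:
  assumes "finite V" and grp: "\<And>v. v \<in> V \<Longrightarrow> group (G v)"
    and fg: "\<And>v. v \<in> V \<Longrightarrow> finitely_generated (G v)"
  shows "finitely_generated (free_product V G)"
proof -
  let ?F = "free_product V G"
  interpret F: group ?F using grp by (rule group_free_product)
  obtain S where S: "\<And>v. v \<in> V \<Longrightarrow> finite_generating_set (G v) (S v)"
    using fg unfolding finitely_generated_def by metis
  define T where "T = (\<Union>v\<in>V. fp_inj V G v ` S v)"
  have T: "finite T" "T \<subseteq> carrier ?F"
    using assms(1) S fp_inj_hom[of V G, OF grp]
    by (fastforce simp: T_def finite_generating_set_def hom_def Pi_iff)+
  have inj: "fp_inj V G v g \<in> generate ?F T" if "v \<in> V" "g \<in> carrier (G v)" for v g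
  proof -
    interpret group_hom "G v" ?F "fp_inj V G v"
      using that grp fp_inj_hom[OF grp]
      by (simp add: group_hom_def group_hom_axioms_def F.is_group)
    have "fp_inj V G v ` generate (G v) (S v) = generate ?F (fp_inj V G v ` S v)"
      using S[OF that(1)] generate_img[of "S v"] by (simp add: finite_generating_set_def)
    moreover have "\<dots> \<subseteq> generate ?F T"
      using that by (intro F.mono_generate) (auto simp: T_def)
    ultimately show ?thesis using S[OF that(1)] that by (auto simp: finite_generating_set_def)
  qed
  have word: "fp_rel V G `` {w} \<in> generate ?F T" if "w \<in> fp_words V G" for w
    using that
  proof (induction w)
    case Nil
    then show ?case using generate.one[of ?F T] by (simp add: free_product_def)
  next
    case (Cons a w)
    obtain v g where a: "a = (v, g)" by fastforce
    then have "fp_rel V G `` {a # w} = fp_inj V G v g \<otimes>\<^bsub>?F\<^esub> (fp_rel V G `` {w})"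
      using Cons by (simp add: fp_inj_def fp_mult_class)
    then show ?case using Cons a inj by (auto intro: generate.eng)
  qed
  have "generate ?F T = carrier ?F"
    using word F.generate_incl[OF T(2)] by (auto elim!: fp_carrierE)
  then show ?thesis using T by (auto simp: finitely_generated_def finite_generating_set_def)
qed

theorem finitely_generated_graph_product:
  assumes "finite V" and grp: "\<And>v. v \<in> V \<Longrightarrow> group (G v)"
    and "\<And>v. v \<in> V \<Longrightarrow> finitely_generated (G v)"
  shows "finitely_generated (graph_product V E G)"
proof -
  let ?F = "free_product V G"
  let ?N = "normal_closure ?F (graph_product_relators V E G)"
  obtain T where T: "finite T" "T \<subseteq> carrier ?F" "generate ?F T = carrier ?F"
    using finitely_generated_free_product[of V G] assms
    by (auto simp: finitely_generated_def finite_generating_set_def)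
  interpret N: normal ?N ?F using grp by (rule normal_graph_product)
  interpret group_hom ?F "?F Mod ?N" "\<lambda>a. ?N #>\<^bsub>?F\<^esub> a"
    by (simp add: group_hom_def group_hom_axioms_def N.is_group N.factorgroup_is_group N.r_coset_hom_Mod)
  have "generate (?F Mod ?N) ((\<lambda>a. ?N #>\<^bsub>?F\<^esub> a) ` T) = (\<lambda>a. ?N #>\<^bsub>?F\<^esub> a) ` carrier ?F"
    using generate_img[OF T(2)] T(3) by simp
  also have "\<dots> = carrier (?F Mod ?N)"
    by (auto simp: FactGroup_def RCOSETS_def)
  finally have "finite_generating_set (graph_product V E G) ((\<lambda>a. ?N #>\<^bsub>?F\<^esub> a) ` T)"
    using T by (auto simp: finite_generating_set_def graph_product_def)
  then show ?thesis by (auto simp: finitely_generated_def)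
qed


subsection \<open>Independence of the finite generating set\<close>

abbreviation cayley_adj :: "('a, 'b) monoid_scheme \<Rightarrow> 'a set \<Rightarrow> 'a rel" where
  "cayley_adj H S \<equiv> cayley_graph H S \<union> (cayley_graph H S)\<inverse>"

locale generated_group = group H for H (structure) +
  fixes S
  assumes S_subset: "S \<subseteq> carrier H" and S_generate: "generate H S = carrier H"
begin

lemma adj_translate:
  assumes "(g, h) \<in> cayley_adj H S" "k \<in> carrier H"
  shows "(k \<otimes> g, k \<otimes> h) \<in> cayley_adj H S"
proof -
  have *: "(k \<otimes> g, k \<otimes> h) \<in> cayley_graph H S" if gh: "(g, h) \<in> cayley_graph H S" for g h
  proof -
    obtain s where s: "g \<in> carrier H" "s \<in> S" "h = g \<otimes> s"
      using gh unfolding cayley_graph_def by blast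
    then have "k \<otimes> h = k \<otimes> g \<otimes> s" using S_subset assms(2) by (simp add: m_assoc subset_iff)
    with s assms(2) show ?thesis unfolding cayley_graph_def by blast
  qed
  show ?thesis using assms(1) * by blast
qed

lemma adj_pow_translate:
  assumes "(g, h) \<in> cayley_adj H S ^^ n" "k \<in> carrier H"
  shows "(k \<otimes> g, k \<otimes> h) \<in> cayley_adj H S ^^ n"
  using assms(1)
proof (induction n arbitrary: h)
  case 0 then show ?case by simp
next
  case (Suc n)
  then show ?case using adj_translate[OF _ assms(2)] by (metis relpow_Suc_E relpow_Suc_I)
qed

lemma adj_pow_sym: "(g, h) \<in> cayley_adj H S ^^ n \<Longrightarrow> (h, g) \<in> cayley_adj H S ^^ n"
proof (induction n arbitrary: h)
  case 0 then show ?case by simp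
next
  case (Suc n)
  then obtain k where k: "(g, k) \<in> cayley_adj H S ^^ n" "(k, h) \<in> cayley_adj H S" by auto
  then have "(k, g) \<in> cayley_adj H S ^^ n" "(h, k) \<in> cayley_adj H S" using Suc.IH by auto
  then show ?case by (metis relpow_Suc_I2)
qed

lemma connected_one: "g \<in> carrier H \<Longrightarrow> \<exists>n. (\<one>, g) \<in> cayley_adj H S ^^ n"
proof -
  have "g \<in> carrier H \<and> (\<exists>n. (\<one>, g) \<in> cayley_adj H S ^^ n)" if "g \<in> generate H S" for g
    using that
  proof (induction rule: generate.induct)
    case one then show ?case by (auto intro: exI[of _ 0])
  next
    case (incl h)
    then have "(\<one>, h) \<in> cayley_adj H S ^^ 1"
      using S_subset unfolding cayley_graph_def by force
    then show ?case using incl S_subset by blast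
  next
    case (inv h)
    then have "(inv h, inv h \<otimes> h) \<in> cayley_graph H S"
      using S_subset unfolding cayley_graph_def by blast
    then have "(\<one>, inv h) \<in> cayley_adj H S ^^ 1"
      using inv S_subset by auto
    then show ?case using inv S_subset by blast
  next
    case (eng g h)
    then obtain m n where "(\<one>, g) \<in> cayley_adj H S ^^ m" "(\<one>, h) \<in> cayley_adj H S ^^ n" by auto
    then have "(\<one>, g \<otimes> h) \<in> cayley_adj H S ^^ (m + n)"
      using adj_pow_translate[of \<one> h n g] eng by (auto simp: relpow_add)
    then show ?case using eng by blast
  qed
  then show "g \<in> carrier H \<Longrightarrow> \<exists>n. (\<one>, g) \<in> cayley_adj H S ^^ n" using S_generate by blast
qed

lemma cayley_connected:
  assumes "g \<in> carrier H" "h \<in> carrier H"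
  shows "\<exists>n. (g, h) \<in> cayley_adj H S ^^ n"
proof -
  obtain n where "(\<one>, inv g \<otimes> h) \<in> cayley_adj H S ^^ n" using connected_one assms by blast
  from adj_pow_translate[OF this assms(1)] show ?thesis using assms by (auto simp flip: m_assoc)
qed

lemma cayley_dist_path:
  assumes "g \<in> carrier H" "h \<in> carrier H"
  obtains n where "cayley_dist H S g h = real n" "(g, h) \<in> cayley_adj H S ^^ n"
  using LeastI_ex[OF cayley_connected[OF assms]] unfolding cayley_dist_def by blast

lemma cayley_dist_le: "(g, h) \<in> cayley_adj H S ^^ n \<Longrightarrow> cayley_dist H S g h \<le> real n"
  unfolding cayley_dist_def by (simp add: Least_le)

lemma Metric_space_cayley: "Metric_space (carrier H) (cayley_dist H S)"
proof
  show "0 \<le> cayley_dist H S x y" for x y by (simp add: cayley_dist_def)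
  show "cayley_dist H S x y = cayley_dist H S y x" for x y
    unfolding cayley_dist_def using adj_pow_sym by metis
  show "cayley_dist H S x y = 0 \<longleftrightarrow> x = y" if "x \<in> carrier H" "y \<in> carrier H" for x y
  proof
    assume "cayley_dist H S x y = 0"
    then show "x = y" using cayley_dist_path[OF that]
      by (metis of_nat_eq_0_iff relpow_0_E)
  next
    assume "x = y"
    then show "cayley_dist H S x y = 0"
      using cayley_dist_le[of x y 0] by (simp add: cayley_dist_def)
  qed
  show "cayley_dist H S x z \<le> cayley_dist H S x y + cayley_dist H S y z"
    if xyz: "x \<in> carrier H" "y \<in> carrier H" "z \<in> carrier H" for x y z
  proof -
    obtain m where m: "cayley_dist H S x y = real m" "(x, y) \<in> cayley_adj H S ^^ m"
      using cayley_dist_path[OF xyz(1,2)] .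
    obtain n where n: "cayley_dist H S y z = real n" "(y, z) \<in> cayley_adj H S ^^ n"
      using cayley_dist_path[OF xyz(2,3)] .
    have "(x, z) \<in> cayley_adj H S ^^ (m + n)" using m n by (auto simp: relpow_add)
    then show ?thesis using m n cayley_dist_le by fastforce
  qed
qed

lemma cayley_dist_translate:
  assumes "g \<in> carrier H" "h \<in> carrier H" "k \<in> carrier H"
  shows "cayley_dist H S (k \<otimes> g) (k \<otimes> h) \<le> cayley_dist H S g h"
  using cayley_dist_path[OF assms(1,2)] adj_pow_translate[OF _ assms(3)] cayley_dist_le by metis

lemma cayley_dist_Lipschitz:
  assumes "finite_generating_set H T"
  shows "\<exists>K>0. \<forall>g\<in>carrier H. \<forall>h\<in>carrier H. cayley_dist H S g h \<le> K * cayley_dist H T g h"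
proof -
  interpret T: generated_group H T
    using assms by unfold_locales (auto simp: finite_generating_set_def)
  interpret Metric_space "carrier H" "cayley_dist H S" by (rule Metric_space_cayley)
  define K where "K = 1 + (\<Sum>t\<in>T. cayley_dist H S \<one> t)"
  have K: "K > 0" unfolding K_def by (smt (verit) nonneg sum_nonneg)
  have gen: "cayley_dist H S g (g \<otimes> t) \<le> K" if "g \<in> carrier H" "t \<in> T" for g t
  proof -
    have "cayley_dist H S g (g \<otimes> t) \<le> cayley_dist H S \<one> t"
      using cayley_dist_translate[of \<one> t g] that T.S_subset by auto
    also have "\<dots> \<le> (\<Sum>t\<in>T. cayley_dist H S \<one> t)"
      using assms that by (intro member_le_sum) (auto simp: finite_generating_set_def)
    finally show ?thesis by (simp add: K_def)
  qed
  have adj: "g \<in> carrier H \<and> h \<in> carrier H \<and> cayley_dist H S g h \<le> K"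
    if "(g, h) \<in> cayley_adj H T" for g h
    using that gen T.S_subset commute unfolding cayley_graph_def by (auto simp: commute)
  have path: "h \<in> carrier H \<and> cayley_dist H S g h \<le> K * n"
    if "(g, h) \<in> cayley_adj H T ^^ n" "g \<in> carrier H" for g h n
    using that
  proof (induction n arbitrary: h)
    case 0 then show ?case by simp
  next
    case (Suc n)
    then obtain k where k: "(g, k) \<in> cayley_adj H T ^^ n" "(k, h) \<in> cayley_adj H T" by auto
    with Suc adj[OF k(2)] triangle[of g k h] show ?case by (fastforce simp: algebra_simps)
  qed
  have "cayley_dist H S g h \<le> K * cayley_dist H T g h" if "g \<in> carrier H" "h \<in> carrier H" for g h
    using T.cayley_dist_path[OF that] path that by metis
  with K show ?thesis by blast
qed

end

lemma asdim_le_bilipschitz: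
  assumes d: "Metric_space M d" and e: "Metric_space M e" and "K > 0" "L > 0"
    and de: "\<And>x y. x \<in> M \<Longrightarrow> y \<in> M \<Longrightarrow> d x y \<le> K * e x y"
    and ed: "\<And>x y. x \<in> M \<Longrightarrow> y \<in> M \<Longrightarrow> e x y \<le> L * d x y"
    and "Metric_space.asdim_le M d n"
  shows "Metric_space.asdim_le M e n"
proof -
  interpret d: Metric_space M d by (fact d)
  interpret e: Metric_space M e by (fact e)
  show ?thesis
    unfolding e.asdim_le_def
  proof
    fix r
    obtain \<V> B where \<V>: "\<Union>\<V> = M" "\<And>U x y. \<lbrakk>U \<in> \<V>; x \<in> U; y \<in> U\<rbrakk> \<Longrightarrow> d x y \<le> B"
      and mult: "d.multiplicity_le (K * r) \<V> (n + 1)"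
      using assms(7) unfolding d.asdim_le_def d.uniformly_bounded_def by metis
    have "e.mball x r \<subseteq> d.mball x (K * r)" for x
    proof
      fix y assume "y \<in> e.mball x r"
      then have y: "x \<in> M" "y \<in> M" "e x y < r" by auto
      have "d x y \<le> K * e x y" using de y by blast
      also have "\<dots> < K * r" using y \<open>K > 0\<close> by simp
      finally show "y \<in> d.mball x (K * r)" using y by simp
    qed
    then have sub: "{U \<in> \<V>. U \<inter> e.mball x r \<noteq> {}} \<subseteq> {U \<in> \<V>. U \<inter> d.mball x (K * r) \<noteq> {}}" for x
      by blast
    have "e.multiplicity_le r \<V> (n + 1)"
      using mult sub unfolding d.multiplicity_le_def e.multiplicity_le_def
      by (meson card_mono finite_subset le_trans)
    moreover have "e.uniformly_bounded \<V>"
      unfolding e.uniformly_bounded_def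
    proof (intro exI ballI)
      fix U x y assume U: "U \<in> \<V>" "x \<in> U" "y \<in> U"
      then have "e x y \<le> L * d x y" using ed \<V>(1) by blast
      also have "\<dots> \<le> L * B" using \<V>(2)[OF U] \<open>L > 0\<close> by simp
      finally show "e x y \<le> L * B" .
    qed
    ultimately show "\<exists>\<V>. \<Union>\<V> = M \<and> e.uniformly_bounded \<V> \<and> e.multiplicity_le r \<V> (n + 1)"
      using \<V>(1) by blast
  qed
qed

theorem asdim_cayley_independent:
  assumes "group H" "finite_generating_set H S" "finite_generating_set H T"
  shows "Metric_space.asdim (carrier H) (cayley_dist H S) = Metric_space.asdim (carrier H) (cayley_dist H T)"
proof -
  interpret S: generated_group H S
    using assms by (auto simp: generated_group_def generated_group_axioms_def finite_generating_set_def)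
  interpret T: generated_group H T
    using assms by (auto simp: generated_group_def generated_group_axioms_def finite_generating_set_def)
  obtain K L where
    "K > 0" "\<And>g h. g \<in> carrier H \<Longrightarrow> h \<in> carrier H \<Longrightarrow> cayley_dist H S g h \<le> K * cayley_dist H T g h"
    "L > 0" "\<And>g h. g \<in> carrier H \<Longrightarrow> h \<in> carrier H \<Longrightarrow> cayley_dist H T g h \<le> L * cayley_dist H S g h"
    using S.cayley_dist_Lipschitz[OF assms(3)] T.cayley_dist_Lipschitz[OF assms(2)] by metis
  then have "Metric_space.asdim_le (carrier H) (cayley_dist H S) n
      \<longleftrightarrow> Metric_space.asdim_le (carrier H) (cayley_dist H T) n" (is "?P n \<longleftrightarrow> ?Q n") for n
    using asdim_le_bilipschitz[OF S.Metric_space_cayley T.Metric_space_cayley]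
      asdim_le_bilipschitz[OF T.Metric_space_cayley S.Metric_space_cayley] by metis
  then have "?P = ?Q" by blast
  then show ?thesis
    by (simp add: Metric_space.asdim_def[OF S.Metric_space_cayley] Metric_space.asdim_def[OF T.Metric_space_cayley])
qed

theorem adim_eq:
  assumes "group H" "finite_generating_set H S"
  shows "adim H = Metric_space.asdim (carrier H) (cayley_dist H S)"
  unfolding adim_def
  using asdim_cayley_independent[OF assms(1) someI[of "finite_generating_set H", OF assms(2)] assms(2)] .

end

theory Submission
  imports Defs "HOL-Library.Sublist" "HOL-Algebra.Bij"
begin

text \<open>
  The bound is proved by induction on the number of vertices. Fix a vertex \<open>v\<close>, let \<open>A\<close> and \<open>C\<close> be
  the subgroups of the graph product \<open>P\<close> that belong to the vertices other than \<open>v\<close> and to the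
  neighbours of \<open>v\<close>, and let \<open>H\<close> be the copy of \<open>G\<^sub>v\<close>. Then \<open>P\<close> is the amalgam of \<open>A\<close> and \<open>C \<times> H\<close> over
  \<open>C\<close>. As a clique that contains \<open>v\<close> consists of \<open>v\<close> and a clique of neighbours of \<open>v\<close>, the induction
  step is the following: if \<open>asdim A \<le> n\<close>, \<open>asdim C + asdim H \<le> n\<close> and \<open>asdim C + 1 \<le> n\<close>, then
  \<open>asdim P \<le> n\<close> (lemma \<open>adim_graph_product_insert_vertex\<close>).

  Algebraically, \<open>P\<close> is the semidirect product of \<open>A\<close> with the kernel of the retraction \<open>\<rho>\<close> onto \<open>A\<close>,
  and the kernel is the free product of copies of \<open>H\<close> indexed by the cosets \<open>a C\<close>. So every element is
  determined by \<open>\<rho> x\<close> and by a reduced word \<open>\<pi> x\<close> in letters \<open>(a C, h)\<close>, which stand for the conjugates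
  \<open>a h a\<^sup>-\<^sup>1\<close>. The word map is obtained from an action of \<open>P\<close> on the pairs of a reduced word and an
  element of \<open>A\<close>; the action exists by the universal property of the graph product (lemma
  \<open>word_map_exists\<close>). The words form a tree; the fibres of \<open>\<pi>\<close> are left cosets of \<open>A\<close>, and a path in
  the Cayley graph can leave a branch of the tree through a left coset of \<open>C\<close> only.

  Geometrically, \<open>asdim \<le> n\<close> is used in the following form: for every \<open>r\<close> the space is the union of
  \<open>n + 1\<close> sets (colours) whose \<open>r\<close>-components are uniformly bounded. Following Kolmogorov, one can use
  more colours if every point still misses at most \<open>n\<close> of them; this gives the bound for the product
  \<open>C \<times> H\<close>. A part of bounded depth of the tree is assembled from cosets of \<open>A\<close> and of \<open>C \<times> H\<close> in
  finitely many steps, so it has dimension at most \<open>n\<close> by the theorem on infinite unions. It remains to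
  cut the tree into such parts and to glue their colourings (lemma \<open>tree_gluing\<close>). This is where the
  dimension of \<open>C\<close> has to be smaller than \<open>n\<close>: between adjacent parts there are \<open>n + 1\<close> parallel
  layers, each of them close to a coset of \<open>C\<close>, and in the layer number \<open>c\<close> all colours except \<open>c\<close> are
  used. So no component of a colour runs through all the layers, and the components remain bounded.
\<close>

section \<open>Colourings by coarsely discrete sets\<close>

text \<open>The \<open>r\<close>-components of \<open>Y\<close> have diameter at most \<open>B\<close>. Instead of chains of points, the definition uses
  a labelling \<open>f\<close> that is constant on the components; a set of points can serve as the label of a
  component.\<close>

definition coarsely_discrete :: "('a \<Rightarrow> 'a \<Rightarrow> real) \<Rightarrow> real \<Rightarrow> real \<Rightarrow> 'a set \<Rightarrow> bool" where
  "coarsely_discrete d r B Y \<longleftrightarrow>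
    (\<exists>f :: 'a \<Rightarrow> 'a set. \<forall>x\<in>Y. \<forall>y\<in>Y. (d x y \<le> r \<longrightarrow> f x = f y) \<and> (f x = f y \<longrightarrow> d x y \<le> B))"

text \<open>For \<open>m = n + 1\<close> the condition on the cardinality says that the sets \<open>Y 0, \<dots>, Y n\<close> cover \<open>Z\<close>. A larger
  \<open>m\<close> gives the freedom to avoid some of the colours at a point.\<close>

definition colouring :: "('a \<Rightarrow> 'a \<Rightarrow> real) \<Rightarrow> nat \<Rightarrow> nat \<Rightarrow> real \<Rightarrow> real \<Rightarrow> 'a set \<Rightarrow> bool" where
  "colouring d n m r B Z \<longleftrightarrow>
    (\<exists>Y. (\<forall>i<m. Y i \<subseteq> Z \<and> coarsely_discrete d r B (Y i)) \<and> (\<forall>x\<in>Z. card {i. i < m \<and> x \<notin> Y i} \<le> n))"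

text \<open>The bound \<open>B\<close> depends on the scale \<open>r\<close> but is common to all members of the family. A single space \<open>Z\<close>
  is treated as the family \<open>{Z}\<close>.\<close>

definition uniform_colouring :: "('a \<Rightarrow> 'a \<Rightarrow> real) \<Rightarrow> nat \<Rightarrow> nat \<Rightarrow> 'a set set \<Rightarrow> bool" where
  "uniform_colouring d n m \<Z> \<longleftrightarrow> (\<forall>r. \<exists>B. \<forall>Z\<in>\<Z>. colouring d n m r B Z)"

abbreviation uniform_asdim_le :: "('a \<Rightarrow> 'a \<Rightarrow> real) \<Rightarrow> nat \<Rightarrow> 'a set set \<Rightarrow> bool" where
  "uniform_asdim_le d n \<equiv> uniform_colouring d n (Suc n)"

definition neighbourhood :: "'a set \<Rightarrow> ('a \<Rightarrow> 'a \<Rightarrow> real) \<Rightarrow> real \<Rightarrow> 'a set \<Rightarrow> 'a set" where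
  "neighbourhood M d r Z = {x \<in> M. \<exists>z\<in>Z. d x z \<le> r}"

lemma coarsely_discreteI:
  fixes g :: "'a \<Rightarrow> 'b"
  assumes "\<And>x y. \<lbrakk>x \<in> Y; y \<in> Y; d x y \<le> r\<rbrakk> \<Longrightarrow> g x = g y"
    and "\<And>x y. \<lbrakk>x \<in> Y; y \<in> Y; g x = g y\<rbrakk> \<Longrightarrow> d x y \<le> B"
  shows "coarsely_discrete d r B Y"
proof -
  have eq: "{z \<in> Y. g z = g x} = {z \<in> Y. g z = g y} \<longleftrightarrow> g x = g y" if "x \<in> Y" "y \<in> Y" for x y
    using that by auto
  show ?thesis
    unfolding coarsely_discrete_def
    by (intro exI[of _ "\<lambda>x. {z \<in> Y. g z = g x}"] ballI) (simp add: eq assms)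
qed

lemma coarsely_discreteE:
  assumes "coarsely_discrete d r B Y"
  obtains f :: "'a \<Rightarrow> 'a set"
  where "\<forall>x\<in>Y. \<forall>y\<in>Y. (d x y \<le> r \<longrightarrow> f x = f y) \<and> (f x = f y \<longrightarrow> d x y \<le> B)"
  using assms unfolding coarsely_discrete_def by blast

lemma coarsely_discrete_mono:
  assumes "coarsely_discrete d r B Y" "Y' \<subseteq> Y" "r' \<le> r" "B \<le> B'"
  shows "coarsely_discrete d r' B' Y'"
proof -
  obtain f :: "'a \<Rightarrow> 'a set" where f: "\<forall>x\<in>Y. \<forall>y\<in>Y.
      (d x y \<le> r \<longrightarrow> f x = f y) \<and> (f x = f y \<longrightarrow> d x y \<le> B)"
    using assms(1) by (rule coarsely_discreteE)
  note f = f[rule_format, THEN conjunct1, rule_format] f[rule_format, THEN conjunct2, rule_format]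
  then show ?thesis
    using assms(2-) by (intro coarsely_discreteI[where g = f]) (meson order_trans subsetD)+
qed

lemma coarsely_discrete_fibres:
  assumes "\<And>x y. \<lbrakk>x \<in> Y; y \<in> Y; d x y \<le> r\<rbrakk> \<Longrightarrow> g x = g y"
    and "\<And>i. coarsely_discrete d r B {x \<in> Y. g x = i}"
  shows "coarsely_discrete d r B Y"
proof -
  have "\<exists>f :: 'a \<Rightarrow> 'a set. \<forall>x\<in>Y. \<forall>y\<in>Y. g x = i \<longrightarrow> g y = i \<longrightarrow>
      (d x y \<le> r \<longrightarrow> f x = f y) \<and> (f x = f y \<longrightarrow> d x y \<le> B)" for i
    using assms(2)[of i] unfolding coarsely_discrete_def by auto
  then obtain f :: "'b \<Rightarrow> 'a \<Rightarrow> 'a set" where f: "\<And>x y. \<lbrakk>x \<in> Y; y \<in> Y; g x = g y\<rbrakk> \<Longrightarrow>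
      (d x y \<le> r \<longrightarrow> f (g x) x = f (g x) y) \<and> (f (g x) x = f (g x) y \<longrightarrow> d x y \<le> B)"
    by metis
  show ?thesis
    using f assms(1) by (intro coarsely_discreteI[where g = "\<lambda>x. (g x, f (g x) x)"]) auto
qed

text \<open>If the components of \<open>Y2\<close> are far apart in comparison with the size of the components of \<open>Y1\<close>, then
  each component of \<open>Y1\<close> is close to at most one component of \<open>Y2\<close>, which absorbs it.\<close>

lemma (in Metric_space) coarsely_discrete_Un:
  assumes Y1: "coarsely_discrete d r D Y1" and Y2: "coarsely_discrete d (D + 2 * r) B Y2"
    and sub: "Y1 \<subseteq> M" "Y2 \<subseteq> M" and pos: "0 \<le> r" "0 \<le> D" "0 \<le> B"
  shows "coarsely_discrete d r (B + 2 * (D + r)) (Y1 \<union> Y2)"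
proof -
  obtain f1 :: "'a \<Rightarrow> 'a set" where f1: "\<forall>x\<in>Y1. \<forall>y\<in>Y1.
      (d x y \<le> r \<longrightarrow> f1 x = f1 y) \<and> (f1 x = f1 y \<longrightarrow> d x y \<le> D)"
    using Y1 by (rule coarsely_discreteE)
  note f1 = f1[rule_format, THEN conjunct1, rule_format] f1[rule_format, THEN conjunct2, rule_format]
  obtain f2 :: "'a \<Rightarrow> 'a set" where f2: "\<forall>x\<in>Y2. \<forall>y\<in>Y2.
      (d x y \<le> D + 2 * r \<longrightarrow> f2 x = f2 y) \<and> (f2 x = f2 y \<longrightarrow> d x y \<le> B)"
    using Y2 by (rule coarsely_discreteE)
  note f2 = f2[rule_format, THEN conjunct1, rule_format] f2[rule_format, THEN conjunct2, rule_format]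
  \<comment> \<open>\<open>near x y\<close>: the point \<open>y\<close> of \<open>Y2\<close> is \<open>x\<close> or close to the class of \<open>x\<close>, which it absorbs.\<close>
  define near where "near x y \<longleftrightarrow> y \<in> Y2 \<and> (if x \<in> Y2 then y = x else
    (\<exists>x'\<in>Y1. f1 x' = f1 x \<and> d x' y \<le> r))" for x y
  have near_dist: "d x y \<le> D + r" if xy: "near x y" "x \<in> Y1 \<union> Y2" for x y
  proof (cases "x \<in> Y2")
    case False
    then obtain x' where x': "x' \<in> Y1" "f1 x' = f1 x" "d x' y \<le> r" "x \<in> Y1" "y \<in> Y2"
      using xy False by (auto simp: near_def)
    then show ?thesis using f1(2)[of x x'] triangle[of x x' y] sub by fastforce
  qed (use xy pos sub in \<open>auto simp: near_def\<close>)
  have near_unique: "f2 y = f2 y'" if nn: "near x y" "near x y'" for x y y'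
  proof (cases "x \<in> Y2")
    case False
    then obtain x1 x2 where x: "x1 \<in> Y1" "d x1 y \<le> r" "x2 \<in> Y1" "d x2 y' \<le> r"
      and f: "f1 x1 = f1 x2" and y: "y \<in> Y2" "y' \<in> Y2"
      using nn False by (auto simp: near_def)
    have "x1 \<in> M" "x2 \<in> M" "y \<in> M" "y' \<in> M" using x y sub by auto
    then have "d y y' \<le> d x1 y + d x1 x2 + d x2 y'"
      using triangle[of y x1 y'] triangle[of x1 x2 y'] commute[of y x1] by linarith
    then show ?thesis using f1(2)[OF x(1,3) f] x(2,4) by (intro f2(1) y) linarith
  qed (use nn in \<open>auto simp: near_def\<close>)
  define g :: "'a \<Rightarrow> 'a set + 'a set" where
    "g x = (if \<exists>y. near x y then Inr (f2 (SOME y. near x y)) else Inl (f1 x))" for x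
  have g_near: "g x = Inr (f2 y)" if "near x y" for x y
  proof -
    have "near x (SOME y. near x y)" using that by (rule someI)
    then have "f2 (SOME y. near x y) = f2 y" using that by (rule near_unique)
    moreover have "\<exists>y. near x y" using that by blast
    ultimately show ?thesis by (simp add: g_def)
  qed
  have near_self: "near x x" if "x \<in> Y2" for x using that by (simp add: near_def)
  show ?thesis
  proof (rule coarsely_discreteI[where g = g])
    have step: "g x = g y" if xy: "x \<in> Y2" "y \<in> Y1 \<union> Y2" "d x y \<le> r" for x y
    proof (cases "y \<in> Y2")
      case True
      then show ?thesis using f2(1)[of x y] xy pos g_near near_self by (metis add_increasing mult_2 order_trans)
    next
      case False
      then have "near y x" using xy by (auto simp: near_def commute)
      then show ?thesis using g_near near_self xy by metis
    qed
    fix x y assume xy: "x \<in> Y1 \<union> Y2" "y \<in> Y1 \<union> Y2" "d x y \<le> r"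
    show "g x = g y"
    proof (cases "x \<in> Y2 \<or> y \<in> Y2")
      case True
      then show ?thesis using step xy by (metis commute)
    next
      case False
      then have "f1 x = f1 y" using f1 xy by auto
      then have "near x = near y" using False by (auto simp: near_def fun_eq_iff)
      then show ?thesis using \<open>f1 x = f1 y\<close> by (simp add: g_def)
    qed
  next
    fix x y assume xy: "x \<in> Y1 \<union> Y2" "y \<in> Y1 \<union> Y2" "g x = g y"
    show "d x y \<le> B + 2 * (D + r)"
    proof (cases "\<exists>a. near x a")
      case True
      then obtain a b where ab: "near x a" "near y b" "f2 a = f2 b"
        using xy(3) g_near by (metis g_def sum.distinct(1) sum.inject(2))
      then have "a \<in> Y2" "b \<in> Y2" by (auto simp: near_def)
      then have "d a b \<le> B" using f2 ab by auto
      moreover have "d x y \<le> d x a + d a b + d b y"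
        using triangle[of x a y] triangle[of a b y] xy \<open>a \<in> Y2\<close> \<open>b \<in> Y2\<close> sub by fastforce
      ultimately show ?thesis using near_dist[OF ab(1)] near_dist[OF ab(2)] xy by (simp add: commute)
    next
      case False
      then have "\<nexists>b. near y b" using xy(3) by (metis g_def sum.distinct(1))
      with False have "f1 x = f1 y" "x \<in> Y1" "y \<in> Y1"
        using xy near_self by (auto simp: g_def)
      then show ?thesis using f1(2)[of x y] pos by auto
    qed
  qed
qed

lemma (in Metric_space) coarsely_discrete_neighbourhood:
  assumes "coarsely_discrete d (r + 2 * s) B Y" "Y \<subseteq> M" "0 \<le> r"
  shows "coarsely_discrete d r (B + 2 * s) (neighbourhood M d s Y)"
proof -
  obtain f :: "'a \<Rightarrow> 'a set" where f: "\<forall>x\<in>Y. \<forall>y\<in>Y.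
      (d x y \<le> r + 2 * s \<longrightarrow> f x = f y) \<and> (f x = f y \<longrightarrow> d x y \<le> B)"
    using assms(1) by (rule coarsely_discreteE)
  note f = f[rule_format, THEN conjunct1, rule_format] f[rule_format, THEN conjunct2, rule_format]
  define p where "p x = (SOME y. y \<in> Y \<and> d x y \<le> s)" for x
  have p: "p x \<in> Y" "d x (p x) \<le> s" "x \<in> M" "p x \<in> M" if "x \<in> neighbourhood M d s Y" for x
    using that someI_ex[of "\<lambda>y. y \<in> Y \<and> d x y \<le> s"] assms(2) by (auto simp: neighbourhood_def p_def)
  have dist: "d (p x) (p y) \<le> d x y + 2 * s \<and> d x y \<le> d (p x) (p y) + 2 * s"
    if "x \<in> neighbourhood M d s Y" "y \<in> neighbourhood M d s Y" for x y
    using p[OF that(1)] p[OF that(2)] triangle[of x "p x" y] triangle[of "p x" "p y" y]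
      triangle[of "p x" x "p y"] triangle[of x y "p y"] commute[of x "p x"] commute[of y "p y"] by linarith
  show ?thesis
  proof (rule coarsely_discreteI[where g = "\<lambda>x. f (p x)"])
    fix x y assume xy: "x \<in> neighbourhood M d s Y" "y \<in> neighbourhood M d s Y"
    show "f (p x) = f (p y)" if "d x y \<le> r"
      using dist[OF xy] that p(1)[OF xy(1)] p(1)[OF xy(2)] by (intro f(1)) auto
    show "d x y \<le> B + 2 * s" if "f (p x) = f (p y)"
      using dist[OF xy] f(2)[OF p(1)[OF xy(1)] p(1)[OF xy(2)] that] by simp
  qed
qed

lemma colouring_mono:
  assumes "colouring d n m r B Z" "r' \<le> r" "B \<le> B'" "n \<le> n'"
  shows "colouring d n' m r' B' Z"
  using assms coarsely_discrete_mono[of d r B _ _ r' B'] unfolding colouring_def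
  by (meson order_refl order_trans)

text \<open>The colour sets of a family of colourings can be chosen simultaneously.\<close>

lemma colouring_choice:
  assumes "\<And>W. W \<in> Z ` I \<Longrightarrow> colouring d n m r B W"
  obtains F where "\<forall>i\<in>I. (\<forall>c<m. F i c \<subseteq> Z i \<and> coarsely_discrete d r B (F i c)) \<and>
      (\<forall>x\<in>Z i. card {c. c < m \<and> x \<notin> F i c} \<le> n)"
proof -
  have "\<forall>i\<in>I. \<exists>F. (\<forall>c<m. F c \<subseteq> Z i \<and> coarsely_discrete d r B (F c)) \<and>
      (\<forall>x\<in>Z i. card {c. c < m \<and> x \<notin> F c} \<le> n)"
    using assms unfolding colouring_def by blast
  from bchoice[OF this] show ?thesis using that by blast
qed

lemma uniform_colouringE:
  assumes "uniform_colouring d n m \<Z>"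
  obtains B where "0 \<le> B" "\<And>Z. Z \<in> \<Z> \<Longrightarrow> colouring d n m r B Z"
proof -
  obtain B where "\<And>Z. Z \<in> \<Z> \<Longrightarrow> colouring d n m r B Z"
    using assms unfolding uniform_colouring_def by blast
  then show ?thesis
    using that[of "max 0 B"] colouring_mono[of d n m r B _ r "max 0 B" n] by auto
qed

lemma uniform_colouringI:
  assumes "\<And>r. 0 < r \<Longrightarrow> \<exists>B. \<forall>Z\<in>\<Z>. colouring d n m r B Z"
  shows "uniform_colouring d n m \<Z>"
  unfolding uniform_colouring_def
proof
  fix r :: real
  obtain B where "\<forall>Z\<in>\<Z>. colouring d n m (max r 1) B Z" using assms[of "max r 1"] by fastforce
  then show "\<exists>B. \<forall>Z\<in>\<Z>. colouring d n m r B Z" using colouring_mono[of d n m "max r 1" B _ r B n] by auto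
qed

section \<open>Coarse invariance, additional colours and products\<close>

text \<open>Preimages of the colour sets under coarse embeddings with common constants are colour sets again.
  Subsets, neighbourhoods and translates are special cases, and so is a change of the generating set.\<close>

lemma uniform_colouring_pullback:
  fixes d :: "'a \<Rightarrow> 'a \<Rightarrow> real" and d' :: "'b \<Rightarrow> 'b \<Rightarrow> real"
  assumes "uniform_colouring d' n m \<Z>'" and "0 \<le> K"
    and emb: "\<And>Z. Z \<in> \<Z> \<Longrightarrow> \<exists>Z'\<in>\<Z>'. \<exists>\<phi>. \<phi> ` Z \<subseteq> Z' \<and>
      (\<forall>x\<in>Z. \<forall>y\<in>Z. d' (\<phi> x) (\<phi> y) \<le> K * d x y + L \<and> d x y \<le> K * d' (\<phi> x) (\<phi> y) + L)"
  shows "uniform_colouring d n m \<Z>"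
  unfolding uniform_colouring_def
proof
  fix r
  obtain B where B: "\<And>Z. Z \<in> \<Z>' \<Longrightarrow> colouring d' n m (K * r + L) B Z"
    using assms(1) unfolding uniform_colouring_def by blast
  have "colouring d n m r (K * B + L) Z" if Z: "Z \<in> \<Z>" for Z
  proof -
    obtain Z' \<phi> where Z': "Z' \<in> \<Z>'" "\<phi> ` Z \<subseteq> Z'"
      and "\<forall>x\<in>Z. \<forall>y\<in>Z. d' (\<phi> x) (\<phi> y) \<le> K * d x y + L \<and> d x y \<le> K * d' (\<phi> x) (\<phi> y) + L"
      using emb[OF Z] by blast
    note \<phi> = this(3)[rule_format]
    obtain Y where Y: "\<And>i. i < m \<Longrightarrow> coarsely_discrete d' (K * r + L) B (Y i)"
      and card: "\<And>x. x \<in> Z' \<Longrightarrow> card {i. i < m \<and> x \<notin> Y i} \<le> n"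
      using B[OF Z'(1)] unfolding colouring_def by blast
    define X where "X i = {x \<in> Z. \<phi> x \<in> Y i}" for i
    have "coarsely_discrete d r (K * B + L) (X i)" if i: "i < m" for i
    proof -
      obtain f :: "'b \<Rightarrow> 'b set" where f: "\<forall>x\<in>Y i. \<forall>y\<in>Y i.
          (d' x y \<le> K * r + L \<longrightarrow> f x = f y) \<and> (f x = f y \<longrightarrow> d' x y \<le> B)"
        using Y[OF i] by (rule coarsely_discreteE)
      note f = f[rule_format, THEN conjunct1, rule_format] f[rule_format, THEN conjunct2, rule_format]
      show ?thesis
      proof (rule coarsely_discreteI[where g = "f \<circ> \<phi>"])
        fix x y assume xy: "x \<in> X i" "y \<in> X i"
        then have in_Z: "x \<in> Z" "y \<in> Z" by (auto simp: X_def)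
        note \<phi> = \<phi>[OF in_Z]
        show "(f \<circ> \<phi>) x = (f \<circ> \<phi>) y" if "d x y \<le> r"
        proof -
          have "K * d x y \<le> K * r" using that assms(2) by (rule mult_left_mono)
          then show ?thesis using \<phi> xy f(1) by (auto simp: X_def)
        qed
        show "d x y \<le> K * B + L" if "(f \<circ> \<phi>) x = (f \<circ> \<phi>) y"
        proof -
          have "d' (\<phi> x) (\<phi> y) \<le> B" using that f(2) xy by (auto simp: X_def)
          then have "K * d' (\<phi> x) (\<phi> y) \<le> K * B" using assms(2) by (rule mult_left_mono)
          then show ?thesis using \<phi> by linarith
        qed
      qed
    qed
    moreover have "{i. i < m \<and> x \<notin> X i} = {i. i < m \<and> \<phi> x \<notin> Y i}" if "x \<in> Z" for x
      using that by (auto simp: X_def)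
    ultimately show ?thesis
      unfolding colouring_def using card Z'(2) by (intro exI[of _ X]) (auto simp: X_def)
  qed
  then show "\<exists>B. \<forall>Z\<in>\<Z>. colouring d n m r B Z" by blast
qed

lemma uniform_colouring_subsets:
  assumes "uniform_colouring d n m \<Z>'" "\<And>Z. Z \<in> \<Z> \<Longrightarrow> \<exists>Z'\<in>\<Z>'. Z \<subseteq> Z'"
  shows "uniform_colouring d n m \<Z>"
proof (rule uniform_colouring_pullback[OF assms(1), of 1 _ _ 0])
  fix Z assume "Z \<in> \<Z>"
  then obtain Z' where "Z' \<in> \<Z>'" "Z \<subseteq> Z'" using assms(2) by blast
  then show "\<exists>Z'\<in>\<Z>'. \<exists>\<phi>. \<phi> ` Z \<subseteq> Z' \<and>
      (\<forall>x\<in>Z. \<forall>y\<in>Z. d (\<phi> x) (\<phi> y) \<le> 1 * d x y + 0 \<and> d x y \<le> 1 * d (\<phi> x) (\<phi> y) + 0)"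
    by (intro bexI[of _ Z'] exI[of _ id]) auto
qed auto

lemma (in Metric_space) uniform_colouring_neighbourhood:
  assumes "uniform_colouring d n m \<Z>" "\<And>Z. Z \<in> \<Z> \<Longrightarrow> Z \<subseteq> M"
  shows "uniform_colouring d n m (neighbourhood M d s ` \<Z>)"
proof (rule uniform_colouring_pullback[OF assms(1), of 1 _ _ "2 * s"])
  fix X assume "X \<in> neighbourhood M d s ` \<Z>"
  then obtain Z where Z: "Z \<in> \<Z>" "X = neighbourhood M d s Z" by blast
  define p where "p x = (SOME y. y \<in> Z \<and> d x y \<le> s)" for x
  have p: "p x \<in> Z" "d x (p x) \<le> s" "x \<in> M" "p x \<in> M" if "x \<in> X" for x
    using that someI_ex[of "\<lambda>y. y \<in> Z \<and> d x y \<le> s"] assms(2)[OF Z(1)] Z by (auto simp: neighbourhood_def p_def)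
  have "d (p x) (p y) \<le> 1 * d x y + 2 * s \<and> d x y \<le> 1 * d (p x) (p y) + 2 * s"
    if "x \<in> X" "y \<in> X" for x y
    using p[OF that(1)] p[OF that(2)] triangle[of x "p x" y] triangle[of "p x" "p y" y]
      triangle[of "p x" x "p y"] triangle[of x y "p y"] commute[of x "p x"] commute[of y "p y"] by linarith
  then show "\<exists>Z'\<in>\<Z>. \<exists>\<phi>. \<phi> ` X \<subseteq> Z' \<and>
      (\<forall>x\<in>X. \<forall>y\<in>X. d (\<phi> x) (\<phi> y) \<le> 1 * d x y + 2 * s \<and> d x y \<le> 1 * d (\<phi> x) (\<phi> y) + 2 * s)"
    using p Z(1) by (intro bexI[of _ Z] exI[of _ p]) auto
qed auto

text \<open>Kolmogorov's trick. The given colour sets are enlarged to their \<open>r\<close>-neighbourhoods, and the new colour is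
  given to the points that still miss \<open>n\<close> colours. Along an \<open>r\<close>-chain of such points the set of missed
  colours is constant, so a component of the new colour set lies in a component of any of the old colour
  sets that its points do not miss.\<close>

lemma (in Metric_space) colouring_Suc:
  assumes col: "colouring d n m (3 * r) B Z" and "n < m" "Z \<subseteq> M" "0 \<le> r"
  shows "colouring d n (Suc m) r (B + 2 * r) Z"
proof -
  obtain Y where Y: "\<And>i. i < m \<Longrightarrow> Y i \<subseteq> Z" "\<And>i. i < m \<Longrightarrow> coarsely_discrete d (3 * r) B (Y i)"
    and card: "\<And>x. x \<in> Z \<Longrightarrow> card {i. i < m \<and> x \<notin> Y i} \<le> n"
    using col unfolding colouring_def by blast
  have "\<forall>i. i < m \<longrightarrow> (\<exists>f :: 'a \<Rightarrow> 'a set. \<forall>x\<in>Y i. \<forall>y\<in>Y i.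
      (d x y \<le> 3 * r \<longrightarrow> f x = f y) \<and> (f x = f y \<longrightarrow> d x y \<le> B))"
    using Y(2) unfolding coarsely_discrete_def by blast
  then obtain f :: "nat \<Rightarrow> 'a \<Rightarrow> 'a set" where
    f: "\<And>i x y. \<lbrakk>i < m; x \<in> Y i; y \<in> Y i; d x y \<le> 3 * r\<rbrakk> \<Longrightarrow> f i x = f i y"
      "\<And>i x y. \<lbrakk>i < m; x \<in> Y i; y \<in> Y i; f i x = f i y\<rbrakk> \<Longrightarrow> d x y \<le> B"
    by metis
  define J where "J x = {i. i < m \<and> x \<notin> Y i}" for x
  define X where "X i = Z \<inter> neighbourhood M d r (Y i)" for i
  have nbh: "y \<in> X i" if "x \<in> Y i" "y \<in> Z" "d x y \<le> r" for x y i
    using that assms(3) by (auto simp: X_def neighbourhood_def commute)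
  have X_J: "{i. i < m \<and> x \<notin> X i} \<subseteq> J x" if "x \<in> Z" for x
    using nbh[of x _ x] that assms(3,4) by (auto simp: J_def)
  have finJ: "finite (J x)" for x by (simp add: J_def)
  have leX: "card {i. i < m \<and> x \<notin> X i} \<le> n" if "x \<in> Z" for x
    using card_mono[OF finJ X_J[OF that]] card[OF that] by (simp add: J_def)
  \<comment> \<open>the points of the additional set lie in no neighbourhood that they do not have to lie in\<close>
  define T where "T = {x \<in> Z. card {i. i < m \<and> x \<notin> X i} = n}"
  have TJ: "J x = {i. i < m \<and> x \<notin> X i}" "card (J x) = n" if "x \<in> T" for x
  proof -
    have x: "x \<in> Z" "card {i. i < m \<and> x \<notin> X i} = n" using that by (auto simp: T_def)
    show "J x = {i. i < m \<and> x \<notin> X i}"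
      using card_seteq[OF finJ X_J[OF x(1)]] x card[OF x(1)] by (simp add: J_def)
    with x show "card (J x) = n" by simp
  qed
  have J_eq: "J x = J y" if "x \<in> T" "y \<in> T" "d x y \<le> r" for x y
  proof -
    have "J y \<subseteq> J x"
      using TJ(1)[OF that(2)] nbh[of x _ y] that by (auto simp: J_def T_def)
    then show ?thesis using card_seteq[OF finJ] TJ(2) that by (metis order_refl)
  qed
  define least where "least x = (LEAST i. i < m \<and> i \<notin> J x)" for x
  have least: "least x < m" "x \<in> Y (least x)" if "x \<in> T" for x
  proof -
    have "\<exists>i. i < m \<and> i \<notin> J x"
    proof (rule ccontr)
      assume "\<not> ?thesis"
      then have "{..<m} \<subseteq> J x" by auto
      then have "m \<le> n" using card_mono[OF finJ, of "{..<m}" x] TJ(2)[OF that] by simp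
      with \<open>n < m\<close> show False by simp
    qed
    then have "least x < m \<and> least x \<notin> J x" unfolding least_def by (rule LeastI_ex)
    then show "least x < m" "x \<in> Y (least x)" by (auto simp: J_def)
  qed
  have T: "coarsely_discrete d r (B + 2 * r) T"
  proof (rule coarsely_discreteI[where g = "\<lambda>x. (J x, f (least x) x)"])
    fix x y assume xy: "x \<in> T" "y \<in> T"
    have lxy: "least x = least y" if "J x = J y" using that by (simp add: least_def)
    show "(J x, f (least x) x) = (J y, f (least y) y)" if "d x y \<le> r"
      using J_eq[OF xy that] lxy f(1)[of "least x" x y] least[OF xy(1)] least[OF xy(2)] that assms(4) by auto
    show "d x y \<le> B + 2 * r" if "(J x, f (least x) x) = (J y, f (least y) y)"
      using that lxy f(2)[of "least x" x y] least[OF xy(1)] least[OF xy(2)] assms(4) by auto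
  qed
  have X: "coarsely_discrete d r (B + 2 * r) (X i)" if i: "i < m" for i
  proof -
    have "coarsely_discrete d r (B + 2 * r) (neighbourhood M d r (Y i))"
      using Y[OF i] assms(3,4) by (intro coarsely_discrete_neighbourhood) auto
    then show ?thesis by (rule coarsely_discrete_mono) (auto simp: X_def)
  qed
  define W where "W i = (if i = m then T else X i)" for i
  have "card {i. i < Suc m \<and> x \<notin> W i} \<le> n" if "x \<in> Z" for x
  proof (cases "x \<in> T")
    case True
    then have "{i. i < Suc m \<and> x \<notin> W i} = {i. i < m \<and> x \<notin> X i}" by (auto simp: W_def)
    then show ?thesis using leX[OF that] by simp
  next
    case False
    then have lt: "card {i. i < m \<and> x \<notin> X i} < n" using leX[OF that] that by (auto simp: T_def)
    have "{i. i < Suc m \<and> x \<notin> W i} \<subseteq> insert m {i. i < m \<and> x \<notin> X i}" by (auto simp: W_def)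
    then have "card {i. i < Suc m \<and> x \<notin> W i} \<le> card (insert m {i. i < m \<and> x \<notin> X i})"
      by (intro card_mono) auto
    also have "\<dots> \<le> Suc (card {i. i < m \<and> x \<notin> X i})" by (simp add: card_insert_le_m1)
    finally show ?thesis using lt by simp
  qed
  moreover have "W i \<subseteq> Z \<and> coarsely_discrete d r (B + 2 * r) (W i)" if "i < Suc m" for i
    using that X T by (auto simp: W_def X_def T_def)
  ultimately show ?thesis unfolding colouring_def by blast
qed

lemma (in Metric_space) uniform_colouring_more_colours:
  assumes "uniform_colouring d n m \<Z>" "n < m" "m \<le> m'" and sub: "\<And>Z. Z \<in> \<Z> \<Longrightarrow> Z \<subseteq> M"
  shows "uniform_colouring d n m' \<Z>"
  using assms(3)
proof (induction rule: dec_induct)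
  case (step k)
  show ?case
  proof (rule uniform_colouringI)
    fix r :: real assume "0 < r"
    obtain B where B: "\<And>Z. Z \<in> \<Z> \<Longrightarrow> colouring d n k (3 * r) B Z"
      using step.IH by (rule uniform_colouringE[where r = "3 * r"]) blast
    then have "\<forall>Z\<in>\<Z>. colouring d n (Suc k) r (B + 2 * r) Z"
      using colouring_Suc[of n k r B] sub \<open>0 < r\<close> step(1) assms(2) by auto
    then show "\<exists>B. \<forall>Z\<in>\<Z>. colouring d n (Suc k) r B Z" by blast
  qed
qed (use assms in simp)

lemma (in Metric_space) uniform_asdim_le_mono:
  assumes "uniform_asdim_le d n \<Z>" "n \<le> n'" "\<And>Z. Z \<in> \<Z> \<Longrightarrow> Z \<subseteq> M"
  shows "uniform_asdim_le d n' \<Z>"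
proof -
  have "uniform_colouring d n (Suc n') \<Z>"
    using assms by (intro uniform_colouring_more_colours[OF assms(1)]) auto
  then show ?thesis
    unfolding uniform_colouring_def by (meson assms(2) colouring_mono order_refl)
qed

text \<open>With \<open>n1 + n2 + 1\<close> colours on both factors, of which a point misses at most \<open>n1\<close> and \<open>n2\<close>, there is a
  colour that neither coordinate misses; so the products of colour sets with the same number work.\<close>

lemma uniform_asdim_le_product:
  fixes d1 :: "'a \<Rightarrow> 'a \<Rightarrow> real" and d2 :: "'b \<Rightarrow> 'b \<Rightarrow> real" and d :: "'c \<Rightarrow> 'c \<Rightarrow> real"
  assumes M1: "Metric_space M1 d1" and M2: "Metric_space M2 d2" and sub: "Z1 \<subseteq> M1" "Z2 \<subseteq> M2"
    and asdim: "uniform_asdim_le d1 n1 {Z1}" "uniform_asdim_le d2 n2 {Z2}"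
    and \<phi>: "\<phi>1 ` Z \<subseteq> Z1" "\<phi>2 ` Z \<subseteq> Z2" and "0 \<le> K"
    and up: "\<And>x y. \<lbrakk>x \<in> Z; y \<in> Z\<rbrakk> \<Longrightarrow> d1 (\<phi>1 x) (\<phi>1 y) \<le> K * d x y"
      "\<And>x y. \<lbrakk>x \<in> Z; y \<in> Z\<rbrakk> \<Longrightarrow> d2 (\<phi>2 x) (\<phi>2 y) \<le> K * d x y"
    and low: "\<And>x y. \<lbrakk>x \<in> Z; y \<in> Z\<rbrakk> \<Longrightarrow> d x y \<le> d1 (\<phi>1 x) (\<phi>1 y) + d2 (\<phi>2 x) (\<phi>2 y)"
  shows "uniform_asdim_le d (n1 + n2) {Z}"
proof (rule uniform_colouringI)
  fix r :: real assume "0 < r"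
  let ?m = "Suc (n1 + n2)"
  have u1: "uniform_colouring d1 n1 ?m {Z1}"
    using sub by (intro Metric_space.uniform_colouring_more_colours[OF M1 asdim(1)]) auto
  have u2: "uniform_colouring d2 n2 ?m {Z2}"
    using sub by (intro Metric_space.uniform_colouring_more_colours[OF M2 asdim(2)]) auto
  obtain B1 where "colouring d1 n1 ?m (K * r) B1 Z1"
    using u1 by (rule uniform_colouringE[where r = "K * r"]) blast
  then obtain Y1 where Y1: "\<And>i. i < ?m \<Longrightarrow> coarsely_discrete d1 (K * r) B1 (Y1 i)"
    and card1: "\<And>x. x \<in> Z1 \<Longrightarrow> card {i. i < ?m \<and> x \<notin> Y1 i} \<le> n1"
    unfolding colouring_def by blast
  obtain B2 where "colouring d2 n2 ?m (K * r) B2 Z2"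
    using u2 by (rule uniform_colouringE[where r = "K * r"]) blast
  then obtain Y2 where Y2: "\<And>i. i < ?m \<Longrightarrow> coarsely_discrete d2 (K * r) B2 (Y2 i)"
    and card2: "\<And>x. x \<in> Z2 \<Longrightarrow> card {i. i < ?m \<and> x \<notin> Y2 i} \<le> n2"
    unfolding colouring_def by blast
  define Y where "Y i = {x \<in> Z. \<phi>1 x \<in> Y1 i \<and> \<phi>2 x \<in> Y2 i}" for i
  have "coarsely_discrete d r (B1 + B2) (Y i)" if i: "i < ?m" for i
  proof -
    obtain f1 :: "'a \<Rightarrow> 'a set" where f1: "\<forall>x\<in>Y1 i. \<forall>y\<in>Y1 i.
        (d1 x y \<le> K * r \<longrightarrow> f1 x = f1 y) \<and> (f1 x = f1 y \<longrightarrow> d1 x y \<le> B1)"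
      using Y1[OF i] by (rule coarsely_discreteE)
    note f1 = f1[rule_format, THEN conjunct1, rule_format] f1[rule_format, THEN conjunct2, rule_format]
    obtain f2 :: "'b \<Rightarrow> 'b set" where f2: "\<forall>x\<in>Y2 i. \<forall>y\<in>Y2 i.
        (d2 x y \<le> K * r \<longrightarrow> f2 x = f2 y) \<and> (f2 x = f2 y \<longrightarrow> d2 x y \<le> B2)"
      using Y2[OF i] by (rule coarsely_discreteE)
    note f2 = f2[rule_format, THEN conjunct1, rule_format] f2[rule_format, THEN conjunct2, rule_format]
    show ?thesis
    proof (rule coarsely_discreteI[where g = "\<lambda>x. (f1 (\<phi>1 x), f2 (\<phi>2 x))"])
      fix x y assume xy: "x \<in> Y i" "y \<in> Y i"
      then have in_Z: "x \<in> Z" "y \<in> Z" by (auto simp: Y_def)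
      show "(f1 (\<phi>1 x), f2 (\<phi>2 x)) = (f1 (\<phi>1 y), f2 (\<phi>2 y))" if "d x y \<le> r"
      proof -
        have "K * d x y \<le> K * r" using that \<open>0 \<le> K\<close> by (rule mult_left_mono)
        then show ?thesis using up[OF in_Z] xy f1(1) f2(1) by (auto simp: Y_def)
      qed
      show "d x y \<le> B1 + B2" if "(f1 (\<phi>1 x), f2 (\<phi>2 x)) = (f1 (\<phi>1 y), f2 (\<phi>2 y))"
        using that low[OF in_Z] xy f1(2)[of "\<phi>1 x" "\<phi>1 y"] f2(2)[of "\<phi>2 x" "\<phi>2 y"]
        by (auto simp: Y_def)
    qed
  qed
  moreover have "card {i. i < ?m \<and> x \<notin> Y i} \<le> n1 + n2" if "x \<in> Z" for x
  proof -
    have "{i. i < ?m \<and> x \<notin> Y i} = {i. i < ?m \<and> \<phi>1 x \<notin> Y1 i} \<union> {i. i < ?m \<and> \<phi>2 x \<notin> Y2 i}"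
      using that by (auto simp: Y_def)
    then have "card {i. i < ?m \<and> x \<notin> Y i} \<le> card {i. i < ?m \<and> \<phi>1 x \<notin> Y1 i} + card {i. i < ?m \<and> \<phi>2 x \<notin> Y2 i}"
      by (simp only: card_Un_le)
    also have "\<dots> \<le> n1 + n2" using card1[of "\<phi>1 x"] card2[of "\<phi>2 x"] \<phi> that by (intro add_mono) auto
    finally show ?thesis .
  qed
  ultimately have "colouring d (n1 + n2) ?m r (B1 + B2) Z"
    unfolding colouring_def by (intro exI[of _ Y]) (auto simp: Y_def)
  then show "\<exists>B. \<forall>Z\<in>{Z}. colouring d (n1 + n2) ?m r B Z" by blast
qed

section \<open>Infinite unions\<close>

text \<open>Outside a large neighbourhood of \<open>Y\<close> the sets \<open>Z i\<close> are far from each other, so that the components of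
  their colour sets stay separate. The neighbourhood of \<open>Y\<close> is coloured afterwards, at a scale at which
  its components absorb those of the sets \<open>Z i\<close>.\<close>

lemma (in Metric_space) uniform_asdim_le_infinite_union:
  assumes Y: "uniform_asdim_le d n {Y}" and Z: "uniform_asdim_le d n (Z ` I)"
    and sub: "Y \<subseteq> M" "\<And>i. i \<in> I \<Longrightarrow> Z i \<subseteq> M"
    and sep: "\<And>r. 0 < r \<Longrightarrow> \<exists>\<rho>. \<forall>i\<in>I. \<forall>j\<in>I. \<forall>x\<in>Z i. \<forall>y\<in>Z j.
      i \<noteq> j \<longrightarrow> d x y \<le> r \<longrightarrow> x \<in> neighbourhood M d \<rho> Y"
  shows "uniform_asdim_le d n {Y \<union> (\<Union>i\<in>I. Z i)}"
proof (rule uniform_colouringI)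
  fix r :: real assume r: "0 < r"
  obtain \<rho> where \<rho>: "\<And>i j x y. \<lbrakk>i \<in> I; j \<in> I; x \<in> Z i; y \<in> Z j; i \<noteq> j; d x y \<le> r\<rbrakk> \<Longrightarrow> x \<in> neighbourhood M d \<rho> Y"
    using sep[OF r] by blast
  define N where "N = neighbourhood M d (max \<rho> 0) Y"
  have N: "Y \<subseteq> N" "N \<subseteq> M" using sub by (force simp: N_def neighbourhood_def)+
  have \<rho>_N: "x \<in> N" if "x \<in> neighbourhood M d \<rho> Y" for x
    using that by (force simp: N_def neighbourhood_def)
  obtain D where D: "0 \<le> D" "\<And>W. W \<in> Z ` I \<Longrightarrow> colouring d n (Suc n) r D W"
    using Z by (rule uniform_colouringE[where r = r]) blast
  have "uniform_asdim_le d n {N}"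
    using uniform_colouring_neighbourhood[OF Y, of "max \<rho> 0"] sub by (simp add: N_def)
  then obtain B where B: "0 \<le> B" "colouring d n (Suc n) (D + 2 * r) B N"
    by (rule uniform_colouringE[where r = "D + 2 * r"]) blast
  obtain V where V: "\<And>c. c < Suc n \<Longrightarrow> V c \<subseteq> N" "\<And>c. c < Suc n \<Longrightarrow> coarsely_discrete d (D + 2 * r) B (V c)"
    and V_card: "\<And>x. x \<in> N \<Longrightarrow> card {c. c < Suc n \<and> x \<notin> V c} \<le> n"
    using B(2) unfolding colouring_def by blast
  have "\<forall>i. \<exists>F. i \<in> I \<longrightarrow> (\<forall>c<Suc n. F c \<subseteq> Z i \<and> coarsely_discrete d r D (F c)) \<and>
      (\<forall>x\<in>Z i. card {c. c < Suc n \<and> x \<notin> F c} \<le> n)"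
    using D(2) unfolding colouring_def by blast
  then obtain F where F: "\<And>i. i \<in> I \<Longrightarrow> (\<forall>c<Suc n. F i c \<subseteq> Z i \<and> coarsely_discrete d r D (F i c)) \<and>
      (\<forall>x\<in>Z i. card {c. c < Suc n \<and> x \<notin> F i c} \<le> n)"
    by metis
  define ix where "ix x = (SOME i. i \<in> I \<and> x \<in> Z i)" for x
  have ix: "ix x \<in> I" "x \<in> Z (ix x)" if "i \<in> I" "x \<in> Z i" for i x
    using someI[of "\<lambda>i. i \<in> I \<and> x \<in> Z i" i] that by (auto simp: ix_def)
  define U where "U c = {x. (\<exists>i\<in>I. x \<in> Z i) \<and> x \<notin> N \<and> x \<in> F (ix x) c}" for c
  have U_M: "U c \<subseteq> M" for c using sub(2) by (fastforce simp: U_def)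
  have U: "coarsely_discrete d r D (U c)" if c: "c < Suc n" for c
  proof (rule coarsely_discrete_fibres[where g = ix])
    fix x y assume xy: "x \<in> U c" "y \<in> U c" "d x y \<le> r"
    then have "ix x \<in> I" "x \<in> Z (ix x)" "ix y \<in> I" "y \<in> Z (ix y)" "x \<notin> N"
      using ix by (auto simp: U_def)
    then show "ix x = ix y" using \<rho>[of "ix x" "ix y" x y] \<rho>_N[of x] xy(3) by metis
  next
    fix i
    show "coarsely_discrete d r D {x \<in> U c. ix x = i}"
    proof (cases "i \<in> I")
      case True
      then have "coarsely_discrete d r D (F i c)" using F c by blast
      then show ?thesis by (rule coarsely_discrete_mono) (auto simp: U_def)
    next
      case False
      then have "{x \<in> U c. ix x = i} = {}" using ix by (auto simp: U_def)
      then show ?thesis by (simp only:) (simp add: coarsely_discrete_def)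
    qed
  qed
  define W where "W c = (U c \<union> V c) \<inter> (Y \<union> (\<Union>i\<in>I. Z i))" for c
  have "coarsely_discrete d r (B + 2 * (D + r)) (W c)" if c: "c < Suc n" for c
  proof -
    have "coarsely_discrete d r (B + 2 * (D + r)) (U c \<union> V c)"
      using U[OF c] V[OF c] U_M[of c] N(2) r D(1) B(1) by (intro coarsely_discrete_Un) auto
    then show ?thesis by (rule coarsely_discrete_mono) (auto simp: W_def)
  qed
  moreover have "card {c. c < Suc n \<and> x \<notin> W c} \<le> n" if x: "x \<in> Y \<union> (\<Union>i\<in>I. Z i)" for x
  proof (cases "x \<in> N")
    case True
    have "card {c. c < Suc n \<and> x \<notin> W c} \<le> card {c. c < Suc n \<and> x \<notin> V c}"
      using x by (intro card_mono) (auto simp: W_def)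
    then show ?thesis using V_card[OF True] by simp
  next
    case False
    then obtain i where i: "i \<in> I" "x \<in> Z i" using x N by blast
    have "card {c. c < Suc n \<and> x \<notin> W c} \<le> card {c. c < Suc n \<and> x \<notin> F (ix x) c}"
      using x False i by (intro card_mono) (auto simp: W_def U_def)
    moreover have "card {c. c < Suc n \<and> x \<notin> F (ix x) c} \<le> n" using F ix[OF i] by blast
    ultimately show ?thesis by simp
  qed
  ultimately have "colouring d n (Suc n) r (B + 2 * (D + r)) (Y \<union> (\<Union>i\<in>I. Z i))"
    unfolding colouring_def by (intro exI[of _ W]) (auto simp: W_def)
  then show "\<exists>B. \<forall>Z\<in>{Y \<union> (\<Union>i\<in>I. Z i)}. colouring d n (Suc n) r B Z" by blast
qed

section \<open>Comparison with covers of bounded multiplicity\<close>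

lemma card_missed_le_iff:
  "card {c. c < Suc n \<and> \<not> P c} \<le> n \<longleftrightarrow> (\<exists>c<Suc n. P c)"
proof
  assume le: "card {c. c < Suc n \<and> \<not> P c} \<le> n"
  show "\<exists>c<Suc n. P c"
  proof (rule ccontr)
    assume "\<not> ?thesis"
    then have "{c. c < Suc n \<and> \<not> P c} = {..<Suc n}" by auto
    with le show False by simp
  qed
next
  assume "\<exists>c<Suc n. P c"
  then have "{c. c < Suc n \<and> \<not> P c} \<subset> {..<Suc n}" by auto
  then have "card {c. c < Suc n \<and> \<not> P c} < card {..<Suc n}" by (intro psubset_card_mono) auto
  then show "card {c. c < Suc n \<and> \<not> P c} \<le> n" by simp
qed

lemma stationary_index:
  fixes N :: "nat \<Rightarrow> 'b set"
  assumes "mono N" "N 0 \<noteq> {}" "finite (N (Suc n))" "card (N (Suc n)) \<le> Suc n"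
  shows "\<exists>c<Suc n. N c = N (Suc c)"
proof (rule ccontr)
  assume neq: "\<not> ?thesis"
  have fin: "finite (N c)" if "c \<le> Suc n" for c
    using assms(3) monoD[OF assms(1) that] by (rule rev_finite_subset)
  have "c \<le> Suc n \<Longrightarrow> Suc c \<le> card (N c)" for c
  proof (induction c)
    case 0
    then show ?case using assms(2) fin[of 0] by (simp add: Suc_le_eq card_gt_0_iff)
  next
    case (Suc c)
    then have "N c \<noteq> N (Suc c)" using neq by auto
    then have "N c \<subset> N (Suc c)" using monoD[OF assms(1), of c "Suc c"] by auto
    then have "card (N c) < card (N (Suc c))" using fin[OF Suc.prems] by (intro psubset_card_mono)
    then show ?case using Suc by simp
  qed
  from this[of "Suc n"] assms(4) show False by simp
qed

text \<open>For a cover with large multiplicity radius, the members that meet balls of increasing radii around a point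
  form an increasing sequence of sets. This sequence must be stationary somewhere. The place where it is
  stationary is the colour, and the common value of the sequence, which does not change along short steps,
  labels the component.\<close>

lemma (in Metric_space) uniform_asdim_le_if_asdim_le:
  assumes "asdim_le n"
  shows "uniform_asdim_le d n {M}"
proof (rule uniform_colouringI)
  fix r :: real assume r: "0 < r"
  define g where "g = 2 * r"
  have g: "0 < g" "r < g" using r by (auto simp: g_def)
  obtain \<V> where \<V>: "\<Union>\<V> = M" "uniformly_bounded \<V>" "multiplicity_le (real (Suc (Suc n)) * g) \<V> (n + 1)"
    using assms unfolding asdim_le_def by blast
  obtain B where B: "\<And>U x y. \<lbrakk>U \<in> \<V>; x \<in> U; y \<in> U\<rbrakk> \<Longrightarrow> d x y \<le> B"
    using \<V>(2) unfolding uniformly_bounded_def by blast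
  \<comment> \<open>\<open>N x k\<close> grows with \<open>k\<close> from a non-empty set to a set of at most \<open>n + 1\<close> elements, so it is
    stationary at one of \<open>n + 1\<close> steps; that step is the colour of \<open>x\<close>.\<close>
  define N where "N x k = {U \<in> \<V>. U \<inter> mball x (real (Suc k) * g) \<noteq> {}}" for x k
  have mono: "mono (N x)" for x
  proof (rule monoI)
    fix k l :: nat assume "k \<le> l"
    then have "real (Suc k) * g \<le> real (Suc l) * g" using g by (intro mult_right_mono) auto
    then have "mball x (real (Suc k) * g) \<subseteq> mball x (real (Suc l) * g)" by (rule mball_subset_concentric)
    then show "N x k \<subseteq> N x l" unfolding N_def by blast
  qed
  have ne: "N x k \<noteq> {}" if x: "x \<in> M" for x k
  proof -
    obtain U where "U \<in> \<V>" "x \<in> U" using x \<V>(1) by blast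
    moreover have "x \<in> mball x (real (Suc k) * g)" using x g by simp
    ultimately show ?thesis unfolding N_def by blast
  qed
  have shift: "N x k \<subseteq> N y (Suc k)" if "x \<in> M" "y \<in> M" "d x y \<le> r" for x y k
  proof -
    have "mball x (real (Suc k) * g) \<subseteq> mball y (real (Suc (Suc k)) * g)"
    proof
      fix z assume "z \<in> mball x (real (Suc k) * g)"
      then have z: "z \<in> M" "d x z < real (Suc k) * g" by auto
      have "d y z \<le> d y x + d x z" using triangle that z by blast
      then have "d y z < real (Suc (Suc k)) * g" using z that g by (simp add: commute algebra_simps)
      then show "z \<in> mball y (real (Suc (Suc k)) * g)" using z that by simp
    qed
    then show ?thesis unfolding N_def by blast
  qed
  define Y where "Y c = {x \<in> M. N x c = N x (Suc c)}" for c
  define B' where "B' = B + 2 * (real (Suc n) * g)"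
  have "coarsely_discrete d r B' (Y c)" if c: "c < Suc n" for c
  proof (rule coarsely_discreteI[where g = "\<lambda>x. N x c"])
    fix x y assume xy: "x \<in> Y c" "y \<in> Y c"
    then have M: "x \<in> M" "y \<in> M" by (auto simp: Y_def)
    show "N x c = N y c" if "d x y \<le> r"
      using shift[OF M that, of c] shift[of y x c] that M xy by (auto simp: Y_def commute)
    show "d x y \<le> B'" if eq: "N x c = N y c"
    proof -
      obtain U where U: "U \<in> N x c" "U \<in> N y c" using ne[OF M(1), of c] eq by blast
      obtain a where a: "a \<in> U" "a \<in> M" "d x a < real (Suc c) * g" using U(1) by (auto simp: N_def)
      obtain b where b: "b \<in> U" "b \<in> M" "d y b < real (Suc c) * g" using U(2) by (auto simp: N_def)
      have "d a b \<le> B" using B a b U(1) by (auto simp: N_def)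
      moreover have "d x y \<le> d x a + d a b + d b y"
        using triangle[of x a y] triangle[of a b y] a b M by linarith
      moreover have "real (Suc c) * g \<le> real (Suc n) * g" using c g by (intro mult_right_mono) auto
      ultimately show ?thesis using a b commute[of b y] by (simp add: B'_def)
    qed
  qed
  moreover have "card {c. c < Suc n \<and> x \<notin> Y c} \<le> n" if x: "x \<in> M" for x
  proof -
    have "finite (N x (Suc n)) \<and> card (N x (Suc n)) \<le> Suc n"
      using \<V>(3) x unfolding multiplicity_le_def N_def by auto
    then obtain c where "c < Suc n" "N x c = N x (Suc c)"
      using stationary_index[OF mono ne[OF x, of 0], of n] by blast
    then show ?thesis using x by (subst card_missed_le_iff) (auto simp: Y_def)
  qed
  ultimately have "colouring d n (Suc n) r B' M"
    unfolding colouring_def by (intro exI[of _ Y]) (auto simp: Y_def)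
  then show "\<exists>B. \<forall>Z\<in>{M}. colouring d n (Suc n) r B Z" by blast
qed

text \<open>The components of the colour sets form the cover: at scale \<open>2 r\<close>, a ball of radius \<open>r\<close> meets at most one
  component of each colour.\<close>

lemma (in Metric_space) asdim_le_if_uniform_asdim_le:
  assumes "uniform_asdim_le d n {M}"
  shows "asdim_le n"
  unfolding asdim_le_def
proof
  fix r :: real
  obtain B where "colouring d n (Suc n) (2 * r) B M"
    using assms by (rule uniform_colouringE[where r = "2 * r"]) blast
  then obtain Y where Y: "\<And>c. c < Suc n \<Longrightarrow> Y c \<subseteq> M" "\<And>c. c < Suc n \<Longrightarrow> coarsely_discrete d (2 * r) B (Y c)"
    and card: "\<And>x. x \<in> M \<Longrightarrow> card {c. c < Suc n \<and> x \<notin> Y c} \<le> n"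
    unfolding colouring_def by blast
  have "\<forall>c. \<exists>f :: 'a \<Rightarrow> 'a set. c < Suc n \<longrightarrow> (\<forall>x\<in>Y c. \<forall>y\<in>Y c.
      (d x y \<le> 2 * r \<longrightarrow> f x = f y) \<and> (f x = f y \<longrightarrow> d x y \<le> B))"
    using Y(2) unfolding coarsely_discrete_def by blast
  then obtain f :: "nat \<Rightarrow> 'a \<Rightarrow> 'a set" where
    f: "\<And>c x y. \<lbrakk>c < Suc n; x \<in> Y c; y \<in> Y c; d x y \<le> 2 * r\<rbrakk> \<Longrightarrow> f c x = f c y"
      "\<And>c x y. \<lbrakk>c < Suc n; x \<in> Y c; y \<in> Y c; f c x = f c y\<rbrakk> \<Longrightarrow> d x y \<le> B"
    by metis
  define cls where "cls c x = {y \<in> Y c. f c y = f c x}" for c x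
  define \<V> where "\<V> = {cls c x | c x. c < Suc n \<and> x \<in> Y c}"
  have "\<Union>\<V> = M"
  proof
    show "\<Union>\<V> \<subseteq> M" using Y(1) by (auto simp: \<V>_def cls_def)
    show "M \<subseteq> \<Union>\<V>"
    proof
      fix x assume "x \<in> M"
      then obtain c where "c < Suc n" "x \<in> Y c" using card card_missed_le_iff[of n "\<lambda>c. x \<in> Y c"] by blast
      then show "x \<in> \<Union>\<V>" unfolding \<V>_def cls_def by blast
    qed
  qed
  moreover have "uniformly_bounded \<V>"
    unfolding uniformly_bounded_def by (rule exI[of _ B]) (use f(2) in \<open>auto simp: \<V>_def cls_def\<close>)
  moreover have "multiplicity_le r \<V> (n + 1)"
    unfolding multiplicity_le_def
  proof (intro ballI)
    fix x assume x: "x \<in> M"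
    define p where "p c = (SOME y. y \<in> Y c \<and> y \<in> mball x r)" for c
    have "{U \<in> \<V>. U \<inter> mball x r \<noteq> {}} \<subseteq> (\<lambda>c. cls c (p c)) ` {..<Suc n}"
    proof
      fix U assume "U \<in> {U \<in> \<V>. U \<inter> mball x r \<noteq> {}}"
      then have "U \<in> \<V>" "\<exists>y. y \<in> U \<and> y \<in> mball x r" by auto
      then obtain c z y where c: "c < Suc n" "z \<in> Y c" "U = cls c z" and y: "y \<in> U" "y \<in> mball x r"
        unfolding \<V>_def by blast
      then have yY: "y \<in> Y c" "f c y = f c z" by (auto simp: cls_def)
      have "\<exists>y. y \<in> Y c \<and> y \<in> mball x r" using yY(1) y(2) by blast
      then have "p c \<in> Y c \<and> p c \<in> mball x r" unfolding p_def by (rule someI_ex)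
      then have p: "p c \<in> Y c" "p c \<in> M" "d x (p c) < r" by auto
      have "d y (p c) \<le> d y x + d x (p c)" using triangle[of y x "p c"] y(2) p x by auto
      then have "d y (p c) \<le> 2 * r" using y(2) p by (simp add: commute)
      then have "f c y = f c (p c)" using f(1)[OF c(1) yY(1) p(1)] by simp
      then show "U \<in> (\<lambda>c. cls c (p c)) ` {..<Suc n}" using c yY by (auto simp: cls_def)
    qed
    moreover have "card ((\<lambda>c. cls c (p c)) ` {..<Suc n}) \<le> n + 1" using card_image_le[of "{..<Suc n}" "\<lambda>c. cls c (p c)"] by simp
    ultimately show "finite {U \<in> \<V>. U \<inter> mball x r \<noteq> {}} \<and> card {U \<in> \<V>. U \<inter> mball x r \<noteq> {}} \<le> n + 1"
      by (meson card_mono finite_imageI finite_lessThan finite_subset le_trans)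
  qed
  ultimately show "\<exists>\<V>. \<Union>\<V> = M \<and> uniformly_bounded \<V> \<and> multiplicity_le r \<V> (n + 1)" by blast
qed

section \<open>Gluing along a tree\<close>

text \<open>Words are built by adding letters at the head, so the words that extend \<open>u\<close> are those with suffix \<open>u\<close>.\<close>

definition branch :: "'a set \<Rightarrow> ('a \<Rightarrow> 'l list) \<Rightarrow> 'l list \<Rightarrow> 'a set" where
  "branch M \<pi> u = {x \<in> M. suffix u (\<pi> x)}"

definition branch_boundary :: "'a set \<Rightarrow> ('a \<Rightarrow> 'a \<Rightarrow> real) \<Rightarrow> ('a \<Rightarrow> 'l list) \<Rightarrow> real \<Rightarrow> 'l list \<Rightarrow> 'a set" where
  "branch_boundary M d \<pi> \<rho> u = {x \<in> branch M \<pi> u. \<exists>y\<in>M - branch M \<pi> u. d x y \<le> \<rho>}"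

definition branch_piece :: "'a set \<Rightarrow> ('a \<Rightarrow> 'l list) \<Rightarrow> nat \<Rightarrow> 'l list \<Rightarrow> 'a set" where
  "branch_piece M \<pi> N u = {x \<in> branch M \<pi> u. length (\<pi> x) \<le> length u + N}"

text \<open>The hypothesis \<open>tree\<close> says that \<open>\<pi>\<close> is Lipschitz for the metric of the tree of words. The tree is cut at
  the levels \<open>R, 2 R, \<dots>\<close>. For a word \<open>u\<close> at one of these levels, the points of the branch at \<open>u\<close> are
  sorted by their distance from the complement of the branch: the nearest ones (\<open>z \<le> 1\<close>) are added to the
  piece above, those with \<open>z = c + 2\<close> for a colour \<open>c\<close> form the layers, and the far ones (\<open>z > k + 3\<close>)
  belong to the piece of \<open>u\<close>. First the layers are coloured, with a bound \<open>D\<close>, and then the pieces at a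
  scale that is large in comparison with \<open>D\<close>. As the layer \<open>c\<close> avoids the colour \<open>c\<close>, a component of this
  colour meets only one piece and layers at the border of that piece, and its parts in the layers are absorbed
  by the larger sets in the piece.\<close>

lemma (in Metric_space) tree_gluing:
  fixes \<pi> :: "'a \<Rightarrow> 'l list"
  assumes root: "x0 \<in> M" "\<pi> x0 = []"
    and tree: "\<And>x y. \<lbrakk>x \<in> M; y \<in> M\<rbrakk> \<Longrightarrow> \<exists>p. suffix p (\<pi> x) \<and> suffix p (\<pi> y) \<and>
      length (\<pi> x) \<le> length p + d x y \<and> length (\<pi> y) \<le> length p + d x y"
    and boundary: "\<And>\<rho>. uniform_asdim_le d k (branch_boundary M d \<pi> \<rho> ` {u. u \<noteq> []})"
    and piece: "\<And>N. uniform_asdim_le d (Suc k) (range (branch_piece M \<pi> N))"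
  shows "uniform_asdim_le d (Suc k) {M}"
proof (rule uniform_colouringI)
  fix s :: real assume s: "0 < s"
  define n where "n = Suc k"
  \<comment> \<open>The boundaries have \<open>n + 2\<close> units of thickness; the remaining units ensure that the boundaries at one
    level are far from those at the next level.\<close>
  define R where "R = nat \<lceil>(real n + 4) * s\<rceil>"
  have R: "(real n + 4) * s \<le> real R" unfolding R_def by linarith
  have R4: "real n * s + 4 * s \<le> real R" using R by (simp add: algebra_simps)
  have ns: "0 \<le> real n * s" using s by simp
  have R0: "0 < R" using R4 ns s by linarith
  let ?\<rho> = "real (n + 2) * s"
  \<comment> \<open>colourings of the boundaries with \<open>k + 2\<close> colours, of which a point misses at most \<open>k\<close>\<close>
  have "uniform_colouring d k (Suc n) (branch_boundary M d \<pi> ?\<rho> ` {u. u \<noteq> []})"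
    by (rule uniform_colouring_more_colours[OF boundary]) (auto simp: n_def branch_boundary_def branch_def)
  then obtain D where D: "0 \<le> D"
    "\<And>W. W \<in> branch_boundary M d \<pi> ?\<rho> ` {u. u \<noteq> []} \<Longrightarrow> colouring d k (Suc n) s D W"
    by (rule uniform_colouringE[where r = s]) blast
  obtain B where B: "0 \<le> B"
    "\<And>W. W \<in> range (branch_piece M \<pi> (2 * R)) \<Longrightarrow> colouring d n (Suc n) (D + 2 * s) B W"
    using piece[of "2 * R"] unfolding n_def by (rule uniform_colouringE[where r = "D + 2 * s"]) blast
  obtain F where F: "\<forall>u\<in>{u. u \<noteq> []}.
      (\<forall>c<Suc n. F u c \<subseteq> branch_boundary M d \<pi> ?\<rho> u \<and> coarsely_discrete d s D (F u c)) \<and>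
      (\<forall>x\<in>branch_boundary M d \<pi> ?\<rho> u. card {c. c < Suc n \<and> x \<notin> F u c} \<le> k)"
    using D(2) by (rule colouring_choice)
  obtain P where P: "\<forall>u\<in>UNIV.
      (\<forall>c<Suc n. P u c \<subseteq> branch_piece M \<pi> (2 * R) u \<and> coarsely_discrete d (D + 2 * s) B (P u c)) \<and>
      (\<forall>x\<in>branch_piece M \<pi> (2 * R) u. card {c. c < Suc n \<and> x \<notin> P u c} \<le> n)"
    using B(2) by (rule colouring_choice)
  \<comment> \<open>\<open>anc j w\<close> is the ancestor of \<open>w\<close> at level \<open>j * R\<close>, and \<open>cut x\<close> is the last one on the way to \<open>\<pi> x\<close>.\<close>
  define anc where "anc j w = drop (length w - j * R) w" for j and w :: "'l list"
  have anc_suffix: "suffix (anc j w) w" for j w by (simp add: anc_def suffix_drop)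
  have anc_length: "length (anc j w) = j * R" if "j * R \<le> length w" for j w
    using that by (simp add: anc_def)
  have anc_eq: "anc j p = anc j w" if "suffix p w" "j * R \<le> length p" for j p w
    using that by (auto simp: anc_def suffix_def)
  have anc_unique: "u = anc j w" if "suffix u w" "length u = j * R" for u j w
    using anc_eq[of u w j] that by (simp add: anc_def)
  have drop_anc: "drop R (anc (Suc j) w) = anc j w" if "Suc j * R \<le> length w" for j w
    using that by (simp add: anc_def)
  define lev where "lev x = length (\<pi> x) div R" for x
  have lev: "lev x * R \<le> length (\<pi> x)" "length (\<pi> x) < Suc (lev x) * R" for x
    using R0 by (simp_all add: lev_def) (metis dividend_less_times_div mult.commute mult_Suc)
  define cut where "cut x = anc (lev x) (\<pi> x)" for x
  have cut: "suffix (cut x) (\<pi> x)" "length (cut x) = lev x * R" for x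
    using anc_suffix anc_length lev by (auto simp: cut_def)
  have cut_Nil: "cut x = [] \<longleftrightarrow> lev x = 0" for x using cut(2)[of x] R0 by auto
  \<comment> \<open>\<open>lam u x\<close> is the distance of \<open>x\<close> from the complement of the branch at \<open>u\<close>, in units of \<open>s\<close>; the root
    belongs to the complement if \<open>u \<noteq> []\<close>, so that the minimum exists.\<close>
  define lam where "lam u x = (LEAST j. \<exists>y\<in>M. \<not> suffix u (\<pi> y) \<and> d x y \<le> real j * s)" for u x
  have lam_le: "lam u x \<le> j" if "y \<in> M" "\<not> suffix u (\<pi> y)" "d x y \<le> real j * s" for u x y j
    unfolding lam_def using that by (intro Least_le) blast
  have lam_ex: "\<exists>y\<in>M. \<not> suffix u (\<pi> y) \<and> d x y \<le> real (lam u x) * s" if "u \<noteq> []" for u x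
  proof -
    obtain j where "d x x0 < real j * s" using s reals_Archimedean3 by blast
    then have "\<exists>j. \<exists>y\<in>M. \<not> suffix u (\<pi> y) \<and> d x y \<le> real j * s"
      using root that by (intro exI[of _ j] bexI[of _ x0]) auto
    then show ?thesis unfolding lam_def by (rule LeastI_ex)
  qed
  have lam_step: "lam u x \<le> Suc (lam u y)" if u: "u \<noteq> []" and xy: "x \<in> M" "y \<in> M" "d x y \<le> s" for u x y
  proof -
    obtain y' where y': "y' \<in> M" "\<not> suffix u (\<pi> y')" "d y y' \<le> real (lam u y) * s"
      using lam_ex[OF u] by blast
    then have "d x y' \<le> real (Suc (lam u y)) * s"
      using triangle[of x y y'] xy by (simp add: algebra_simps)
    then show ?thesis using y' by (intro lam_le)
  qed
  \<comment> \<open>The piece at the root has no complement; its points count as far from it.\<close>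
  define z where "z x = (if lev x = 0 then n + 3 else lam (cut x) x)" for x
  \<comment> \<open>The set \<open>{x. z x = c + 2}\<close> separates the two sides of the boundary and avoids colour \<open>c\<close>.\<close>
  define region where "region c x = (if z x > c + 2 then cut x else drop R (cut x))" for c x
  \<comment> \<open>Let \<open>x\<close> and \<open>y\<close> be close to each other with different cuts. Each of them is either at the level of
    \<open>p\<close> and far from the root of its branch, or one level deeper and close to that root. So neither
    lies in a layer, and both belong to the piece of the ancestor of \<open>p\<close>.\<close>
  have side: "(lev x = length p div R \<and> n + 3 \<le> z x) \<or> (lev x = Suc (length p div R) \<and> z x \<le> 1)"
    if xy: "x \<in> M" "y \<in> M" "d x y \<le> s" "cut x \<noteq> cut y"
      and p: "suffix p (\<pi> x)" "suffix p (\<pi> y)" "length (\<pi> x) \<le> length p + d x y"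
        "length (\<pi> y) \<le> length p + d x y" for x y p
  proof -
    let ?j = "length p div R"
    have lens: "length p \<le> length (\<pi> x)" "length p \<le> length (\<pi> y)"
      using p suffix_length_le by auto
    have upper: "lev a \<le> Suc ?j" if "length (\<pi> a) \<le> length p + d x y" for a
    proof -
      have "real (length (\<pi> a)) < real (length p) + real R" using that xy R4 ns s by linarith
      then have "length (\<pi> a) < length p + R" by linarith
      then have "lev a \<le> (length p + R) div R" unfolding lev_def by (intro div_le_mono) simp
      then show ?thesis using R0 by simp
    qed
    have levs: "?j \<le> lev x" "?j \<le> lev y" "lev x \<le> Suc ?j" "lev y \<le> Suc ?j"
      using lens upper p unfolding lev_def by (auto intro: div_le_mono)
    have jp: "?j * R \<le> length p" by simp
    show ?thesis
    proof (cases "lev x = Suc ?j")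
      case True
      have "\<not> suffix (cut x) (\<pi> y)"
      proof
        assume suf: "suffix (cut x) (\<pi> y)"
        have len: "length (cut x) = Suc ?j * R" using cut(2)[of x] True by simp
        then have "Suc ?j * R \<le> length (\<pi> y)" using suffix_length_le[OF suf] by simp
        then have "Suc ?j \<le> lev y" unfolding lev_def using R0 by (simp add: less_eq_div_iff_mult_less_eq)
        then have "lev y = Suc ?j" using levs by simp
        then have "cut x = cut y" using anc_unique[OF suf len] by (simp add: cut_def)
        with xy show False by simp
      qed
      then have "lam (cut x) x \<le> 1" using xy by (intro lam_le[of y]) auto
      then show ?thesis using True by (simp add: z_def)
    next
      case False
      then have lx: "lev x = ?j" using levs by simp
      have "lev y \<noteq> ?j"
      proof
        assume "lev y = ?j"
        then have "cut x = anc ?j p" "cut y = anc ?j p"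
          using lx anc_eq[OF p(1) jp] anc_eq[OF p(2) jp] by (auto simp: cut_def)
        with xy show False by simp
      qed
      then have "lev y = Suc ?j" using levs by simp
      then have "Suc ?j * R \<le> length (\<pi> y)" using lev(1)[of y] by simp
      then have "real (Suc ?j * R) \<le> real (length (\<pi> y))" using of_nat_le_iff by blast
      then have y_long: "real ?j * real R + real R \<le> real (length (\<pi> x)) + s"
        using p(4) xy(3) lens by (simp add: algebra_simps)
      have "n + 3 \<le> z x"
      proof (cases "lev x = 0")
        case nonroot: False
        have "\<not> lam (cut x) x \<le> n + 2"
        proof
          assume le: "lam (cut x) x \<le> n + 2"
          obtain y' where y': "y' \<in> M" "\<not> suffix (cut x) (\<pi> y')" "d x y' \<le> real (lam (cut x) x) * s"
            using lam_ex[of "cut x" x] cut_Nil[of x] nonroot by metis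
          have "real (lam (cut x) x) * s \<le> real (n + 2) * s" using le s by (intro mult_right_mono) auto
          then have dy': "d x y' \<le> real n * s + 2 * s" using y'(3) by (simp add: algebra_simps)
          obtain q where q: "suffix q (\<pi> x)" "suffix q (\<pi> y')" "length (\<pi> x) \<le> length q + d x y'"
            using tree[OF xy(1) y'(1)] by blast
          have "length q < length (cut x)"
          proof (rule ccontr)
            assume "\<not> ?thesis"
            then have "suffix (cut x) q" using cut(1) q(1) by (meson not_less suffix_length_suffix)
            then show False using q(2) y'(2) suffix_order.trans by blast
          qed
          then have "real (length q) \<le> real ?j * real R" using cut(2)[of x] lx by (simp flip: of_nat_mult)
          then show False using q(3) dy' y_long R4 s by linarith
        qed
        then show ?thesis using nonroot by (simp add: z_def)
      qed (simp add: z_def)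
      then show ?thesis using lx by simp
    qed
  qed
  have region_side: "region c x = anc j p"
    if "(lev x = j \<and> n + 3 \<le> z x) \<or> (lev x = Suc j \<and> z x \<le> 1)" "suffix p (\<pi> x)" "j * R \<le> length p" "c < Suc n"
    for c x j p
    using that(1)
  proof
    assume "lev x = j \<and> n + 3 \<le> z x"
    then show ?thesis using anc_eq[OF that(2,3)] that(4) by (simp add: region_def cut_def)
  next
    assume *: "lev x = Suc j \<and> z x \<le> 1"
    then have "drop R (cut x) = anc j (\<pi> x)" using drop_anc[of j "\<pi> x"] lev(1)[of x] by (simp add: cut_def)
    then show ?thesis using anc_eq[OF that(2,3)] * by (simp add: region_def)
  qed
  define Fr where "Fr c = {x \<in> M. 2 \<le> z x \<and> z x \<le> n + 2 \<and> x \<in> F (cut x) c}" for c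
  define Co where "Co c = {x \<in> M. (z x \<le> 1 \<or> n + 3 \<le> z x) \<and> x \<in> P (region c x) c}" for c
  define Y where "Y c = Co c \<union> {x \<in> Fr c. z x \<noteq> c + 2}" for c
  have Fr: "coarsely_discrete d s D (Fr c)" if c: "c < Suc n" for c
  proof (rule coarsely_discrete_fibres[where g = cut])
    fix x y assume xy: "x \<in> Fr c" "y \<in> Fr c" "d x y \<le> s"
    show "cut x = cut y"
    proof (rule ccontr)
      assume neq: "cut x \<noteq> cut y"
      have M: "x \<in> M" "y \<in> M" using xy by (auto simp: Fr_def)
      obtain p where "suffix p (\<pi> x)" "suffix p (\<pi> y)" "length (\<pi> x) \<le> length p + d x y"
        "length (\<pi> y) \<le> length p + d x y" using tree[OF M] by blast
      from side[OF M xy(3) neq this] xy(1) show False by (auto simp: Fr_def)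
    qed
  next
    fix u
    show "coarsely_discrete d s D {x \<in> Fr c. cut x = u}"
    proof (cases "u = []")
      case True
      then have "{x \<in> Fr c. cut x = u} = {}" using cut_Nil by (auto simp: Fr_def z_def)
      then show ?thesis by (simp only:) (simp add: coarsely_discrete_def)
    next
      case False
      then have "coarsely_discrete d s D (F u c)" using F c by simp
      then show ?thesis by (rule coarsely_discrete_mono) (auto simp: Fr_def)
    qed
  qed
  have "coarsely_discrete d s (B + 2 * (D + s)) (Y c)" if c: "c < Suc n" for c
  proof (rule coarsely_discrete_fibres[where g = "region c"])
    fix x y assume xy: "x \<in> Y c" "y \<in> Y c" "d x y \<le> s"
    have M: "x \<in> M" "y \<in> M" using xy by (auto simp: Y_def Co_def Fr_def)
    have z_neq: "z a \<noteq> c + 2" if "a \<in> Y c" for a using that c by (auto simp: Y_def Co_def)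
    show "region c x = region c y"
    proof (cases "cut x = cut y")
      case True
      then have lev_eq: "lev x = lev y" using cut(2)[of x] cut(2)[of y] R0 by simp
      have "z x > c + 2 \<longleftrightarrow> z y > c + 2"
      proof (cases "lev x = 0")
        case False
        then have ne: "cut x \<noteq> []" using cut_Nil by simp
        have "z x \<le> Suc (z y)" "z y \<le> Suc (z x)"
          using lam_step[OF ne M xy(3)] lam_step[OF ne M(2,1)] xy(3) False lev_eq True
          by (auto simp: z_def commute)
        then show ?thesis using z_neq[OF xy(1)] z_neq[OF xy(2)] by linarith
      qed (use lev_eq in \<open>simp add: z_def\<close>)
      then show ?thesis using True by (simp add: region_def)
    next
      case False
      obtain p where p: "suffix p (\<pi> x)" "suffix p (\<pi> y)" "length (\<pi> x) \<le> length p + d x y"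
        "length (\<pi> y) \<le> length p + d x y" using tree[OF M] by blast
      have "region c x = anc (length p div R) p"
        using side[OF M xy(3) False p] p(1) c by (intro region_side) auto
      moreover have "region c y = anc (length p div R) p"
        using side[of y x p] M xy(3) False p c commute[of x y] by (intro region_side) auto
      ultimately show ?thesis by simp
    qed
  next
    fix u
    have "coarsely_discrete d s (B + 2 * (D + s)) (Fr c \<union> P u c)"
      using Fr[OF c] P[rule_format, OF UNIV_I, THEN conjunct1, rule_format, OF c] s D(1) B(1)
      by (intro coarsely_discrete_Un) (auto simp: Fr_def branch_piece_def branch_def)
    then show "coarsely_discrete d s (B + 2 * (D + s)) {x \<in> Y c. region c x = u}"
      by (rule coarsely_discrete_mono) (auto simp: Y_def Co_def)
  qed
  moreover have Y_sub: "Y c \<subseteq> M" for c by (auto simp: Y_def Co_def Fr_def)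
  moreover have "\<exists>c<Suc n. x \<in> Y c" if x: "x \<in> M" for x
  proof (cases "z x \<le> 1 \<or> n + 3 \<le> z x")
    case True
    have region: "region c x = region 0 x" if "c < Suc n" for c
      using True that by (auto simp: region_def)
    have "x \<in> branch_piece M \<pi> (2 * R) (region 0 x)"
    proof -
      have "suffix (drop R (cut x)) (\<pi> x)" using cut(1) suffix_drop suffix_order.trans by blast
      then have "suffix (region 0 x) (\<pi> x)" using cut(1) by (simp add: region_def)
      moreover have "length (\<pi> x) \<le> length (region 0 x) + 2 * R"
      proof -
        have "lev x * R - R \<le> length (region 0 x)" by (simp add: region_def cut(2))
        moreover have "length (\<pi> x) < R + lev x * R" using lev(2)[of x] by simp
        ultimately show ?thesis by linarith
      qed
      ultimately show ?thesis using x by (simp add: branch_piece_def branch_def)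
    qed
    then have "card {c. c < Suc n \<and> x \<notin> P (region 0 x) c} \<le> n" using P by simp
    then obtain c where c: "c < Suc n" "x \<in> P (region 0 x) c"
      unfolding card_missed_le_iff by blast
    then have "x \<in> Co c" using region[OF c(1)] True x by (simp add: Co_def)
    then show ?thesis using c(1) by (auto simp: Y_def)
  next
    case False
    have lx: "lev x \<noteq> 0"
    proof
      assume "lev x = 0"
      then have "z x = n + 3" by (simp add: z_def)
      with False show False by simp
    qed
    then have ne: "cut x \<noteq> []" and z: "z x = lam (cut x) x" using cut_Nil by (simp_all add: z_def)
    obtain y where y: "y \<in> M" "\<not> suffix (cut x) (\<pi> y)" "d x y \<le> real (z x) * s"
      using lam_ex[OF ne, of x] unfolding z by blast
    have "real (z x) * s \<le> ?\<rho>" using False s by (intro mult_right_mono) auto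
    then have "x \<in> branch_boundary M d \<pi> ?\<rho> (cut x)"
      using y x cut(1) by (auto simp: branch_boundary_def branch_def intro!: bexI[of _ y])
    then have card: "card {c. c < Suc n \<and> x \<notin> F (cut x) c} \<le> k" using F ne by simp
    \<comment> \<open>A point of a layer misses at most \<open>k\<close> of the \<open>k + 2\<close> colours, so one of the other two is allowed.\<close>
    have "\<exists>c<Suc n. x \<in> F (cut x) c \<and> z x \<noteq> c + 2"
    proof (rule ccontr)
      assume "\<not> ?thesis"
      then have "{..<Suc n} \<subseteq> insert (z x - 2) {c. c < Suc n \<and> x \<notin> F (cut x) c}" by auto
      then have "card {..<Suc n} \<le> card (insert (z x - 2) {c. c < Suc n \<and> x \<notin> F (cut x) c})"
        by (intro card_mono) auto
      also have "\<dots> \<le> Suc k" using card by (simp add: card_insert_if)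
      finally show False by (simp add: n_def)
    qed
    then show ?thesis using False x by (auto simp: Y_def Fr_def)
  qed
  ultimately have "colouring d n (Suc n) s (B + 2 * (D + s)) M"
    using Y_sub unfolding colouring_def card_missed_le_iff by blast
  then show "\<exists>B. \<forall>Z\<in>{M}. colouring d (Suc k) (Suc (Suc k)) s B Z" unfolding n_def by blast
qed

section \<open>A vertex group attached to a subgroup that commutes with it\<close>

text \<open>Right multiplication of a word by the letter \<open>(c, h)\<close>, followed by reduction at the head.\<close>

definition push :: "('g, 'b) monoid_scheme \<Rightarrow> 'l \<Rightarrow> 'g \<Rightarrow> ('l \<times> 'g) list \<Rightarrow> ('l \<times> 'g) list" where
  "push K c h w = (if h = \<one>\<^bsub>K\<^esub> then w else case w of [] \<Rightarrow> [(c, h)]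
    | (c', h') # p \<Rightarrow> if c' = c then (if h' \<otimes>\<^bsub>K\<^esub> h = \<one>\<^bsub>K\<^esub> then p else (c, h' \<otimes>\<^bsub>K\<^esub> h) # p) else (c, h) # w)"

lemma push_one [simp]: "push K c \<one>\<^bsub>K\<^esub> w = w"
  by (simp add: push_def)

lemma push_suffix:
  "\<exists>q. suffix q w \<and> suffix q (push K c h w) \<and> length w \<le> Suc (length q) \<and> length (push K c h w) \<le> Suc (length q)"
proof (cases "h = \<one>\<^bsub>K\<^esub> \<or> w = []")
  case True
  then show ?thesis by (intro exI[of _ w]) (auto simp: push_def)
next
  case False
  then obtain c' h' p where w: "w = (c', h') # p" by (metis list.exhaust surj_pair)
  show ?thesis
    using False w by (intro exI[of _ "if c' = c then p else w"]) (auto simp: push_def suffix_Cons)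
qed

text \<open>Only the head of a word is changed, so a branch can be left only at its root.\<close>

lemma push_exit:
  assumes "suffix u w" "\<not> suffix u (push K c h w)"
  shows "w = u" "u \<noteq> []" "fst (hd u) = c"
proof -
  show "u \<noteq> []" using assms by auto
  then obtain c' h' p where w: "w = (c', h') # p" using assms(1) by (metis list.exhaust suffix_bot.extremum_uniqueI surj_pair)
  have "c' = c" using assms w by (auto simp: push_def suffix_Cons split: if_splits)
  moreover show "w = u" using assms w by (auto simp: push_def suffix_Cons split: if_splits)
  ultimately show "fst (hd u) = c" using w by auto
qed

lemma push_exit_coset:
  assumes "suffix ((c, h) # p) w" "\<And>h''. \<not> suffix ((c, h'') # p) (push K c' h' w)"
  shows "push K c' h' w = p"
proof -
  have w: "w = (c, h) # p" "c = c'" using push_exit[OF assms(1,2)] by auto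
  show ?thesis
  proof (rule ccontr)
    assume "push K c' h' w \<noteq> p"
    then have "\<exists>h''. push K c' h' w = (c, h'') # p"
      using w by (cases "h' = \<one>\<^bsub>K\<^esub>") (auto simp: push_def)
    then show False using assms(2) by fastforce
  qed
qed

text \<open>The situation of the induction step: \<open>\<rho>\<close> is the retraction onto \<open>A\<close> that kills \<open>H\<close>, and \<open>\<pi> x\<close> is the path
  from the base point to the coset \<open>x A\<close> in the Bass-Serre tree, the vertices of type \<open>C \<times> H\<close> being left
  out. The generators lie in \<open>A\<close> or in \<open>H\<close>, so that an edge of the Cayley graph changes \<open>\<pi>\<close> by at most one
  application of \<^const>\<open>push\<close>.\<close>

locale tree_extension = generated_group GG S for GG (structure) and S +
  fixes A C H :: "'a set" and \<rho> :: "'a \<Rightarrow> 'a" and \<pi> :: "'a \<Rightarrow> ('a set \<times> 'a) list"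
  assumes A_subgroup: "subgroup A GG" and C_subgroup: "subgroup C GG" and H_subgroup: "subgroup H GG" and C_A: "C \<subseteq> A"
    and CH: "\<lbrakk>c \<in> C; h \<in> H\<rbrakk> \<Longrightarrow> c \<otimes> h = h \<otimes> c"
    and \<rho>_hom: "\<rho> \<in> hom GG GG" and \<rho>_closed_A: "x \<in> carrier GG \<Longrightarrow> \<rho> x \<in> A"
    and \<rho>_A: "a \<in> A \<Longrightarrow> \<rho> a = a" and \<rho>_H: "h \<in> H \<Longrightarrow> \<rho> h = \<one>"
    and S_AH: "S \<subseteq> A \<union> H"
    and \<pi>_one: "\<pi> \<one> = []"
    and \<pi>_A: "\<lbrakk>x \<in> carrier GG; a \<in> A\<rbrakk> \<Longrightarrow> \<pi> (x \<otimes> a) = \<pi> x"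
    and \<pi>_H: "\<lbrakk>x \<in> carrier GG; h \<in> H\<rbrakk> \<Longrightarrow> \<pi> (x \<otimes> h) = push GG (\<rho> x <# C) h (\<pi> x)"
begin

abbreviation d where "d \<equiv> cayley_dist GG S"

sublocale Metric_space "carrier GG" d
  by (rule Metric_space_cayley)

lemma A_carrier [simp]: "a \<in> A \<Longrightarrow> a \<in> carrier GG" using subgroup.mem_carrier[OF A_subgroup] .
lemma C_carrier [simp]: "a \<in> C \<Longrightarrow> a \<in> carrier GG" using subgroup.mem_carrier[OF C_subgroup] .
lemma H_carrier [simp]: "a \<in> H \<Longrightarrow> a \<in> carrier GG" using subgroup.mem_carrier[OF H_subgroup] .

lemma inv_mult_cancel [simp]:
  assumes "x \<in> carrier GG" "y \<in> carrier GG"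
  shows "inv x \<otimes> (x \<otimes> y) = y" "x \<otimes> (inv x \<otimes> y) = y"
  using assms by (simp_all flip: m_assoc)

lemma \<rho>_mult: "\<lbrakk>x \<in> carrier GG; y \<in> carrier GG\<rbrakk> \<Longrightarrow> \<rho> (x \<otimes> y) = \<rho> x \<otimes> \<rho> y"
  using \<rho>_hom by (rule hom_mult)

lemma \<rho>_closed [simp]: "x \<in> carrier GG \<Longrightarrow> \<rho> x \<in> carrier GG"
  using \<rho>_closed_A A_carrier by blast

text \<open>Elements are built by right multiplication because the behaviour of \<open>\<pi>\<close> under right multiplication
  is known.\<close>

lemma right_induct [consumes 1, case_names one A H]:
  assumes x: "x \<in> carrier GG" and one: "P \<one>"
    and stepA: "\<And>x a. \<lbrakk>x \<in> carrier GG; P x; a \<in> A\<rbrakk> \<Longrightarrow> P (x \<otimes> a)"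
    and stepH: "\<And>x h. \<lbrakk>x \<in> carrier GG; P x; h \<in> H\<rbrakk> \<Longrightarrow> P (x \<otimes> h)"
  shows "P x"
proof -
  have gen: "y \<in> carrier GG \<and> (\<forall>x\<in>carrier GG. P x \<longrightarrow> P (x \<otimes> y))" if "y \<in> generate GG S" for y
    using that
  proof (induction rule: generate.induct)
    case one then show ?case by simp
  next
    case (incl h)
    then have "h \<in> A \<union> H" using S_AH by blast
    then show ?case using stepA stepH by auto
  next
    case (inv h)
    then have "h \<in> A \<union> H" using S_AH by blast
    then have "inv h \<in> A \<union> H" using subgroup.m_inv_closed[OF A_subgroup] subgroup.m_inv_closed[OF H_subgroup] by blast
    then show ?case using stepA stepH by auto
  next
    case (eng h1 h2)
    then show ?case by (auto simp flip: m_assoc)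
  qed
  then show ?thesis using gen[of x] x S_generate one by force
qed

subsection \<open>Normal forms\<close>

definition conj_letter :: "'a set \<Rightarrow> 'a \<Rightarrow> 'a" where
  "conj_letter c h = (SOME a. a \<in> c) \<otimes> h \<otimes> inv (SOME a. a \<in> c)"

primrec word_value :: "('a set \<times> 'a) list \<Rightarrow> 'a" where
  "word_value [] = \<one>"
| "word_value (l # w) = word_value w \<otimes> conj_letter (fst l) (snd l)"

definition valid :: "('a set \<times> 'a) list \<Rightarrow> bool" where
  "valid w \<longleftrightarrow> (\<forall>l\<in>set w. fst l \<in> (\<lambda>a. a <# C) ` A \<and> snd l \<in> H)"

lemma in_coset_self: "a \<in> A \<Longrightarrow> a \<in> a <# C"
  using subgroup.one_closed[OF C_subgroup] unfolding l_coset_def by force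

lemma coset_elem:
  assumes "a \<in> A" "b \<in> a <# C"
  obtains c where "c \<in> C" "b = a \<otimes> c" "b \<in> A"
proof -
  obtain c where c: "c \<in> C" "b = a \<otimes> c" using assms(2) unfolding l_coset_def by blast
  then show ?thesis using that assms(1) C_A subgroup.m_closed[OF A_subgroup] by blast
qed

text \<open>The conjugate depends on the coset only, because \<open>C\<close> commutes with \<open>H\<close>.\<close>

lemma conj_letter_eq:
  assumes a: "a \<in> A" and h: "h \<in> H"
  shows "conj_letter (a <# C) h = a \<otimes> h \<otimes> inv a"
proof -
  have "(SOME b. b \<in> a <# C) \<in> a <# C" using in_coset_self[OF a] by (rule someI)
  then obtain c where c: "c \<in> C" "(SOME b. b \<in> a <# C) = a \<otimes> c" using coset_elem[OF a] by metis
  have "conj_letter (a <# C) h = a \<otimes> (c \<otimes> h) \<otimes> (inv c \<otimes> inv a)"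
    using a h c by (simp add: conj_letter_def m_assoc inv_mult_group)
  also have "c \<otimes> h = h \<otimes> c" using CH c h by blast
  finally show ?thesis using a h c(1) by (simp add: m_assoc)
qed

lemma coset_letter:
  assumes "valid w" "l \<in> set w"
  obtains a h where "a \<in> A" "h \<in> H" "l = (a <# C, h)"
  using assms by (cases l) (auto simp: valid_def)

lemma conj_letter_closed: "c \<in> (\<lambda>a. a <# C) ` A \<Longrightarrow> h \<in> H \<Longrightarrow> conj_letter c h \<in> carrier GG"
  using conj_letter_eq by auto

lemma word_value_closed [simp]: "valid w \<Longrightarrow> word_value w \<in> carrier GG"
  by (induction w) (auto simp: valid_def intro!: conj_letter_closed)

lemma conj_mult:
  assumes "a \<in> A" "h \<in> H" "h' \<in> H"
  shows "a \<otimes> h \<otimes> inv a \<otimes> (a \<otimes> h' \<otimes> inv a) = a \<otimes> (h \<otimes> h') \<otimes> inv a"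
  using assms by (simp add: m_assoc)

lemma word_value_push:
  assumes w: "valid w" and a: "a \<in> A" and h: "h \<in> H"
  shows "valid (push GG (a <# C) h w)"
    and "word_value (push GG (a <# C) h w) = word_value w \<otimes> (a \<otimes> h \<otimes> inv a)"
proof -
  have "valid (push GG (a <# C) h w) \<and>
    word_value (push GG (a <# C) h w) = word_value w \<otimes> (a \<otimes> h \<otimes> inv a)"
  proof (cases w)
    case Nil
    then show ?thesis using a h by (auto simp: push_def valid_def conj_letter_eq)
  next
    case (Cons l p)
    then obtain c' h' where l: "l = (c', h')" by fastforce
    have p: "valid p" and h': "h' \<in> H" using w Cons l by (auto simp: valid_def)
    have hh': "h' \<otimes> h \<in> H" using h h' subgroup.m_closed[OF H_subgroup] by blast
    show ?thesis
    proof (cases "h = \<one> \<or> c' \<noteq> a <# C")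
      case True
      then show ?thesis using w a h Cons l by (auto simp: push_def valid_def conj_letter_eq)
    next
      case False
      then have "word_value w \<otimes> (a \<otimes> h \<otimes> inv a) = word_value p \<otimes> (a \<otimes> h' \<otimes> inv a \<otimes> (a \<otimes> h \<otimes> inv a))"
        using Cons l p a h h' by (simp add: conj_letter_eq m_assoc)
      also have "\<dots> = word_value p \<otimes> (a \<otimes> (h' \<otimes> h) \<otimes> inv a)"
        using conj_mult[OF a h' h] by simp
      finally show ?thesis using False Cons l p a h h' hh' w
        by (auto simp: push_def valid_def conj_letter_eq)
    qed
  qed
  then show "valid (push GG (a <# C) h w)"
    "word_value (push GG (a <# C) h w) = word_value w \<otimes> (a \<otimes> h \<otimes> inv a)" by auto
qed

lemma \<rho>_one: "\<rho> \<one> = \<one>"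
  using \<rho>_A subgroup.one_closed[OF A_subgroup] by blast

lemma normal_form:
  assumes "x \<in> carrier GG"
  shows "valid (\<pi> x) \<and> x = word_value (\<pi> x) \<otimes> \<rho> x"
  using assms
proof (induction rule: right_induct)
  case one
  then show ?case by (simp add: \<pi>_one valid_def \<rho>_one)
next
  case (A x a)
  have "word_value (\<pi> (x \<otimes> a)) \<otimes> \<rho> (x \<otimes> a) = word_value (\<pi> x) \<otimes> \<rho> x \<otimes> a"
    using A(1,2) A(3)[THEN conjunct1] by (simp add: \<pi>_A \<rho>_mult \<rho>_A m_assoc)
  then show ?case using A by (simp add: \<pi>_A)
next
  case (H x h)
  then have "word_value (\<pi> (x \<otimes> h)) \<otimes> \<rho> (x \<otimes> h) = word_value (\<pi> x) \<otimes> (\<rho> x \<otimes> h \<otimes> inv \<rho> x) \<otimes> \<rho> x"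
    by (simp add: \<pi>_H word_value_push \<rho>_closed_A \<rho>_mult \<rho>_H)
  also have "\<dots> = word_value (\<pi> x) \<otimes> \<rho> x \<otimes> h"
    using H(1,2) H(3)[THEN conjunct1] by (simp add: m_assoc)
  also have "\<dots> = x \<otimes> h" using H(3) by metis
  finally show ?case using H word_value_push(1)[of "\<pi> x" "\<rho> x" h] by (simp add: \<pi>_H \<rho>_closed_A)
qed

lemmas valid_\<pi> = normal_form[THEN conjunct1] and \<pi>_value = normal_form[THEN conjunct2]

text \<open>With \<open>word_value_append\<close> this shows that left translation by the value of a word \<open>u\<close> maps the elements
  of length at most \<open>N\<close> onto a set that contains the part of depth \<open>N\<close> of the branch at \<open>u\<close>. That is
  why one estimate covers all branches.\<close>

lemma length_\<pi>_word_value: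
  assumes "valid w" "a \<in> A"
  shows "length (\<pi> (word_value w \<otimes> a)) \<le> length w"
proof -
  have "\<rho> (word_value w) = \<one> \<and> length (\<pi> (word_value w)) \<le> length w"
    using assms(1)
  proof (induction w)
    case Nil
    then show ?case by (simp add: \<pi>_one \<rho>_one)
  next
    case (Cons l w)
    obtain b h where l: "b \<in> A" "h \<in> H" "l = (b <# C, h)" using coset_letter[OF Cons.prems, of l] by auto
    have w: "valid w" using Cons.prems by (auto simp: valid_def)
    have inv_b: "inv b \<in> A" using l subgroup.m_inv_closed[OF A_subgroup] by blast
    have "word_value (l # w) = word_value w \<otimes> b \<otimes> h \<otimes> inv b"
      using l w by (simp add: conj_letter_eq m_assoc)
    moreover have "\<pi> (word_value w \<otimes> b \<otimes> h \<otimes> inv b) = push GG (\<rho> (word_value w \<otimes> b) <# C) h (\<pi> (word_value w))"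
      using l w inv_b by (simp add: \<pi>_A \<pi>_H)
    moreover have "length (push GG (\<rho> (word_value w \<otimes> b) <# C) h (\<pi> (word_value w))) \<le> Suc (length (\<pi> (word_value w)))"
      using push_suffix[of "\<pi> (word_value w)" GG] by (meson suffix_length_le Suc_le_mono le_trans)
    moreover have "\<rho> (word_value w \<otimes> b \<otimes> h \<otimes> inv b) = \<one>"
      using Cons.IH[OF w] l w inv_b by (simp add: \<rho>_mult \<rho>_A \<rho>_H)
    ultimately show ?case using Cons.IH[OF w] by simp
  qed
  then show ?thesis using assms by (simp add: \<pi>_A)
qed

lemma word_value_append:
  "valid (w @ u) \<Longrightarrow> word_value (w @ u) = word_value u \<otimes> word_value w"
proof (induction w)
  case Nil
  then show ?case by simp
next
  case (Cons l w)
  have w: "valid w" "valid u" "valid (w @ u)" and l: "conj_letter (fst l) (snd l) \<in> carrier GG"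
    using Cons.prems by (auto simp: valid_def intro!: conj_letter_closed)
  then show ?case using Cons.IH[OF w(3)] by (simp add: m_assoc)
qed

subsection \<open>Geometry of the tree\<close>

lemma adj_cases:
  assumes "(x, y) \<in> cayley_adj GG S"
  obtains (A) a where "x \<in> carrier GG" "a \<in> A" "y = x \<otimes> a"
  | (H) h where "x \<in> carrier GG" "h \<in> H" "y = x \<otimes> h"
proof -
  have inv_AH: "inv s \<in> A \<union> H" if "s \<in> A \<union> H" for s
    using that subgroup.m_inv_closed[OF A_subgroup] subgroup.m_inv_closed[OF H_subgroup] by blast
  have "\<exists>t. x \<in> carrier GG \<and> t \<in> A \<union> H \<and> y = x \<otimes> t"
    using assms
  proof
    assume "(x, y) \<in> cayley_graph GG S"
    then show ?thesis using S_AH unfolding cayley_graph_def by blast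
  next
    assume "(x, y) \<in> (cayley_graph GG S)\<inverse>"
    then obtain s where s: "s \<in> S" "x = y \<otimes> s" "y \<in> carrier GG" unfolding cayley_graph_def by blast
    then have "s \<in> A \<union> H" using S_AH by blast
    then have "inv s \<in> A \<union> H" "s \<in> carrier GG" using inv_AH by auto
    then show ?thesis using s by (intro exI[of _ "inv s"]) (auto simp: m_assoc)
  qed
  then show ?thesis using that by blast
qed

lemma adj_closed: "(x, y) \<in> cayley_adj GG S \<Longrightarrow> y \<in> carrier GG"
  by (elim adj_cases) auto

lemma adj_dist: "(x, y) \<in> cayley_adj GG S \<Longrightarrow> d x y \<le> 1"
  using cayley_dist_le[of x y 1] by simp

lemma common_suffix_path:
  assumes "(x, y) \<in> cayley_adj GG S ^^ n"
  shows "\<exists>p. suffix p (\<pi> x) \<and> suffix p (\<pi> y) \<and> length (\<pi> x) \<le> length p + n \<and> length (\<pi> y) \<le> length p + n"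
  using assms
proof (induction n arbitrary: y)
  case 0
  then show ?case by auto
next
  case (Suc n)
  then obtain z where z: "(x, z) \<in> cayley_adj GG S ^^ n" "(z, y) \<in> cayley_adj GG S" by auto
  obtain p where p: "suffix p (\<pi> x)" "suffix p (\<pi> z)" "length (\<pi> x) \<le> length p + n" "length (\<pi> z) \<le> length p + n"
    using Suc.IH[OF z(1)] by blast
  obtain q where q: "suffix q (\<pi> z)" "suffix q (\<pi> y)" "length (\<pi> z) \<le> Suc (length q)" "length (\<pi> y) \<le> Suc (length q)"
    using z(2)
  proof (cases rule: adj_cases)
    case (A a)
    then show ?thesis using that[of "\<pi> z"] by (simp add: \<pi>_A)
  next
    case (H h)
    then show ?thesis using push_suffix[of "\<pi> z" GG "\<rho> z <# C" h] that by (auto simp: \<pi>_H)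
  qed
  show ?case
  proof (cases "length p \<le> length q")
    case True
    then have "suffix p q" using p(2) q(1) suffix_length_suffix by blast
    then have "suffix p (\<pi> y)" using q(2) suffix_order.trans by blast
    moreover have "length q \<le> length (\<pi> z)" using q(1) by (rule suffix_length_le)
    ultimately show ?thesis using p q by (intro exI[of _ p]) auto
  next
    case False
    then have "suffix q p" using p(2) q(1) suffix_length_suffix by (metis nat_le_linear)
    then have "suffix q (\<pi> x)" using p(1) suffix_order.trans by blast
    moreover have "length p \<le> length (\<pi> z)" using p(2) by (rule suffix_length_le)
    ultimately show ?thesis using p q by (intro exI[of _ q]) auto
  qed
qed

text \<open>When a path first leaves the branch at \<open>u\<close>, it does so by an edge from \<open>H\<close> that changes the head of \<open>u\<close>.
  Such an edge starts at a point with the word \<open>u\<close> whose image under \<open>\<rho>\<close> lies in the coset at the head.\<close>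

lemma path_exit:
  assumes "(x, y) \<in> cayley_adj GG S ^^ n" "x \<in> carrier GG" "suffix u (\<pi> x)" "\<not> suffix u (\<pi> y)"
  shows "\<exists>z\<in>carrier GG. \<pi> z = u \<and> u \<noteq> [] \<and> fst (hd u) = \<rho> z <# C \<and> d x z \<le> real n"
  using assms
proof (induction n arbitrary: x)
  case 0
  then show ?case by simp
next
  case (Suc n)
  obtain w where w: "(x, w) \<in> cayley_adj GG S" "(w, y) \<in> cayley_adj GG S ^^ n"
    using Suc.prems(1) by (rule relpow_Suc_E2)
  have wG: "w \<in> carrier GG" using w(1) by (rule adj_closed)
  show ?case
  proof (cases "suffix u (\<pi> w)")
    case True
    then obtain z where z: "z \<in> carrier GG" "\<pi> z = u" "u \<noteq> []" "fst (hd u) = \<rho> z <# C" "d w z \<le> real n"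
      using Suc.IH[OF w(2) wG] Suc.prems(4) by blast
    moreover have "d x z \<le> real (Suc n)"
      using triangle[OF Suc.prems(2) wG z(1)] adj_dist[OF w(1)] z(5) by simp
    ultimately show ?thesis by blast
  next
    case False
    from w(1) show ?thesis
    proof (cases rule: adj_cases)
      case (A a)
      then show ?thesis using False Suc.prems(3) by (simp add: \<pi>_A)
    next
      case (H h)
      then have "\<not> suffix u (push GG (\<rho> x <# C) h (\<pi> x))" using False by (simp add: \<pi>_H)
      from push_exit[OF Suc.prems(3) this] show ?thesis
        using Suc.prems(2) by (intro bexI[of _ x]) (auto simp: mdist_zero)
    qed
  qed
qed

text \<open>The branches at \<open>(c, h) # p\<close> with fixed \<open>c\<close> and \<open>p\<close> are connected to each other through one coset of
  \<open>C \<times> H\<close>; their union can be left only towards the word \<open>p\<close>.\<close>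

lemma path_exit_coset:
  assumes "(x, y) \<in> cayley_adj GG S ^^ n" "x \<in> carrier GG" "suffix ((c, h) # p) (\<pi> x)"
    "\<And>h'. \<not> suffix ((c, h') # p) (\<pi> y)"
  shows "\<exists>z\<in>carrier GG. \<pi> z = p \<and> d x z \<le> real n"
  using assms
proof (induction n arbitrary: x h)
  case 0
  then show ?case by simp
next
  case (Suc n)
  obtain w where w: "(x, w) \<in> cayley_adj GG S" "(w, y) \<in> cayley_adj GG S ^^ n"
    using Suc.prems(1) by (rule relpow_Suc_E2)
  have wG: "w \<in> carrier GG" using w(1) by (rule adj_closed)
  show ?case
  proof (cases "\<exists>h'. suffix ((c, h') # p) (\<pi> w)")
    case True
    then obtain z where z: "z \<in> carrier GG" "\<pi> z = p" "d w z \<le> real n"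
      using Suc.IH[OF w(2) wG] Suc.prems(4) by blast
    moreover have "d x z \<le> real (Suc n)"
      using triangle[OF Suc.prems(2) wG z(1)] adj_dist[OF w(1)] z(3) by simp
    ultimately show ?thesis by blast
  next
    case False
    from w(1) show ?thesis
    proof (cases rule: adj_cases)
      case (A a)
      then show ?thesis using False Suc.prems(3) by (auto simp: \<pi>_A)
    next
      case (H h')
      then have "\<pi> w = p"
        using push_exit_coset[OF Suc.prems(3), of GG "\<rho> x <# C" h'] False by (simp add: \<pi>_H)
      moreover have "d x w \<le> real (Suc n)" using adj_dist[OF w(1)] by simp
      ultimately show ?thesis using wG by blast
    qed
  qed
qed

subsection \<open>Asymptotic dimension\<close>

lemma uniform_colouring_translates:
  assumes "uniform_colouring d n m {Z}" "Z \<subseteq> carrier GG"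
  shows "uniform_colouring d n m ((\<lambda>g. g <# Z) ` carrier GG)"
proof (rule uniform_colouring_pullback[OF assms(1), of 1 _ _ 0])
  fix X assume "X \<in> (\<lambda>g. g <# Z) ` carrier GG"
  then obtain g where g: "g \<in> carrier GG" "X = g <# Z" by blast
  have X: "x \<in> carrier GG" "inv g \<otimes> x \<in> Z" if "x \<in> X" for x
  proof -
    obtain z where "z \<in> Z" "x = g \<otimes> z" using \<open>x \<in> X\<close> g(2) unfolding l_coset_def by blast
    then show "x \<in> carrier GG" "inv g \<otimes> x \<in> Z" using g(1) assms(2) by (auto simp flip: m_assoc)
  qed
  have "d (inv g \<otimes> x) (inv g \<otimes> y) = d x y" if "x \<in> X" "y \<in> X" for x y
  proof (rule antisym)
    show "d (inv g \<otimes> x) (inv g \<otimes> y) \<le> d x y"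
      using X that g(1) by (intro cayley_dist_translate) auto
    have "d (g \<otimes> (inv g \<otimes> x)) (g \<otimes> (inv g \<otimes> y)) \<le> d (inv g \<otimes> x) (inv g \<otimes> y)"
      using X that g(1) by (intro cayley_dist_translate) auto
    then show "d x y \<le> d (inv g \<otimes> x) (inv g \<otimes> y)" using X that g(1) by (simp flip: m_assoc)
  qed
  then show "\<exists>Z'\<in>{Z}. \<exists>\<phi>. \<phi> ` X \<subseteq> Z' \<and>
      (\<forall>x\<in>X. \<forall>y\<in>X. d (\<phi> x) (\<phi> y) \<le> 1 * d x y + 0 \<and> d x y \<le> 1 * d (\<phi> x) (\<phi> y) + 0)"
    using X(2) by (intro bexI[of _ Z] exI[of _ "\<lambda>x. inv g \<otimes> x"]) auto
qed auto

lemma uniform_colouring_translates_subsets: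
  assumes "uniform_colouring d n m {Z}" "Z \<subseteq> carrier GG"
    and "\<And>X. X \<in> \<X> \<Longrightarrow> X = {} \<or> (\<exists>g\<in>carrier GG. X \<subseteq> g <# Z)"
  shows "uniform_colouring d n m \<X>"
proof (rule uniform_colouring_subsets[OF uniform_colouring_translates[OF assms(1,2)]])
  fix X assume "X \<in> \<X>"
  then show "\<exists>Z'\<in>(\<lambda>g. g <# Z) ` carrier GG. X \<subseteq> Z'" using assms(3)[of X] by auto
qed

definition ball_of_words :: "nat \<Rightarrow> 'a set" where
  "ball_of_words N = {x \<in> carrier GG. length (\<pi> x) \<le> N}"

text \<open>The points through which paths leave the branch at \<open>u\<close>. They lie in one left coset of \<open>C\<close>.\<close>

definition gate :: "('a set \<times> 'a) list \<Rightarrow> 'a set" where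
  "gate u = {z \<in> carrier GG. \<pi> z = u \<and> u \<noteq> [] \<and> fst (hd u) = \<rho> z <# C}"

lemma l_coset_mem: "\<lbrakk>g \<in> carrier GG; x \<in> carrier GG; inv g \<otimes> x \<in> Z\<rbrakk> \<Longrightarrow> x \<in> g <# Z"
  unfolding l_coset_def by (force simp flip: m_assoc)

lemma same_word:
  assumes "x \<in> carrier GG" "y \<in> carrier GG" "\<pi> x = \<pi> y"
  shows "inv x \<otimes> y = inv \<rho> x \<otimes> \<rho> y"
proof -
  let ?w = "word_value (\<pi> x)"
  have w: "?w \<in> carrier GG" using valid_\<pi>[OF assms(1)] by simp
  have "inv x \<otimes> y = inv (?w \<otimes> \<rho> x) \<otimes> (?w \<otimes> \<rho> y)"
    using \<pi>_value[OF assms(1)] \<pi>_value[OF assms(2)] assms(3) by simp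
  also have "\<dots> = inv \<rho> x \<otimes> \<rho> y"
    using w assms(1,2) by (simp add: inv_mult_group m_assoc)
  finally show ?thesis .
qed

lemma gate_coset:
  assumes "x \<in> gate u" "y \<in> gate u"
  shows "y \<in> x <# C"
proof -
  have xy: "x \<in> carrier GG" "y \<in> carrier GG" "\<pi> x = \<pi> y" and eq: "\<rho> y <# C = \<rho> x <# C"
    using assms by (auto simp: gate_def)
  have "\<rho> y \<in> \<rho> x <# C" using in_coset_self[OF \<rho>_closed_A[OF xy(2)]] eq by simp
  then obtain c where "c \<in> C" "\<rho> y = \<rho> x \<otimes> c" unfolding l_coset_def by blast
  then have "inv x \<otimes> y \<in> C" using same_word[OF xy] xy by (simp flip: m_assoc)
  then show ?thesis using xy by (intro l_coset_mem)
qed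

lemma dist_path_exit:
  assumes "x \<in> carrier GG" "y \<in> carrier GG" "suffix u (\<pi> x)" "\<not> suffix u (\<pi> y)"
  shows "\<exists>z\<in>gate u. d x z \<le> d x y"
proof -
  obtain n where "d x y = real n" "(x, y) \<in> cayley_adj GG S ^^ n"
    using cayley_dist_path[OF assms(1,2)] .
  then show ?thesis using path_exit[of x y n u] assms by (auto simp: gate_def)
qed

lemma uniform_asdim_le_boundaries:
  assumes "uniform_asdim_le d k {C}"
  shows "uniform_asdim_le d k (branch_boundary (carrier GG) d \<pi> r ` {u. u \<noteq> []})"
proof -
  have "uniform_asdim_le d k (neighbourhood (carrier GG) d r ` (\<lambda>g. g <# C) ` carrier GG)"
    using uniform_colouring_translates[OF assms] subgroup.subset[OF C_subgroup]
    by (intro uniform_colouring_neighbourhood) (auto simp: l_coset_def)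
  then show ?thesis
  proof (rule uniform_colouring_subsets)
    fix X assume "X \<in> branch_boundary (carrier GG) d \<pi> r ` {u. u \<noteq> []}"
    then obtain u where u: "X = branch_boundary (carrier GG) d \<pi> r u" by blast
    have X: "x \<in> carrier GG \<and> (\<exists>z\<in>gate u. d x z \<le> r)" if "x \<in> X" for x
    proof -
      obtain y where "x \<in> carrier GG" "suffix u (\<pi> x)" "y \<in> carrier GG" "\<not> suffix u (\<pi> y)" "d x y \<le> r"
        using \<open>x \<in> X\<close> u by (auto simp: branch_boundary_def branch_def)
      then show ?thesis using dist_path_exit[of x y u] by (meson order_trans)
    qed
    have "\<exists>g\<in>carrier GG. X \<subseteq> neighbourhood (carrier GG) d r (g <# C)"
    proof (cases "gate u = {}")
      case True
      then show ?thesis using X by auto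
    next
      case False
      then obtain g where g: "g \<in> gate u" by blast
      then have "X \<subseteq> neighbourhood (carrier GG) d r (g <# C)"
        using X gate_coset[OF g] unfolding neighbourhood_def by blast
      then show ?thesis using g by (auto simp: gate_def)
    qed
    then show "\<exists>Z'\<in>neighbourhood (carrier GG) d r ` (\<lambda>g. g <# C) ` carrier GG. X \<subseteq> Z'" by blast
  qed
qed

lemma \<pi>_Nil_iff: "x \<in> carrier GG \<Longrightarrow> \<pi> x = [] \<Longrightarrow> x \<in> A"
  using \<pi>_value[of x] \<rho>_closed_A[of x] by simp

lemma gate_product:
  assumes "x \<in> gate ((c, h) # p)" "y \<in> gate ((c, h') # p)"
  shows "y \<in> (word_value p \<otimes> \<rho> x) <# (C <#> H)"
proof -
  have x: "x \<in> carrier GG" "\<pi> x = (c, h) # p" "c = \<rho> x <# C" using assms(1) by (auto simp: gate_def)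
  have y: "y \<in> carrier GG" "\<pi> y = (c, h') # p" "c = \<rho> y <# C" using assms(2) by (auto simp: gate_def)
  have p: "word_value p \<in> carrier GG" and h': "h' \<in> H" using valid_\<pi>[OF y(1)] y(2) by (auto simp: valid_def)
  have "\<rho> y \<in> \<rho> x <# C" using in_coset_self[OF \<rho>_closed_A[OF y(1)]] x(3) y(3) by simp
  then obtain b where b: "b \<in> C" "\<rho> y = \<rho> x \<otimes> b" unfolding l_coset_def by blast
  have "y = word_value p \<otimes> conj_letter (\<rho> y <# C) h' \<otimes> \<rho> y"
    using \<pi>_value[OF y(1)] y(2,3) by simp
  also have "\<dots> = word_value p \<otimes> (\<rho> y \<otimes> h' \<otimes> inv \<rho> y) \<otimes> \<rho> y"
    using conj_letter_eq[OF \<rho>_closed_A[OF y(1)] h'] by simp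
  also have "\<dots> = word_value p \<otimes> \<rho> y \<otimes> h'" using p h' y(1) by (simp add: m_assoc)
  also have "\<dots> = (word_value p \<otimes> \<rho> x) \<otimes> (b \<otimes> h')" using b p h' x(1) by (simp add: m_assoc)
  finally show ?thesis using b h' unfolding l_coset_def set_mult_def by blast
qed

text \<open>A level is added in two steps, each of which is an instance of the theorem on infinite unions. The first step
  adds the gates of the branches at the new level. They lie in cosets of \<open>C <#> H\<close>, and passing from one
  such coset to another takes a path through the old levels. The second step adds the fibres of
  \<open>\<pi>\<close>, which are contained in cosets of \<open>A\<close>, and paths between them run through the gates.\<close>

lemma uniform_asdim_le_ball_of_words:
  assumes asA: "uniform_asdim_le d n {A}" and asB: "uniform_asdim_le d n {C <#> H}"
  shows "uniform_asdim_le d n {ball_of_words N}"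
proof (induction N)
  case 0
  have "ball_of_words 0 \<subseteq> A" using \<pi>_Nil_iff by (auto simp: ball_of_words_def)
  then show ?case by (intro uniform_colouring_subsets[OF asA]) auto
next
  case (Suc N)
  have ball: "ball_of_words N \<subseteq> carrier GG" for N by (auto simp: ball_of_words_def)
  have sub: "A \<subseteq> carrier GG" "C <#> H \<subseteq> carrier GG" by (auto simp: set_mult_def)
  define I where "I = {(c :: 'a set, p :: ('a set \<times> 'a) list). length p = N}"
  define Z where "Z i = (\<Union>h. gate ((fst i, h) # snd i))" for i :: "'a set \<times> ('a set \<times> 'a) list"
  define Y where "Y = ball_of_words N \<union> (\<Union>i\<in>I. Z i)"
  have Z_sub: "Z i \<subseteq> carrier GG" for i by (auto simp: Z_def gate_def)
  have "uniform_asdim_le d n {Y}"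
    unfolding Y_def
  proof (rule uniform_asdim_le_infinite_union[OF Suc.IH])
    show "uniform_asdim_le d n (Z ` I)"
    proof (rule uniform_colouring_translates_subsets[OF asB sub(2)])
      fix X assume "X \<in> Z ` I"
      then obtain c p where X: "X = (\<Union>h. gate ((c, h) # p))" by (auto simp: Z_def I_def)
      show "X = {} \<or> (\<exists>g\<in>carrier GG. X \<subseteq> g <# (C <#> H))"
      proof (cases "X = {}")
        case False
        then obtain x h where x: "x \<in> gate ((c, h) # p)" using X by blast
        then have xG: "x \<in> carrier GG" "\<pi> x = (c, h) # p" by (auto simp: gate_def)
        then have "valid p" using valid_\<pi>[OF xG(1)] by (auto simp: valid_def)
        then have "word_value p \<otimes> \<rho> x \<in> carrier GG" using xG by simp
        moreover have "X \<subseteq> (word_value p \<otimes> \<rho> x) <# (C <#> H)" using gate_product[OF x] X by blast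
        ultimately show ?thesis by blast
      qed simp
    qed
    show "\<exists>\<rho>. \<forall>i\<in>I. \<forall>j\<in>I. \<forall>x\<in>Z i. \<forall>y\<in>Z j. i \<noteq> j \<longrightarrow> d x y \<le> r \<longrightarrow>
        x \<in> neighbourhood (carrier GG) d \<rho> (ball_of_words N)" for r
    proof (intro exI[of _ r] ballI impI)
      fix i j x y assume ij: "i \<in> I" "j \<in> I" "i \<noteq> j" and xy: "x \<in> Z i" "y \<in> Z j" "d x y \<le> r"
      obtain c p where i: "i = (c, p)" "length p = N" using ij(1) by (auto simp: I_def)
      obtain c' p' where j: "j = (c', p')" "length p' = N" using ij(2) by (auto simp: I_def)
      obtain h where x: "x \<in> carrier GG" "\<pi> x = (c, h) # p" using xy(1) i by (auto simp: Z_def gate_def)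
      obtain h' where y: "y \<in> carrier GG" "\<pi> y = (c', h') # p'" using xy(2) j by (auto simp: Z_def gate_def)
      have "\<not> suffix ((c, h'') # p) (\<pi> y)" for h''
        using y(2) i j ij(3) by (auto simp: suffix_Cons dest: suffix_length_le)
      moreover obtain m where "d x y = real m" "(x, y) \<in> cayley_adj GG S ^^ m"
        using cayley_dist_path[OF x(1) y(1)] .
      ultimately obtain z where "z \<in> carrier GG" "\<pi> z = p" "d x z \<le> d x y"
        using path_exit_coset[of x y m c h p] x by auto
      then show "x \<in> neighbourhood (carrier GG) d r (ball_of_words N)"
        using i x xy(3) by (auto simp: neighbourhood_def ball_of_words_def intro!: bexI[of _ z])
    qed
  qed (use ball Z_sub in auto)
  moreover define J where "J = {w :: ('a set \<times> 'a) list. length w = Suc N}"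
  define F where "F w = {x \<in> carrier GG. \<pi> x = w}" for w
  ultimately have "uniform_asdim_le d n {Y \<union> (\<Union>w\<in>J. F w)}"
  proof (intro uniform_asdim_le_infinite_union)
    show "uniform_asdim_le d n (F ` J)"
    proof (rule uniform_colouring_translates_subsets[OF asA sub(1)])
      fix X assume "X \<in> F ` J"
      then obtain w where X: "X = F w" by blast
      show "X = {} \<or> (\<exists>g\<in>carrier GG. X \<subseteq> g <# A)"
      proof (cases "X = {}")
        case False
        then obtain x where x: "x \<in> F w" using X by blast
        have "X \<subseteq> x <# A"
        proof
          fix y assume "y \<in> X"
          then have xy: "x \<in> carrier GG" "y \<in> carrier GG" "\<pi> x = \<pi> y" using x X by (auto simp: F_def)
          have "inv \<rho> x \<otimes> \<rho> y \<in> A"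
            using \<rho>_closed_A[OF xy(1)] \<rho>_closed_A[OF xy(2)] subgroup.m_closed[OF A_subgroup] subgroup.m_inv_closed[OF A_subgroup] by blast
          then show "y \<in> x <# A" using same_word[OF xy] xy by (intro l_coset_mem) auto
        qed
        then show ?thesis using x by (auto simp: F_def)
      qed simp
    qed
    show "\<exists>\<rho>. \<forall>i\<in>J. \<forall>j\<in>J. \<forall>x\<in>F i. \<forall>y\<in>F j. i \<noteq> j \<longrightarrow> d x y \<le> r \<longrightarrow>
        x \<in> neighbourhood (carrier GG) d \<rho> Y" for r
    proof (intro exI[of _ r] ballI impI)
      fix u w x y assume uw: "u \<in> J" "w \<in> J" "u \<noteq> w" and xy: "x \<in> F u" "y \<in> F w" "d x y \<le> r"
      then have "x \<in> carrier GG" "y \<in> carrier GG" "\<pi> x = u" "\<pi> y = w" by (auto simp: F_def)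
      moreover have "\<not> suffix u w" using uw by (auto simp: J_def suffix_def)
      ultimately obtain z where z: "z \<in> gate u" "d x z \<le> r" "x \<in> carrier GG"
        using dist_path_exit[of x y u] xy(3) by auto
      obtain c h p where u: "u = (c, h) # p" "length p = N"
        using uw(1) by (cases u) (auto simp: J_def)
      then have "z \<in> Z (c, p)" "(c, p) \<in> I" using z(1) by (auto simp: Z_def I_def)
      then have "z \<in> Y" by (auto simp: Y_def)
      then show "x \<in> neighbourhood (carrier GG) d r Y" using z by (auto simp: neighbourhood_def)
    qed
    show "Y \<subseteq> carrier GG" using ball Z_sub unfolding Y_def by blast
  qed (auto simp: F_def)
  moreover have "ball_of_words (Suc N) \<subseteq> Y \<union> (\<Union>w\<in>J. F w)"
    by (auto simp: Y_def J_def F_def ball_of_words_def le_Suc_eq)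
  ultimately show ?case by (blast intro: uniform_colouring_subsets)
qed

lemma uniform_asdim_le_pieces:
  assumes asA: "uniform_asdim_le d n {A}" and asB: "uniform_asdim_le d n {C <#> H}"
  shows "uniform_asdim_le d n (range (branch_piece (carrier GG) \<pi> N))"
proof (rule uniform_colouring_translates_subsets[OF uniform_asdim_le_ball_of_words[OF assms, of N]])
  show "ball_of_words N \<subseteq> carrier GG" by (auto simp: ball_of_words_def)
  fix X assume "X \<in> range (branch_piece (carrier GG) \<pi> N)"
  then obtain u where X: "X = branch_piece (carrier GG) \<pi> N u" by blast
  show "X = {} \<or> (\<exists>g\<in>carrier GG. X \<subseteq> g <# ball_of_words N)"
  proof (cases "valid u")
    case True
    have "X \<subseteq> word_value u <# ball_of_words N"
    proof
      fix x assume "x \<in> X"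
      then have x: "x \<in> carrier GG" "suffix u (\<pi> x)" "length (\<pi> x) \<le> length u + N"
        using X by (auto simp: branch_piece_def branch_def)
      obtain w where w: "\<pi> x = w @ u" using x(2) by (auto simp: suffix_def)
      have val: "valid (w @ u)" "valid w" using valid_\<pi>[OF x(1)] w by (auto simp: valid_def)
      have "x = word_value u \<otimes> (word_value w \<otimes> \<rho> x)"
        using \<pi>_value[OF x(1)] w word_value_append[OF val(1)] val True x(1) by (simp add: m_assoc)
      moreover have "word_value w \<otimes> \<rho> x \<in> ball_of_words N"
        using length_\<pi>_word_value[OF val(2) \<rho>_closed_A[OF x(1)]] x w val(2) by (simp add: ball_of_words_def)
      ultimately show "x \<in> word_value u <# ball_of_words N" unfolding l_coset_def by blast
    qed
    then show ?thesis using True by auto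
  next
    case False
    have "X = {}"
    proof (rule ccontr)
      assume "X \<noteq> {}"
      then obtain x where "x \<in> carrier GG" "suffix u (\<pi> x)" using X by (auto simp: branch_piece_def branch_def)
      then show False using valid_\<pi>[of x] set_mono_suffix[of u "\<pi> x"] False unfolding valid_def by blast
    qed
    then show ?thesis by simp
  qed
qed

theorem uniform_asdim_le_carrier:
  assumes "uniform_asdim_le d k {C}" "uniform_asdim_le d (Suc k) {A}" "uniform_asdim_le d (Suc k) {C <#> H}"
  shows "uniform_asdim_le d (Suc k) {carrier GG}"
proof (rule tree_gluing[of \<one> \<pi>])
  show "\<exists>p. suffix p (\<pi> x) \<and> suffix p (\<pi> y) \<and> length (\<pi> x) \<le> length p + d x y \<and> length (\<pi> y) \<le> length p + d x y"
    if xy: "x \<in> carrier GG" "y \<in> carrier GG" for x y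
  proof -
    obtain n where n: "d x y = real n" "(x, y) \<in> cayley_adj GG S ^^ n" using cayley_dist_path[OF xy] .
    from common_suffix_path[OF n(2)] show ?thesis unfolding n(1) by (metis of_nat_add of_nat_le_iff)
  qed
qed (use uniform_asdim_le_boundaries uniform_asdim_le_pieces assms \<pi>_one in auto)

end

section \<open>Universal property of graph products\<close>

text \<open>The canonical map from a vertex group to the graph product.\<close>

definition gp_inj :: "'v set \<Rightarrow> 'v set set \<Rightarrow> ('v \<Rightarrow> ('a, 'b) monoid_scheme) \<Rightarrow> 'v \<Rightarrow> 'a \<Rightarrow> ('v \<times> 'a) list set set" where
  "gp_inj V E G v g =
    normal_closure (free_product V G) (graph_product_relators V E G) #>\<^bsub>free_product V G\<^esub> fp_inj V G v g"

definition fp_eval :: "('c, 'd) monoid_scheme \<Rightarrow> ('v \<Rightarrow> 'a \<Rightarrow> 'c) \<Rightarrow> ('v \<times> 'a) list \<Rightarrow> 'c" where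
  "fp_eval K f w = foldr (\<lambda>l y. f (fst l) (snd l) \<otimes>\<^bsub>K\<^esub> y) w \<one>\<^bsub>K\<^esub>"

lemma fp_inj_closed:
  assumes "\<And>v. v \<in> V \<Longrightarrow> group (G v)" "v \<in> V" "g \<in> carrier (G v)"
  shows "fp_inj V G v g \<in> carrier (free_product V G)"
proof -
  have "fp_inj V G v \<in> hom (G v) (free_product V G)" using assms(1,2) by (rule fp_inj_hom)
  then show ?thesis using assms(3) by (auto simp: hom_def)
qed

lemma graph_product_projection_hom:
  assumes "\<And>v. v \<in> V \<Longrightarrow> group (G v)"
  shows "(\<lambda>a. normal_closure (free_product V G) (graph_product_relators V E G) #>\<^bsub>free_product V G\<^esub> a)
    \<in> hom (free_product V G) (graph_product V E G)"
  unfolding graph_product_def using normal_graph_product[OF assms] by (rule normal.r_coset_hom_Mod)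

lemma gp_inj_hom:
  assumes "\<And>v. v \<in> V \<Longrightarrow> group (G v)" "v \<in> V"
  shows "gp_inj V E G v \<in> hom (G v) (graph_product V E G)"
  using hom_compose[OF fp_inj_hom[OF assms] graph_product_projection_hom[OF assms(1)]]
  by (simp add: gp_inj_def[abs_def] comp_def)

lemma commute_if_commutator_one:
  assumes "group K" "x \<in> carrier K" "y \<in> carrier K" "commutator K x y = \<one>\<^bsub>K\<^esub>"
  shows "x \<otimes>\<^bsub>K\<^esub> y = y \<otimes>\<^bsub>K\<^esub> x"
proof -
  interpret group K by fact
  have "x \<otimes>\<^bsub>K\<^esub> y = commutator K x y \<otimes>\<^bsub>K\<^esub> y \<otimes>\<^bsub>K\<^esub> x"
  proof -
    have "inv\<^bsub>K\<^esub> y \<otimes>\<^bsub>K\<^esub> (y \<otimes>\<^bsub>K\<^esub> x) = x" using assms(2,3) by (simp flip: m_assoc)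
    then show ?thesis using assms(2,3) by (simp add: commutator_def m_assoc)
  qed
  then show ?thesis using assms by simp
qed

lemma commutator_one_if_commute:
  assumes "group K" "x \<in> carrier K" "y \<in> carrier K" "x \<otimes>\<^bsub>K\<^esub> y = y \<otimes>\<^bsub>K\<^esub> x"
  shows "commutator K x y = \<one>\<^bsub>K\<^esub>"
proof -
  interpret group K by fact
  show ?thesis using assms(2,3)
    by (simp add: commutator_def assms(4)) (simp add: m_assoc)
qed

lemma commutator_hom:
  assumes "group F" "group K" "\<phi> \<in> hom F K" "x \<in> carrier F" "y \<in> carrier F"
  shows "\<phi> (commutator F x y) = commutator K (\<phi> x) (\<phi> y)"
proof -
  interpret group_hom F K \<phi> using assms by (simp add: group_hom_def group_hom_axioms_def)
  show ?thesis using assms by (simp add: commutator_def)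
qed

lemma gp_inj_commute:
  assumes grp: "\<And>v. v \<in> V \<Longrightarrow> group (G v)" and vu: "v \<in> V" "u \<in> V" "{v, u} \<in> E"
    and gh: "g \<in> carrier (G v)" "h \<in> carrier (G u)"
  shows "gp_inj V E G v g \<otimes>\<^bsub>graph_product V E G\<^esub> gp_inj V E G u h
    = gp_inj V E G u h \<otimes>\<^bsub>graph_product V E G\<^esub> gp_inj V E G v g"
proof -
  let ?F = "free_product V G" and ?P = "graph_product V E G"
  let ?N = "normal_closure ?F (graph_product_relators V E G)"
  let ?p = "\<lambda>a. ?N #>\<^bsub>?F\<^esub> a"
  interpret F: group ?F using grp by (rule group_free_product)
  interpret P: group ?P using grp by (rule group_graph_product)
  interpret N: normal ?N ?F using grp by (rule normal_graph_product)
  have p: "?p \<in> hom ?F ?P" using grp by (rule graph_product_projection_hom)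
  have x: "fp_inj V G v g \<in> carrier ?F" and y: "fp_inj V G u h \<in> carrier ?F"
    using fp_inj_closed[of V G, OF grp] vu gh by blast+
  let ?r = "commutator ?F (fp_inj V G v g) (fp_inj V G u h)"
  have "?r \<in> graph_product_relators V E G"
    using vu gh unfolding graph_product_relators_def by blast
  then have "?r \<in> ?N" unfolding normal_closure_def by (rule hull_inc)
  then have "?p ?r = \<one>\<^bsub>?P\<^esub>"
    using N.rcos_const[OF F.is_group] by (simp add: graph_product_def)
  then have "commutator ?P (?p (fp_inj V G v g)) (?p (fp_inj V G u h)) = \<one>\<^bsub>?P\<^esub>"
    using commutator_hom[OF F.is_group P.is_group p x y] by simp
  moreover have "?p (fp_inj V G v g) \<in> carrier ?P" "?p (fp_inj V G u h) \<in> carrier ?P"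
    using p x y unfolding hom_def by blast+
  ultimately show ?thesis
    unfolding gp_inj_def by (intro commute_if_commutator_one[OF P.is_group])
qed

lemma fp_eval_universal:
  assumes grp: "\<And>v. v \<in> V \<Longrightarrow> group (G v)" and K: "group K"
    and f: "\<And>v. v \<in> V \<Longrightarrow> f v \<in> hom (G v) K"
  shows "\<exists>\<phi>\<in>hom (free_product V G) K. \<forall>v\<in>V. \<forall>g\<in>carrier (G v). \<phi> (fp_inj V G v g) = f v g"
proof -
  interpret K: group K by fact
  have f_closed: "f v g \<in> carrier K" if "v \<in> V" "g \<in> carrier (G v)" for v g
    using f that unfolding hom_def by blast
  have closed: "fp_eval K f w \<in> carrier K" if "w \<in> fp_words V G" for w
    using that by (induction w) (auto simp: fp_eval_def f_closed)
  have append: "fp_eval K f (x @ y) = fp_eval K f x \<otimes>\<^bsub>K\<^esub> fp_eval K f y"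
    if "x \<in> fp_words V G" "y \<in> fp_words V G" for x y
    using that closed by (induction x) (auto simp: fp_eval_def f_closed K.m_assoc)
  have step: "fp_eval K f x = fp_eval K f y" if "fp_step V G x y" for x y
    using that
  proof cases
    case (one xs ys v)
    have "f v \<one>\<^bsub>G v\<^esub> = \<one>\<^bsub>K\<^esub>"
      using hom_one[OF f[OF one(5)] grp[OF one(5)] K] .
    moreover have "[(v, \<one>\<^bsub>G v\<^esub>)] \<in> fp_words V G"
      using one(5) grp[OF one(5)] by (simp add: group.is_monoid monoid.one_closed)
    ultimately show ?thesis using one closed[OF one(4)] append by (simp add: fp_eval_def)
  next
    case (mult xs ys v g h)
    have gh: "g \<otimes>\<^bsub>G v\<^esub> h \<in> carrier (G v)"
      using mult grp[OF mult(5)] by (simp add: group.is_monoid monoid.m_closed)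
    have "fp_eval K f [(v, g), (v, h)] = fp_eval K f [(v, g \<otimes>\<^bsub>G v\<^esub> h)]"
      using hom_mult[OF f[OF mult(5)] mult(6,7)] f_closed mult by (simp add: fp_eval_def)
    moreover have "[(v, g), (v, h)] \<in> fp_words V G" "[(v, g \<otimes>\<^bsub>G v\<^esub> h)] \<in> fp_words V G"
      using mult gh by auto
    ultimately show ?thesis using mult(1-4) append by (simp del: fp_words_Cons append.simps)
  qed
  have rel: "fp_eval K f x = fp_eval K f y" if "(x, y) \<in> fp_rel V G" for x y
  proof -
    have "equivclp (fp_step V G) x y" using that by (simp add: fp_rel_def)
    then show ?thesis
    proof (induction rule: equivclp_induct)
      case (step y z)
      then show ?case using \<open>\<And>x y. fp_step V G x y \<Longrightarrow> fp_eval K f x = fp_eval K f y\<close> by metis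
    qed simp
  qed
  define \<phi> where "\<phi> X = fp_eval K f (SOME w. w \<in> X)" for X
  have \<phi>: "\<phi> (fp_rel V G `` {w}) = fp_eval K f w" if "w \<in> fp_words V G" for w
  proof -
    have "w \<in> fp_rel V G `` {w}" using that equiv_class_self[OF equiv_fp_rel] by fast
    then have "(SOME x. x \<in> fp_rel V G `` {w}) \<in> fp_rel V G `` {w}" by (rule someI)
    then show ?thesis using rel unfolding \<phi>_def by auto
  qed
  have "\<phi> \<in> hom (free_product V G) K"
    by (rule homI) (auto elim!: fp_carrierE simp: \<phi> closed fp_mult_class append)
  moreover have "\<phi> (fp_inj V G v g) = f v g" if "v \<in> V" "g \<in> carrier (G v)" for v g
    using that \<phi>[of "[(v, g)]"] f_closed[OF that] by (simp add: fp_inj_def fp_eval_def)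
  ultimately show ?thesis by blast
qed

text \<open>The homomorphism from the free product maps the relators to \<open>\<one>\<close>, so its kernel contains their normal
  closure.\<close>

lemma graph_product_universal:
  assumes grp: "\<And>v. v \<in> V \<Longrightarrow> group (G v)" and K: "group K"
    and f: "\<And>v. v \<in> V \<Longrightarrow> f v \<in> hom (G v) K"
    and comm: "\<And>v u g h. \<lbrakk>v \<in> V; u \<in> V; {v, u} \<in> E; g \<in> carrier (G v); h \<in> carrier (G u)\<rbrakk>
      \<Longrightarrow> f v g \<otimes>\<^bsub>K\<^esub> f u h = f u h \<otimes>\<^bsub>K\<^esub> f v g"
  obtains \<phi> where "\<phi> \<in> hom (graph_product V E G) K"
    and "\<And>v g. \<lbrakk>v \<in> V; g \<in> carrier (G v)\<rbrakk> \<Longrightarrow> \<phi> (gp_inj V E G v g) = f v g"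
proof -
  let ?F = "free_product V G"
  let ?N = "normal_closure ?F (graph_product_relators V E G)"
  obtain \<phi> where \<phi>: "\<phi> \<in> hom ?F K" "\<And>v g. \<lbrakk>v \<in> V; g \<in> carrier (G v)\<rbrakk> \<Longrightarrow> \<phi> (fp_inj V G v g) = f v g"
    using fp_eval_universal[of V G K f, OF grp K f] by blast
  interpret F: group ?F using grp by (rule group_free_product)
  interpret \<phi>: group_hom ?F K \<phi> using \<phi>(1) K by (simp add: group_hom_def group_hom_axioms_def F.is_group)
  have inj: "fp_inj V G v g \<in> carrier ?F" if "v \<in> V" "g \<in> carrier (G v)" for v g
    using grp that by (rule fp_inj_closed)
  have "graph_product_relators V E G \<subseteq> kernel ?F K \<phi>"
  proof
    fix r assume "r \<in> graph_product_relators V E G"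
    then obtain v u g h where r: "r = commutator ?F (fp_inj V G v g) (fp_inj V G u h)"
      and vu: "v \<in> V" "u \<in> V" "{v, u} \<in> E" "g \<in> carrier (G v)" "h \<in> carrier (G u)"
      unfolding graph_product_relators_def by blast
    have fc: "f v g \<in> carrier K" "f u h \<in> carrier K" using f vu unfolding hom_def by blast+
    have "\<phi> r = commutator K (f v g) (f u h)"
      using commutator_hom[OF F.is_group K \<phi>(1) inj[OF vu(1,4)] inj[OF vu(2,5)]] \<phi>(2) vu r by simp
    also have "\<dots> = \<one>\<^bsub>K\<^esub>" using commutator_one_if_commute[OF K fc comm[OF vu]] .
    finally show "r \<in> kernel ?F K \<phi>"
      using r inj[OF vu(1,4)] inj[OF vu(2,5)] by (simp add: kernel_def commutator_def)
  qed
  then have N_ker: "?N \<subseteq> kernel ?F K \<phi>"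
    unfolding normal_closure_def using \<phi>.normal_kernel by (intro hull_minimal)
  have "\<phi> x = \<phi> y" if xy: "x \<in> carrier ?F" "y \<in> carrier ?F" "?N #>\<^bsub>?F\<^esub> x = ?N #>\<^bsub>?F\<^esub> y" for x y
  proof -
    interpret N: normal ?N ?F using grp by (rule normal_graph_product)
    have "x \<in> ?N #>\<^bsub>?F\<^esub> y" using F.rcos_self[OF xy(1) N.subgroup_axioms] xy(3) by simp
    then obtain n where n: "n \<in> ?N" "x = n \<otimes>\<^bsub>?F\<^esub> y" unfolding r_coset_def by blast
    then have "n \<in> carrier ?F" "\<phi> n = \<one>\<^bsub>K\<^esub>" using N_ker by (auto simp: kernel_def)
    then show ?thesis using n xy by simp
  qed
  then obtain \<psi> where \<psi>: "\<psi> \<in> hom (?F Mod ?N) K" "\<And>x. x \<in> carrier ?F \<Longrightarrow> \<psi> (?N #>\<^bsub>?F\<^esub> x) = \<phi> x"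
    using FactGroup_universal[OF \<phi>(1) normal_graph_product[of V G E, OF grp]] by (metis (no_types, lifting))
  show ?thesis
  proof (rule that)
    show "\<psi> \<in> hom (graph_product V E G) K" using \<psi>(1) by (simp add: graph_product_def)
    show "\<psi> (gp_inj V E G v g) = f v g" if "v \<in> V" "g \<in> carrier (G v)" for v g
      using \<psi>(2)[OF inj[OF that]] \<phi>(2)[OF that] by (simp add: gp_inj_def)
  qed
qed

lemma graph_product_induct:
  assumes grp: "\<And>v. v \<in> V \<Longrightarrow> group (G v)" and x: "x \<in> carrier (graph_product V E G)"
    and one: "P \<one>\<^bsub>graph_product V E G\<^esub>"
    and mult: "\<And>x v g. \<lbrakk>x \<in> carrier (graph_product V E G); P x; v \<in> V; g \<in> carrier (G v)\<rbrakk>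
      \<Longrightarrow> P (x \<otimes>\<^bsub>graph_product V E G\<^esub> gp_inj V E G v g)"
  shows "P x"
proof -
  let ?F = "free_product V G" and ?P = "graph_product V E G"
  let ?p = "\<lambda>a. normal_closure ?F (graph_product_relators V E G) #>\<^bsub>?F\<^esub> a"
  interpret F: group ?F using grp by (rule group_free_product)
  interpret p: group_hom ?F ?P ?p
    using graph_product_projection_hom[of V G E, OF grp] group_graph_product[of V G E, OF grp]
    by (simp add: group_hom_def group_hom_axioms_def F.is_group)
  have "P (?p (fp_rel V G `` {w}))" if "w \<in> fp_words V G" for w
    using that
  proof (induction w rule: rev_induct)
    case Nil
    then show ?case using one p.hom_one by (simp add: free_product_def)
  next
    case (snoc l w)
    obtain v g where l: "l = (v, g)" by fastforce
    have w: "w \<in> fp_words V G" "v \<in> V" "g \<in> carrier (G v)" using snoc.prems l by auto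
    have vg: "[(v, g)] \<in> fp_words V G" using w by simp
    have "fp_rel V G `` {w @ [l]} = fp_rel V G `` {w} \<otimes>\<^bsub>?F\<^esub> fp_inj V G v g"
      using fp_mult_class[OF w(1) vg] l by (simp add: fp_inj_def)
    moreover have "fp_inj V G v g \<in> carrier ?F" unfolding fp_inj_def using vg by (rule fp_class_closed)
    ultimately have "?p (fp_rel V G `` {w @ [l]}) = ?p (fp_rel V G `` {w}) \<otimes>\<^bsub>?P\<^esub> gp_inj V E G v g"
      using fp_class_closed[OF w(1)] by (simp add: gp_inj_def)
    then show ?case
      using mult[OF _ snoc.IH[OF w(1)] w(2,3)] p.hom_closed[OF fp_class_closed[OF w(1)]] by simp
  qed
  moreover obtain X where "X \<in> carrier ?F" "x = ?p X"
    using x by (auto simp: graph_product_def carrier_FactGroup)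
  ultimately show ?thesis by (auto elim!: fp_carrierE)
qed

section \<open>Subgraphs\<close>

lemma gp_inj_closed:
  assumes "\<And>v. v \<in> V \<Longrightarrow> group (G v)" "v \<in> V" "g \<in> carrier (G v)"
  shows "gp_inj V E G v g \<in> carrier (graph_product V E G)"
proof -
  have "gp_inj V E G v \<in> hom (G v) (graph_product V E G)" using assms(1,2) by (rule gp_inj_hom)
  then show ?thesis using assms(3) by (auto simp: hom_def)
qed

lemma graph_product_inclusion:
  assumes grp: "\<And>v. v \<in> V \<Longrightarrow> group (G v)" and UV: "U \<subseteq> V"
  obtains i where "i \<in> hom (graph_product U E G) (graph_product V E G)"
    and "\<And>v g. \<lbrakk>v \<in> U; g \<in> carrier (G v)\<rbrakk> \<Longrightarrow> i (gp_inj U E G v g) = gp_inj V E G v g"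
proof (rule graph_product_universal[of U G "graph_product V E G" "gp_inj V E G" E])
  show "group (graph_product V E G)" using grp by (rule group_graph_product)
  show "gp_inj V E G v \<in> hom (G v) (graph_product V E G)" if "v \<in> U" for v
    using grp UV that by (blast intro: gp_inj_hom)
  show "gp_inj V E G v g \<otimes>\<^bsub>graph_product V E G\<^esub> gp_inj V E G u h
      = gp_inj V E G u h \<otimes>\<^bsub>graph_product V E G\<^esub> gp_inj V E G v g"
    if "v \<in> U" "u \<in> U" "{v, u} \<in> E" "g \<in> carrier (G v)" "h \<in> carrier (G u)" for v u g h
    using that UV by (intro gp_inj_commute grp) auto
qed (use grp UV that in auto)

lemma graph_product_retraction:
  assumes grp: "\<And>v. v \<in> V \<Longrightarrow> group (G v)" and UV: "U \<subseteq> V"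
  obtains q where "q \<in> hom (graph_product V E G) (graph_product U E G)"
    and "\<And>v g. \<lbrakk>v \<in> U; g \<in> carrier (G v)\<rbrakk> \<Longrightarrow> q (gp_inj V E G v g) = gp_inj U E G v g"
    and "\<And>v g. \<lbrakk>v \<in> V - U; g \<in> carrier (G v)\<rbrakk> \<Longrightarrow> q (gp_inj V E G v g) = \<one>\<^bsub>graph_product U E G\<^esub>"
proof -
  let ?P = "graph_product U E G"
  have grpU: "group (G v)" if "v \<in> U" for v using grp UV that by blast
  interpret P: group ?P using grpU by (rule group_graph_product)
  define f where "f v = (if v \<in> U then gp_inj U E G v else (\<lambda>_. \<one>\<^bsub>?P\<^esub>))" for v
  have f: "f v \<in> hom (G v) ?P" for v
    using gp_inj_hom[of U G v E, OF grpU] by (auto simp: f_def hom_def)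
  have closed: "gp_inj U E G v g \<in> carrier ?P" if "v \<in> U" "g \<in> carrier (G v)" for v g
    using grpU that by (rule gp_inj_closed)
  obtain q where q: "q \<in> hom (graph_product V E G) ?P"
    "\<And>v g. \<lbrakk>v \<in> V; g \<in> carrier (G v)\<rbrakk> \<Longrightarrow> q (gp_inj V E G v g) = f v g"
  proof (rule graph_product_universal[of V G ?P f E])
    show "f v g \<otimes>\<^bsub>?P\<^esub> f u h = f u h \<otimes>\<^bsub>?P\<^esub> f v g"
      if "v \<in> V" "u \<in> V" "{v, u} \<in> E" "g \<in> carrier (G v)" "h \<in> carrier (G u)" for v u g h
      using that closed gp_inj_commute[of U G v u E g h, OF grpU] by (auto simp: f_def)
  qed (use grp f that P.is_group in auto)
  show ?thesis
  proof (rule that[OF q(1)])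
    show "q (gp_inj V E G v g) = gp_inj U E G v g" if "v \<in> U" "g \<in> carrier (G v)" for v g
      using q(2)[of v g] that UV by (auto simp: f_def)
    show "q (gp_inj V E G v g) = \<one>\<^bsub>?P\<^esub>" if "v \<in> V - U" "g \<in> carrier (G v)" for v g
      using q(2)[of v g] that by (auto simp: f_def)
  qed
qed

lemma graph_product_vertex_retraction:
  assumes grp: "\<And>v. v \<in> V \<Longrightarrow> group (G v)" and v: "v \<in> V" and no_loop: "{v} \<notin> E"
  obtains q where "q \<in> hom (graph_product V E G) (G v)"
    and "\<And>g. g \<in> carrier (G v) \<Longrightarrow> q (gp_inj V E G v g) = g"
    and "\<And>u g. \<lbrakk>u \<in> V - {v}; g \<in> carrier (G u)\<rbrakk> \<Longrightarrow> q (gp_inj V E G u g) = \<one>\<^bsub>G v\<^esub>"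
proof -
  interpret group "G v" using grp v by blast
  define f where "f u g = (if u = v then g else \<one>\<^bsub>G v\<^esub>)" for u and g
  have f: "f u \<in> hom (G u) (G v)" for u
    by (cases "u = v") (auto simp: f_def hom_def)
  obtain q where q: "q \<in> hom (graph_product V E G) (G v)"
    "\<And>u g. \<lbrakk>u \<in> V; g \<in> carrier (G u)\<rbrakk> \<Longrightarrow> q (gp_inj V E G u g) = f u g"
  proof (rule graph_product_universal[of V G "G v" f E])
    show "f u g \<otimes>\<^bsub>G v\<^esub> f u' h = f u' h \<otimes>\<^bsub>G v\<^esub> f u g"
      if "u \<in> V" "u' \<in> V" "{u, u'} \<in> E" "g \<in> carrier (G u)" "h \<in> carrier (G u')" for u u' g h
      using that no_loop by (cases "u = v"; cases "u' = v") (auto simp: f_def)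
  qed (use grp f that is_group in auto)
  show ?thesis
  proof (rule that[OF q(1)])
    show "q (gp_inj V E G v g) = g" if "g \<in> carrier (G v)" for g
      using q(2)[OF v that] by (simp add: f_def)
    show "q (gp_inj V E G u g) = \<one>\<^bsub>G v\<^esub>" if "u \<in> V - {v}" "g \<in> carrier (G u)" for u g
      using q(2)[of u g] that by (simp add: f_def)
  qed
qed

lemma graph_product_hom_eqI:
  assumes grp: "\<And>v. v \<in> V \<Longrightarrow> group (G v)" and K: "group K"
    and \<phi>: "\<phi> \<in> hom (graph_product V E G) K" and \<psi>: "\<psi> \<in> hom (graph_product V E G) K"
    and eq: "\<And>v g. \<lbrakk>v \<in> V; g \<in> carrier (G v)\<rbrakk> \<Longrightarrow> \<phi> (gp_inj V E G v g) = \<psi> (gp_inj V E G v g)"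
    and x: "x \<in> carrier (graph_product V E G)"
  shows "\<phi> x = \<psi> x"
proof (rule graph_product_induct[of V G x E "\<lambda>x. \<phi> x = \<psi> x", OF grp x])
  have P: "group (graph_product V E G)" using grp by (rule group_graph_product)
  show "\<phi> \<one>\<^bsub>graph_product V E G\<^esub> = \<psi> \<one>\<^bsub>graph_product V E G\<^esub>"
    using hom_one[OF \<phi> P K] hom_one[OF \<psi> P K] by simp
  fix x v g
  assume "x \<in> carrier (graph_product V E G)" "\<phi> x = \<psi> x" and v: "v \<in> V" "g \<in> carrier (G v)"
  moreover have "gp_inj V E G v g \<in> carrier (graph_product V E G)" using grp v by (rule gp_inj_closed)
  ultimately show "\<phi> (x \<otimes>\<^bsub>graph_product V E G\<^esub> gp_inj V E G v g) = \<psi> (x \<otimes>\<^bsub>graph_product V E G\<^esub> gp_inj V E G v g)"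
    using hom_mult[OF \<phi>] hom_mult[OF \<psi>] eq by simp
qed

lemma retraction_inclusion:
  assumes grp: "\<And>v. v \<in> U \<Longrightarrow> group (G v)"
    and i: "i \<in> hom (graph_product U E G) P"
      "\<And>v g. \<lbrakk>v \<in> U; g \<in> carrier (G v)\<rbrakk> \<Longrightarrow> i (gp_inj U E G v g) = f v g"
    and q: "q \<in> hom P (graph_product U E G)"
      "\<And>v g. \<lbrakk>v \<in> U; g \<in> carrier (G v)\<rbrakk> \<Longrightarrow> q (f v g) = gp_inj U E G v g"
    and x: "x \<in> carrier (graph_product U E G)"
  shows "q (i x) = x"
proof -
  let ?P = "graph_product U E G"
  have P: "group ?P" using grp by (rule group_graph_product)
  have "(\<lambda>x. q (i x)) \<in> hom ?P ?P" using hom_compose[OF i(1) q(1)] by (simp add: comp_def)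
  moreover have "(\<lambda>x. x) \<in> hom ?P ?P" by (simp add: hom_def)
  ultimately show ?thesis
    using graph_product_hom_eqI[of U G ?P "\<lambda>x. q (i x)" E "\<lambda>x. x" x, OF grp P] i(2) q(2) x by simp
qed

lemma hom_image_subgroup:
  assumes "group K" "group L" "i \<in> hom K L"
  shows "subgroup (i ` carrier K) L"
  using assms group_hom.img_is_subgroup[of K L i] by (simp add: group_hom_def group_hom_axioms_def)

section \<open>The action of a graph product on reduced words\<close>

text \<open>The reduced words are the normal forms of a free product of copies of \<open>H\<close> indexed by the type \<open>'l\<close>.\<close>

definition reduced :: "('g, 'b) monoid_scheme \<Rightarrow> 'g set \<Rightarrow> ('l \<times> 'g) list \<Rightarrow> bool" where
  "reduced K H w \<longleftrightarrow> (\<forall>l\<in>set w. snd l \<in> H \<and> snd l \<noteq> \<one>\<^bsub>K\<^esub>) \<and> distinct_adj (map fst w)"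

text \<open>Each reduced word has a unique form \<open>prepend K c k p\<close> with given \<open>c\<close> such that \<open>p\<close> does not begin with the
  index \<open>c\<close>. In this form \<^const>\<open>push\<close> is multiplication of \<open>k\<close>, which shows that it is an action of \<open>H\<close>.\<close>

definition prepend :: "('g, 'b) monoid_scheme \<Rightarrow> 'l \<Rightarrow> 'g \<Rightarrow> ('l \<times> 'g) list \<Rightarrow> ('l \<times> 'g) list" where
  "prepend K c k p = (if k = \<one>\<^bsub>K\<^esub> then p else (c, k) # p)"

lemma reduced_prependE:
  assumes "reduced K H w" "\<one>\<^bsub>K\<^esub> \<in> H"
  obtains k p where "k \<in> H" "reduced K H p" "p = [] \<or> fst (hd p) \<noteq> c" "w = prepend K c k p"
proof (cases "w = [] \<or> fst (hd w) \<noteq> c")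
  case True
  then show ?thesis using that[of "\<one>\<^bsub>K\<^esub>" w] assms by (simp add: prepend_def)
next
  case False
  then obtain k p where w: "w = (c, k) # p" by (cases w) auto
  then show ?thesis
    using that[of k p] assms(1) by (cases p) (auto simp: prepend_def reduced_def)
qed

lemma reduced_prepend:
  "\<lbrakk>reduced K H p; k \<in> H; p = [] \<or> fst (hd p) \<noteq> c\<rbrakk> \<Longrightarrow> reduced K H (prepend K c k p)"
  by (cases p) (auto simp: prepend_def reduced_def)

lemma push_prepend:
  assumes K: "group K" and h: "h \<in> carrier K" and k: "k \<in> carrier K" and p: "p = [] \<or> fst (hd p) \<noteq> c"
  shows "push K c h (prepend K c k p) = prepend K c (k \<otimes>\<^bsub>K\<^esub> h) p"
proof -
  interpret group K by fact
  show ?thesis using h k p by (cases p) (auto simp: push_def prepend_def)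
qed

lemma reduced_push:
  assumes K: "group K" and H: "subgroup H K" and w: "reduced K H w" and h: "h \<in> H"
  shows "reduced K H (push K c h w)"
proof -
  obtain k p where kp: "k \<in> H" "reduced K H p" "p = [] \<or> fst (hd p) \<noteq> c" "w = prepend K c k p"
    using reduced_prependE[OF w subgroup.one_closed[OF H], of c] by metis
  then have "push K c h w = prepend K c (k \<otimes>\<^bsub>K\<^esub> h) p"
    using push_prepend[OF K _ _ kp(3)] h subgroup.mem_carrier[OF H] by simp
  then show ?thesis using reduced_prepend[OF kp(2) _ kp(3)] kp(1) h subgroup.m_closed[OF H] by simp
qed

lemma push_push:
  assumes K: "group K" and H: "subgroup H K" and w: "reduced K H w" and h: "h \<in> H" "h' \<in> H"
  shows "push K c h' (push K c h w) = push K c (h \<otimes>\<^bsub>K\<^esub> h') w"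
proof -
  interpret group K by fact
  obtain k p where kp: "k \<in> H" "reduced K H p" "p = [] \<or> fst (hd p) \<noteq> c" "w = prepend K c k p"
    using reduced_prependE[OF w subgroup.one_closed[OF H], of c] by metis
  then show ?thesis
    using push_prepend[OF K _ _ kp(3)] h subgroup.mem_carrier[OF H] by (simp add: m_assoc)
qed

text \<open>An action given by a function of two arguments, as a homomorphism to the group of bijections.\<close>

lemma BijGroup_hom:
  assumes "group H" and closed: "\<And>h m. \<lbrakk>h \<in> carrier H; m \<in> M\<rbrakk> \<Longrightarrow> F h m \<in> M"
    and one: "\<And>m. m \<in> M \<Longrightarrow> F \<one>\<^bsub>H\<^esub> m = m"
    and mult: "\<And>g h m. \<lbrakk>g \<in> carrier H; h \<in> carrier H; m \<in> M\<rbrakk> \<Longrightarrow> F (g \<otimes>\<^bsub>H\<^esub> h) m = F g (F h m)"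
  shows "(\<lambda>h. restrict (F h) M) \<in> hom H (BijGroup M)"
proof -
  interpret group H by fact
  have bij: "restrict (F h) M \<in> Bij M" if h: "h \<in> carrier H" for h
  proof -
    have inv: "F h (F (inv\<^bsub>H\<^esub> h) m) = m" "F (inv\<^bsub>H\<^esub> h) (F h m) = m" if "m \<in> M" for m
      using that h mult[of h "inv\<^bsub>H\<^esub> h" m] mult[of "inv\<^bsub>H\<^esub> h" h m] one by auto
    have "bij_betw (F h) M M"
      by (rule bij_betw_byWitness[where f' = "F (inv\<^bsub>H\<^esub> h)"]) (use inv closed h in auto)
    then show ?thesis by (simp add: Bij_def bij_betw_restrict_eq)
  qed
  show ?thesis
  proof (rule homI)
    fix g h assume gh: "g \<in> carrier H" "h \<in> carrier H"
    show "restrict (F g) M \<in> carrier (BijGroup M)" using bij[OF gh(1)] by (simp add: BijGroup_def)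
    show "restrict (F (g \<otimes>\<^bsub>H\<^esub> h)) M = restrict (F g) M \<otimes>\<^bsub>BijGroup M\<^esub> restrict (F h) M"
      using bij gh closed mult by (auto simp: BijGroup_def compose_def restrict_def fun_eq_iff)
  qed
qed

lemma BijGroup_mult_restrict:
  assumes "restrict F M \<in> carrier (BijGroup M)" "restrict F' M \<in> carrier (BijGroup M)"
  shows "restrict F M \<otimes>\<^bsub>BijGroup M\<^esub> restrict F' M = restrict (\<lambda>m. F (F' m)) M"
proof -
  have "F' m \<in> M" if "m \<in> M" for m
    using assms(2) that Bij_imp_funcset[of "restrict F' M" M] by (force simp: BijGroup_def)
  then show ?thesis using assms by (auto simp: BijGroup_def compose_def restrict_def fun_eq_iff)
qed

text \<open>\<open>P\<close> acts from the right on the pairs \<open>(w, a)\<close> of a reduced word and an element of \<open>A\<close>: the vertex groups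
  other than \<open>G v\<close> multiply \<open>a\<close>, and \<open>h\<close> in \<open>G v\<close> appends the letter \<open>(a C, h)\<close> to \<open>w\<close>. The latter
  operation commutes with the multiplication of \<open>a\<close> by elements of \<open>C\<close>, because that leaves the coset
  \<open>a C\<close> unchanged. The word of \<open>x\<close> is the first component of the image of \<open>([], \<one>)\<close> under \<open>x\<close>.\<close>

lemma word_map_exists:
  fixes V' :: "'v set" and G :: "'v \<Rightarrow> ('a, 'b) monoid_scheme" and v E
  defines "V \<equiv> insert v V'"
  defines "P \<equiv> graph_product V E G" and "\<iota> \<equiv> gp_inj V E G"
  assumes grp: "\<And>u. u \<in> V \<Longrightarrow> group (G u)" and v: "v \<notin> V'" and no_loops: "\<And>u. {u} \<notin> E"
    and A: "subgroup A P" and C: "subgroup C P" and CA: "C \<subseteq> A"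
    and \<iota>A: "\<And>u g. \<lbrakk>u \<in> V'; g \<in> carrier (G u)\<rbrakk> \<Longrightarrow> \<iota> u g \<in> A"
    and \<iota>C: "\<And>u g. \<lbrakk>u \<in> V'; {u, v} \<in> E; g \<in> carrier (G u)\<rbrakk> \<Longrightarrow> \<iota> u g \<in> C"
    and \<rho>: "\<rho> \<in> hom P P" and \<rho>_V': "\<And>u g. \<lbrakk>u \<in> V'; g \<in> carrier (G u)\<rbrakk> \<Longrightarrow> \<rho> (\<iota> u g) = \<iota> u g"
    and \<rho>_v: "\<And>g. g \<in> carrier (G v) \<Longrightarrow> \<rho> (\<iota> v g) = \<one>\<^bsub>P\<^esub>"
  shows "\<exists>\<pi>. \<pi> \<one>\<^bsub>P\<^esub> = [] \<and>
    (\<forall>x\<in>carrier P. \<forall>u\<in>V'. \<forall>g\<in>carrier (G u). \<pi> (x \<otimes>\<^bsub>P\<^esub> \<iota> u g) = \<pi> x) \<and>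
    (\<forall>x\<in>carrier P. \<forall>g\<in>carrier (G v). \<pi> (x \<otimes>\<^bsub>P\<^esub> \<iota> v g) = push P (\<rho> x <#\<^bsub>P\<^esub> C) (\<iota> v g) (\<pi> x))"
proof -
  have P: "group P" unfolding P_def using grp by (rule group_graph_product)
  interpret P: group P by (rule P)
  have \<iota>_hom: "\<iota> u \<in> hom (G u) P" if "u \<in> V" for u
    unfolding \<iota>_def P_def using grp that by (rule gp_inj_hom)
  have \<iota>_closed [simp]: "\<iota> u g \<in> carrier P" if "u \<in> V" "g \<in> carrier (G u)" for u g
    unfolding \<iota>_def P_def using grp that by (rule gp_inj_closed)
  have vV: "v \<in> V" and V'V: "u \<in> V' \<Longrightarrow> u \<in> V" for u by (auto simp: V_def)
  define H where "H = \<iota> v ` carrier (G v)"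
  have H: "subgroup H P" unfolding H_def using grp[OF vV] P \<iota>_hom[OF vV] by (rule hom_image_subgroup)
  have A_closed [simp]: "a \<in> carrier P" if "a \<in> A" for a using subgroup.mem_carrier[OF A that] .
  define act where "act u g m = (if u = v then (push P (snd m <#\<^bsub>P\<^esub> C) (\<iota> v g) (fst m), snd m)
    else (fst m, snd m \<otimes>\<^bsub>P\<^esub> \<iota> u g))" for u g and m :: "(_ set \<times> _) list \<times> _"
  define M where "M = {m :: (('v \<times> 'a) list set set set \<times> ('v \<times> 'a) list set set) list \<times> ('v \<times> 'a) list set set.
    reduced P H (fst m) \<and> snd m \<in> A}"
  have \<iota>H: "\<iota> v g \<in> H" if "g \<in> carrier (G v)" for g using that by (simp add: H_def)
  have act_M: "act u g m \<in> M" if "u \<in> V" "g \<in> carrier (G u)" "m \<in> M" for u g m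
    using that \<iota>A[of u g] reduced_push[OF P H _ \<iota>H] subgroup.m_closed[OF A]
    by (auto simp: act_def M_def V_def)
  have act_mult: "act u g (act u h m) = act u (h \<otimes>\<^bsub>G u\<^esub> g) m"
    if u: "u \<in> V" and gh: "g \<in> carrier (G u)" "h \<in> carrier (G u)" and m: "m \<in> M" for u g h m
  proof -
    have \<iota>_mult: "\<iota> u (h \<otimes>\<^bsub>G u\<^esub> g) = \<iota> u h \<otimes>\<^bsub>P\<^esub> \<iota> u g" using hom_mult[OF \<iota>_hom[OF u]] gh by blast
    show ?thesis
    proof (cases "u = v")
      case True
      have red: "reduced P H (fst m)" using m by (simp add: M_def)
      show ?thesis
        using push_push[OF P H red \<iota>H \<iota>H] True gh \<iota>_mult by (simp add: act_def)
    next
      case False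
      have "snd m \<in> carrier P" using m by (simp add: M_def)
      then show ?thesis using False u gh \<iota>_mult by (simp add: act_def P.m_assoc)
    qed
  qed
  have act_one: "act u \<one>\<^bsub>G u\<^esub> m = m" if u: "u \<in> V" and m: "m \<in> M" for u m
  proof -
    have "\<iota> u \<one>\<^bsub>G u\<^esub> = \<one>\<^bsub>P\<^esub>" using hom_one[OF \<iota>_hom[OF u] grp[OF u] P] .
    then show ?thesis using m by (cases m) (auto simp: act_def M_def)
  qed
  have act_commute: "act u g (act u' h m) = act u' h (act u g m)"
    if u: "u \<in> V" "u' \<in> V" "{u, u'} \<in> E" and gh: "g \<in> carrier (G u)" "h \<in> carrier (G u')" and m: "m \<in> M"
    for u u' g h m
  proof -
    have neq: "u \<noteq> u'" using u no_loops by auto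
    have mA: "snd m \<in> A" using m by (simp add: M_def)
    have coset: "(snd m \<otimes>\<^bsub>P\<^esub> c) <#\<^bsub>P\<^esub> C = snd m <#\<^bsub>P\<^esub> C" if "c \<in> C" for c
    proof -
      have "c <#\<^bsub>P\<^esub> C = C" using P.lcos_mult_one P.coset_join3[OF subgroup.mem_carrier[OF C that] C that] by simp
      then show ?thesis
        using P.lcos_m_assoc[OF subgroup.subset[OF C], of "snd m" c] mA subgroup.mem_carrier[OF C that] by simp
    qed
    show ?thesis
    proof (cases "u = v \<or> u' = v")
      case True
      then show ?thesis
        using neq u gh coset \<iota>C[of u g] \<iota>C[of u' h] by (auto simp: act_def V_def insert_commute)
    next
      case False
      have "\<iota> u g \<otimes>\<^bsub>P\<^esub> \<iota> u' h = \<iota> u' h \<otimes>\<^bsub>P\<^esub> \<iota> u g"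
        unfolding \<iota>_def P_def using grp u gh by (rule gp_inj_commute)
      then show ?thesis using False mA u gh by (simp add: act_def P.m_assoc)
    qed
  qed
  \<comment> \<open>Composition of functions is a left action, hence the inverse.\<close>
  define f where "f u g = restrict (act u (inv\<^bsub>G u\<^esub> g)) M" for u g
  have f_hom: "f u \<in> hom (G u) (BijGroup M)" if u: "u \<in> V" for u
  proof -
    interpret Gu: group "G u" using grp[OF u] .
    show ?thesis
      unfolding f_def
      by (rule BijGroup_hom[OF Gu.is_group]) (use u act_M act_one act_mult in \<open>auto simp: Gu.inv_mult_group\<close>)
  qed
  have f_closed: "f u g \<in> carrier (BijGroup M)" if "u \<in> V" "g \<in> carrier (G u)" for u g
    using f_hom[OF that(1)] that(2) unfolding hom_def by blast
  have inv_closed: "inv\<^bsub>G u\<^esub> g \<in> carrier (G u)" if "u \<in> V" "g \<in> carrier (G u)" for u g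
    using grp[OF that(1)] that(2) by (rule group.inv_closed)
  obtain \<phi> where \<phi>: "\<phi> \<in> hom P (BijGroup M)" "\<And>u g. \<lbrakk>u \<in> V; g \<in> carrier (G u)\<rbrakk> \<Longrightarrow> \<phi> (\<iota> u g) = f u g"
    unfolding P_def \<iota>_def
  proof (rule graph_product_universal[of V G "BijGroup M" f E])
    show "f u g \<otimes>\<^bsub>BijGroup M\<^esub> f u' h = f u' h \<otimes>\<^bsub>BijGroup M\<^esub> f u g"
      if u: "u \<in> V" "u' \<in> V" "{u, u'} \<in> E" "g \<in> carrier (G u)" "h \<in> carrier (G u')" for u u' g h
    proof -
      have "restrict (\<lambda>m. act u (inv\<^bsub>G u\<^esub> g) (act u' (inv\<^bsub>G u'\<^esub> h) m)) M
          = restrict (\<lambda>m. act u' (inv\<^bsub>G u'\<^esub> h) (act u (inv\<^bsub>G u\<^esub> g) m)) M"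
        using act_commute[OF u(1-3) inv_closed[OF u(1,4)] inv_closed[OF u(2,5)]] by (intro restrict_ext)
      then show ?thesis
        using f_closed[OF u(1,4)] f_closed[OF u(2,5)] unfolding f_def by (simp add: BijGroup_mult_restrict)
    qed
  qed (use grp f_hom group_BijGroup in auto)
  have carrier_Bij: "carrier (BijGroup M) = Bij M" by (simp add: BijGroup_def)
  have one_Bij: "\<one>\<^bsub>BijGroup M\<^esub> m = m" if "m \<in> M" for m using that by (simp add: BijGroup_def)
  have mult_Bij: "(a \<otimes>\<^bsub>BijGroup M\<^esub> b) m = a (b m)" if "a \<in> Bij M" "b \<in> Bij M" "m \<in> M" for a b m
    using that by (simp add: BijGroup_def compose_def)
  interpret \<phi>: group_hom P "BijGroup M" \<phi>
    using \<phi>(1) group_BijGroup by (simp add: group_hom_def group_hom_axioms_def)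
  let ?m0 = "([], \<one>\<^bsub>P\<^esub>)"
  have m0: "?m0 \<in> M" using subgroup.one_closed[OF A] by (simp add: M_def reduced_def)
  define state where "state x = \<phi> (inv\<^bsub>P\<^esub> x) ?m0" for x
  have state_M: "state x \<in> M" if "x \<in> carrier P" for x
  proof -
    have "\<phi> (inv\<^bsub>P\<^esub> x) \<in> Bij M"
      using \<phi>.hom_closed[OF P.inv_closed[OF that]] unfolding carrier_Bij .
    from funcset_mem[OF Bij_imp_funcset[OF this] m0] show ?thesis by (simp only: state_def)
  qed
  have state_one: "state \<one>\<^bsub>P\<^esub> = ?m0"
    using one_Bij[OF m0] unfolding state_def P.inv_one \<phi>.hom_one .
  have state_mult: "state (x \<otimes>\<^bsub>P\<^esub> \<iota> u g) = act u g (state x)"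
    if x: "x \<in> carrier P" and u: "u \<in> V" "g \<in> carrier (G u)" for x u g
  proof -
    interpret \<iota>u: group_hom "G u" P "\<iota> u"
      using grp[OF u(1)] P \<iota>_hom[OF u(1)] by (simp add: group_hom_def group_hom_axioms_def)
    have "inv\<^bsub>P\<^esub> (x \<otimes>\<^bsub>P\<^esub> \<iota> u g) = \<iota> u (inv\<^bsub>G u\<^esub> g) \<otimes>\<^bsub>P\<^esub> inv\<^bsub>P\<^esub> x"
      using x u by (simp add: P.inv_mult_group)
    then have "\<phi> (inv\<^bsub>P\<^esub> (x \<otimes>\<^bsub>P\<^esub> \<iota> u g)) = f u (inv\<^bsub>G u\<^esub> g) \<otimes>\<^bsub>BijGroup M\<^esub> \<phi> (inv\<^bsub>P\<^esub> x)"
      using \<phi>.hom_mult[OF \<iota>_closed[OF u(1) inv_closed[OF u]] P.inv_closed[OF x]]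
      by (simp only: \<phi>(2)[OF u(1) inv_closed[OF u]])
    moreover have "\<phi> (inv\<^bsub>P\<^esub> x) \<in> Bij M" "f u (inv\<^bsub>G u\<^esub> g) \<in> Bij M"
      using \<phi>.hom_closed[OF P.inv_closed[OF x]] f_closed[OF u(1) inv_closed[OF u]]
      unfolding carrier_Bij by blast+
    ultimately have "state (x \<otimes>\<^bsub>P\<^esub> \<iota> u g) = f u (inv\<^bsub>G u\<^esub> g) (state x)"
      using mult_Bij[of "f u (inv\<^bsub>G u\<^esub> g)" "\<phi> (inv\<^bsub>P\<^esub> x)" ?m0] m0 by (simp only: state_def)
    then show ?thesis using state_M[OF x] u by (simp add: f_def)
  qed
  have state_\<rho>: "snd (state x) = \<rho> x" if "x \<in> carrier P" for x
  proof (rule graph_product_induct[of V G x E "\<lambda>x. snd (state x) = \<rho> x", OF grp that[unfolded P_def]])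
    show "snd (state \<one>\<^bsub>graph_product V E G\<^esub>) = \<rho> \<one>\<^bsub>graph_product V E G\<^esub>"
      using state_one hom_one[OF \<rho> P P] by (simp add: P_def)
    fix x u g
    assume "x \<in> carrier (graph_product V E G)" and eq: "snd (state x) = \<rho> x" and u: "u \<in> V" "g \<in> carrier (G u)"
    then have x: "x \<in> carrier P" by (simp add: P_def)
    have "\<rho> (x \<otimes>\<^bsub>P\<^esub> \<iota> u g) = \<rho> x \<otimes>\<^bsub>P\<^esub> \<rho> (\<iota> u g)"
      using hom_mult[OF \<rho>] x u by simp
    moreover have "snd (state x) \<in> carrier P" using state_M[OF x] by (auto simp: M_def)
    ultimately have "snd (state (x \<otimes>\<^bsub>P\<^esub> \<iota> u g)) = \<rho> (x \<otimes>\<^bsub>P\<^esub> \<iota> u g)"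
      using state_mult[OF x u] eq u v \<rho>_V'[of u g] \<rho>_v[of g]
      by (cases "u = v") (auto simp: act_def V_def)
    then show "snd (state (x \<otimes>\<^bsub>graph_product V E G\<^esub> gp_inj V E G u g))
        = \<rho> (x \<otimes>\<^bsub>graph_product V E G\<^esub> gp_inj V E G u g)"
      by (simp add: P_def \<iota>_def)
  qed
  show ?thesis
  proof (intro exI[of _ "\<lambda>x. fst (state x)"] conjI ballI)
    show "fst (state \<one>\<^bsub>P\<^esub>) = []" by (simp add: state_one)
    show "fst (state (x \<otimes>\<^bsub>P\<^esub> \<iota> u g)) = fst (state x)"
      if "x \<in> carrier P" "u \<in> V'" "g \<in> carrier (G u)" for x u g
      using that state_mult[of x u g] v V'V by (auto simp: act_def)
    show "fst (state (x \<otimes>\<^bsub>P\<^esub> \<iota> v g)) = push P (\<rho> x <#\<^bsub>P\<^esub> C) (\<iota> v g) (fst (state x))"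
      if "x \<in> carrier P" "g \<in> carrier (G v)" for x g
      using that state_mult[of x v g] vV state_\<rho>[of x] by (simp add: act_def)
  qed
qed

section \<open>Homomorphisms and word metrics\<close>

lemma generated_groupI: "\<lbrakk>group K; finite_generating_set K S\<rbrakk> \<Longrightarrow> generated_group K S"
  by (simp add: generated_group_def generated_group_axioms_def finite_generating_set_def)

lemma hom_Lipschitz:
  assumes K: "group K" "finite_generating_set K S" and L: "group L" "finite_generating_set L T"
    and \<phi>: "\<phi> \<in> hom K L"
  shows "\<exists>c\<ge>0. \<forall>x\<in>carrier K. \<forall>y\<in>carrier K. cayley_dist L T (\<phi> x) (\<phi> y) \<le> c * cayley_dist K S x y"
proof -
  interpret K: generated_group K S using K by (rule generated_groupI)
  interpret L: generated_group L T using L by (rule generated_groupI)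
  interpret Metric_space "carrier L" "cayley_dist L T" by (rule L.Metric_space_cayley)
  interpret \<phi>: group_hom K L \<phi>
    using \<phi> by (simp add: group_hom_def group_hom_axioms_def K.is_group L.is_group)
  define c where "c = (\<Sum>s\<in>S. cayley_dist L T \<one>\<^bsub>L\<^esub> (\<phi> s))"
  have c: "0 \<le> c" unfolding c_def by (simp add: sum_nonneg)
  have edge: "cayley_dist L T (\<phi> x) (\<phi> (x \<otimes>\<^bsub>K\<^esub> s)) \<le> c" if x: "x \<in> carrier K" and s: "s \<in> S" for x s
  proof -
    have sK: "s \<in> carrier K" using s K.S_subset by blast
    have "cayley_dist L T (\<phi> x \<otimes>\<^bsub>L\<^esub> \<one>\<^bsub>L\<^esub>) (\<phi> x \<otimes>\<^bsub>L\<^esub> \<phi> s) \<le> cayley_dist L T \<one>\<^bsub>L\<^esub> (\<phi> s)"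
      using x sK by (intro L.cayley_dist_translate) auto
    also have "\<dots> \<le> c" unfolding c_def
      using K(2) s by (intro member_le_sum) (auto simp: finite_generating_set_def)
    finally show ?thesis using x sK by simp
  qed
  have adj: "x \<in> carrier K \<and> y \<in> carrier K \<and> cayley_dist L T (\<phi> x) (\<phi> y) \<le> c"
    if "(x, y) \<in> cayley_adj K S" for x y
    using that edge K.S_subset unfolding cayley_graph_def by (auto simp: commute)
  have path: "y \<in> carrier K \<and> cayley_dist L T (\<phi> x) (\<phi> y) \<le> c * real n"
    if "(x, y) \<in> cayley_adj K S ^^ n" "x \<in> carrier K" for x y n
    using that
  proof (induction n arbitrary: y)
    case 0 then show ?case by simp
  next
    case (Suc n)
    then obtain z where z: "(x, z) \<in> cayley_adj K S ^^ n" "(z, y) \<in> cayley_adj K S" by auto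
    have "cayley_dist L T (\<phi> x) (\<phi> y) \<le> cayley_dist L T (\<phi> x) (\<phi> z) + cayley_dist L T (\<phi> z) (\<phi> y)"
      using Suc.prems(2) adj[OF z(2)] by (intro triangle) auto
    then show ?case using Suc.IH[OF z(1) Suc.prems(2)] adj[OF z(2)] by (simp add: algebra_simps)
  qed
  have "cayley_dist L T (\<phi> x) (\<phi> y) \<le> c * cayley_dist K S x y" if xy: "x \<in> carrier K" "y \<in> carrier K" for x y
    using K.cayley_dist_path[OF xy] path[OF _ xy(1)] by metis
  then show ?thesis using c by blast
qed

lemma adim_le_iff:
  assumes "group K" "finite_generating_set K S"
  shows "adim K \<le> enat n \<longleftrightarrow> uniform_asdim_le (cayley_dist K S) n {carrier K}"
proof -
  interpret generated_group K S using assms by (rule generated_groupI)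
  interpret Metric_space "carrier K" "cayley_dist K S" by (rule Metric_space_cayley)
  have iff: "asdim_le m \<longleftrightarrow> uniform_asdim_le (cayley_dist K S) m {carrier K}" for m
    using uniform_asdim_le_if_asdim_le asdim_le_if_uniform_asdim_le by blast
  have "asdim \<le> enat n \<longleftrightarrow> asdim_le n"
  proof
    assume le: "asdim \<le> enat n"
    then have ex: "\<exists>m. asdim_le m" by (auto simp: asdim_def split: if_splits)
    then have "asdim_le (LEAST m. asdim_le m)" by (rule LeastI_ex)
    moreover have "(LEAST m. asdim_le m) \<le> n" using le ex by (simp add: asdim_def)
    ultimately show "asdim_le n" unfolding iff by (rule uniform_asdim_le_mono) auto
  next
    assume "asdim_le n"
    then show "asdim \<le> enat n" by (auto simp: asdim_def intro: Least_le)
  qed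
  then show ?thesis using iff adim_eq[OF assms] by simp
qed

text \<open>Homomorphisms are Lipschitz for word metrics, so an inclusion with a retraction is a bi-Lipschitz embedding.\<close>

lemma uniform_asdim_le_retract:
  assumes K: "group K" "finite_generating_set K S" and L: "group L" "finitely_generated L"
    and i: "i \<in> hom L K" and q: "q \<in> hom K L" and qi: "\<And>x. x \<in> carrier L \<Longrightarrow> q (i x) = x"
    and adim: "adim L \<le> enat n"
  shows "uniform_asdim_le (cayley_dist K S) n {i ` carrier L}"
proof -
  obtain T where T: "finite_generating_set L T" using L(2) by (auto simp: finitely_generated_def)
  interpret K: generated_group K S using K by (rule generated_groupI)
  interpret L: generated_group L T using L(1) T by (rule generated_groupI)
  interpret dK: Metric_space "carrier K" "cayley_dist K S" by (rule K.Metric_space_cayley)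
  interpret dL: Metric_space "carrier L" "cayley_dist L T" by (rule L.Metric_space_cayley)
  obtain a where a: "0 \<le> a" "\<And>x y. \<lbrakk>x \<in> carrier K; y \<in> carrier K\<rbrakk> \<Longrightarrow>
      cayley_dist L T (q x) (q y) \<le> a * cayley_dist K S x y"
    using hom_Lipschitz[OF K L(1) T q] by blast
  obtain b where b: "0 \<le> b" "\<And>x y. \<lbrakk>x \<in> carrier L; y \<in> carrier L\<rbrakk> \<Longrightarrow>
      cayley_dist K S (i x) (i y) \<le> b * cayley_dist L T x y"
    using hom_Lipschitz[OF L(1) T K i] by blast
  have i_closed: "i x \<in> carrier K" if "x \<in> carrier L" for x using i that by (auto simp: hom_def)
  have "uniform_asdim_le (cayley_dist L T) n {carrier L}" using adim_le_iff[OF L(1) T] adim by blast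
  then show ?thesis
  proof (rule uniform_colouring_pullback[where K = "a + b" and L = 0])
    fix Z assume Z: "Z \<in> {i ` carrier L}"
    have "cayley_dist L T (q (i x)) (q (i y)) \<le> (a + b) * cayley_dist K S (i x) (i y) + 0 \<and>
        cayley_dist K S (i x) (i y) \<le> (a + b) * cayley_dist L T (q (i x)) (q (i y)) + 0"
      if xy: "x \<in> carrier L" "y \<in> carrier L" for x y
    proof -
      have "0 \<le> b * cayley_dist K S (i x) (i y)" "0 \<le> a * cayley_dist L T x y" using a(1) b(1) by simp_all
      then show ?thesis using a(2)[OF i_closed i_closed, OF xy] b(2)[OF xy] qi xy by (simp add: distrib_right)
    qed
    then show "\<exists>Z'\<in>{carrier L}. \<exists>\<phi>. \<phi> ` Z \<subseteq> Z' \<and> (\<forall>x\<in>Z. \<forall>y\<in>Z.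
        cayley_dist L T (\<phi> x) (\<phi> y) \<le> (a + b) * cayley_dist K S x y + 0 \<and>
        cayley_dist K S x y \<le> (a + b) * cayley_dist L T (\<phi> x) (\<phi> y) + 0)"
      using Z qi by (intro bexI[of _ "carrier L"] exI[of _ q]) auto
  qed (use a b in auto)
qed

section \<open>Adding a vertex\<close>

lemma graph_product_image_subset:
  assumes grp: "\<And>v. v \<in> U \<Longrightarrow> group (G v)" and L: "group L" and i: "i \<in> hom (graph_product U E G) L"
    and B: "subgroup B L" and gen: "\<And>v g. \<lbrakk>v \<in> U; g \<in> carrier (G v)\<rbrakk> \<Longrightarrow> i (gp_inj U E G v g) \<in> B"
  shows "i ` carrier (graph_product U E G) \<subseteq> B"
proof (rule image_subsetI)
  fix x assume x: "x \<in> carrier (graph_product U E G)"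
  have P: "group (graph_product U E G)" using grp by (rule group_graph_product)
  show "i x \<in> B"
  proof (rule graph_product_induct[of U G x E "\<lambda>x. i x \<in> B", OF grp x])
    show "i \<one>\<^bsub>graph_product U E G\<^esub> \<in> B"
      using hom_one[OF i P L] subgroup.one_closed[OF B] by simp
    fix x v g
    assume x: "x \<in> carrier (graph_product U E G)" "i x \<in> B" and v: "v \<in> U" "g \<in> carrier (G v)"
    have "gp_inj U E G v g \<in> carrier (graph_product U E G)" using grp v by (rule gp_inj_closed)
    then show "i (x \<otimes>\<^bsub>graph_product U E G\<^esub> gp_inj U E G v g) \<in> B"
      using hom_mult[OF i x(1)] gen[OF v] x(2) subgroup.m_closed[OF B] by simp
  qed
qed

lemma subgroup_centralizer:
  assumes "group L" "h \<in> carrier L"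
  shows "subgroup {x \<in> carrier L. x \<otimes>\<^bsub>L\<^esub> h = h \<otimes>\<^bsub>L\<^esub> x} L"
proof -
  interpret group L by fact
  show ?thesis
  proof (rule subgroupI)
    show "{x \<in> carrier L. x \<otimes>\<^bsub>L\<^esub> h = h \<otimes>\<^bsub>L\<^esub> x} \<noteq> {}"
      using assms(2) by (auto intro: exI[of _ "\<one>\<^bsub>L\<^esub>"])
    fix x assume x: "x \<in> {x \<in> carrier L. x \<otimes>\<^bsub>L\<^esub> h = h \<otimes>\<^bsub>L\<^esub> x}"
    then have "h \<otimes>\<^bsub>L\<^esub> inv\<^bsub>L\<^esub> x = inv\<^bsub>L\<^esub> x \<otimes>\<^bsub>L\<^esub> h"
      using assms(2) by (simp add: inv_solve_left inv_solve_right flip: m_assoc)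
    then show "inv\<^bsub>L\<^esub> x \<in> {x \<in> carrier L. x \<otimes>\<^bsub>L\<^esub> h = h \<otimes>\<^bsub>L\<^esub> x}" using x by simp
    fix y assume y: "y \<in> {x \<in> carrier L. x \<otimes>\<^bsub>L\<^esub> h = h \<otimes>\<^bsub>L\<^esub> x}"
    have "x \<otimes>\<^bsub>L\<^esub> y \<otimes>\<^bsub>L\<^esub> h = x \<otimes>\<^bsub>L\<^esub> (h \<otimes>\<^bsub>L\<^esub> y)" using x y assms(2) by (simp add: m_assoc)
    also have "\<dots> = h \<otimes>\<^bsub>L\<^esub> x \<otimes>\<^bsub>L\<^esub> y" using x y assms(2) by (simp flip: m_assoc)
    finally show "x \<otimes>\<^bsub>L\<^esub> y \<in> {x \<in> carrier L. x \<otimes>\<^bsub>L\<^esub> h = h \<otimes>\<^bsub>L\<^esub> x}"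
      using x y assms(2) by (simp add: m_assoc)
  qed auto
qed

text \<open>The induction step. The subgroups that belong to the other vertices, to the neighbours of \<open>v\<close> and to \<open>v\<close>
  itself are retracts of the graph product, so that their intrinsic asymptotic dimensions can be used
  for them as subsets of its Cayley graph.\<close>

lemma adim_graph_product_insert_vertex:
  fixes V' :: "'v set" and G :: "'v \<Rightarrow> ('a, 'b) monoid_scheme" and v E
  defines "V \<equiv> insert v V'" and "lk \<equiv> {u \<in> V'. {u, v} \<in> E}"
  assumes fin: "finite V'" and v: "v \<notin> V'" and no_loops: "\<And>u. {u} \<notin> E"
    and grp: "\<And>u. u \<in> V \<Longrightarrow> group (G u)" and fg: "\<And>u. u \<in> V \<Longrightarrow> finitely_generated (G u)"
    and adim_A: "adim (graph_product V' E G) \<le> enat (Suc k)"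
    and adim_C: "adim (graph_product lk E G) \<le> enat c"
    and adim_H: "adim (G v) \<le> enat h" and ck: "c \<le> k" and chk: "c + h \<le> Suc k"
  shows "adim (graph_product V E G) \<le> enat (Suc k)"
proof -
  let ?P = "graph_product V E G" and ?PA = "graph_product V' E G" and ?PC = "graph_product lk E G"
  let ?\<iota> = "gp_inj V E G"
  have vV: "v \<in> V" and V'V: "V' \<subseteq> V" and lkV': "lk \<subseteq> V'" and lkV: "lk \<subseteq> V" and v_lk: "v \<in> V - lk" "v \<in> V - V'"
    using v by (auto simp: V_def lk_def)
  have grpA: "group (G u)" if "u \<in> V'" for u using grp V'V that by blast
  have grpC: "group (G u)" if "u \<in> lk" for u using grp lkV that by blast
  have P: "group ?P" using grp by (rule group_graph_product)
  have PA: "group ?PA" using grpA by (rule group_graph_product)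
  have PC: "group ?PC" using grpC by (rule group_graph_product)
  have Gv: "group (G v)" using grp vV .
  interpret P: group ?P by (rule P)
  have fgA: "finitely_generated ?PA"
    using fin grpA fg V'V by (intro finitely_generated_graph_product) auto
  have fgC: "finitely_generated ?PC"
    using fin grpC fg lkV finite_subset[OF lkV'] by (intro finitely_generated_graph_product) auto
  have \<iota>_hom: "?\<iota> u \<in> hom (G u) ?P" if "u \<in> V" for u using grp that by (rule gp_inj_hom)
  have \<iota>_closed: "?\<iota> u g \<in> carrier ?P" if "u \<in> V" "g \<in> carrier (G u)" for u g
    using grp that by (rule gp_inj_closed)
  obtain iA where iA: "iA \<in> hom ?PA ?P" "\<And>u g. \<lbrakk>u \<in> V'; g \<in> carrier (G u)\<rbrakk> \<Longrightarrow> iA (gp_inj V' E G u g) = ?\<iota> u g"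
    using graph_product_inclusion[of V G V' E, OF grp V'V] by metis
  obtain qA where qA: "qA \<in> hom ?P ?PA" "\<And>u g. \<lbrakk>u \<in> V'; g \<in> carrier (G u)\<rbrakk> \<Longrightarrow> qA (?\<iota> u g) = gp_inj V' E G u g"
    "\<And>u g. \<lbrakk>u \<in> V - V'; g \<in> carrier (G u)\<rbrakk> \<Longrightarrow> qA (?\<iota> u g) = \<one>\<^bsub>?PA\<^esub>"
    using graph_product_retraction[of V G V' E, OF grp V'V] by metis
  obtain iC where iC: "iC \<in> hom ?PC ?P" "\<And>u g. \<lbrakk>u \<in> lk; g \<in> carrier (G u)\<rbrakk> \<Longrightarrow> iC (gp_inj lk E G u g) = ?\<iota> u g"
    using graph_product_inclusion[of V G lk E, OF grp lkV] by metis
  obtain qC where qC: "qC \<in> hom ?P ?PC" "\<And>u g. \<lbrakk>u \<in> lk; g \<in> carrier (G u)\<rbrakk> \<Longrightarrow> qC (?\<iota> u g) = gp_inj lk E G u g"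
    "\<And>u g. \<lbrakk>u \<in> V - lk; g \<in> carrier (G u)\<rbrakk> \<Longrightarrow> qC (?\<iota> u g) = \<one>\<^bsub>?PC\<^esub>"
    using graph_product_retraction[of V G lk E, OF grp lkV] by metis
  obtain qv where qv: "qv \<in> hom ?P (G v)" "\<And>g. g \<in> carrier (G v) \<Longrightarrow> qv (?\<iota> v g) = g"
    "\<And>u g. \<lbrakk>u \<in> V - {v}; g \<in> carrier (G u)\<rbrakk> \<Longrightarrow> qv (?\<iota> u g) = \<one>\<^bsub>G v\<^esub>"
    using graph_product_vertex_retraction[of V G v E, OF grp vV no_loops] by metis
  have qiA: "qA (iA x) = x" if "x \<in> carrier ?PA" for x
    using grpA iA(1) iA(2) qA(1) qA(2) that by (rule retraction_inclusion)
  have qiC: "qC (iC x) = x" if "x \<in> carrier ?PC" for x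
    using grpC iC(1) iC(2) qC(1) qC(2) that by (rule retraction_inclusion)
  define A where "A = iA ` carrier ?PA"
  define C where "C = iC ` carrier ?PC"
  define H where "H = ?\<iota> v ` carrier (G v)"
  define \<rho> where "\<rho> x = iA (qA x)" for x
  have A: "subgroup A ?P" unfolding A_def using PA P iA(1) by (rule hom_image_subgroup)
  have C: "subgroup C ?P" unfolding C_def using PC P iC(1) by (rule hom_image_subgroup)
  have H: "subgroup H ?P" unfolding H_def using Gv P \<iota>_hom[OF vV] by (rule hom_image_subgroup)
  have \<rho>: "\<rho> \<in> hom ?P ?P" using hom_compose[OF qA(1) iA(1)] by (simp add: comp_def \<rho>_def[abs_def])
  have \<iota>A: "?\<iota> u g \<in> A" if "u \<in> V'" "g \<in> carrier (G u)" for u g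
    using iA(2)[OF that] gp_inj_closed[of V' G u g E, OF grpA that] unfolding A_def by force
  have \<iota>C: "?\<iota> u g \<in> C" if "u \<in> lk" "g \<in> carrier (G u)" for u g
    using iC(2)[OF that] gp_inj_closed[of lk G u g E, OF grpC that] unfolding C_def by force
  have CA: "C \<subseteq> A"
    unfolding C_def
  proof (rule graph_product_image_subset[of lk G ?P iC E A, OF grpC P iC(1) A])
    show "iC (gp_inj lk E G u g) \<in> A" if "u \<in> lk" "g \<in> carrier (G u)" for u g
      using iC(2)[OF that] \<iota>A[of u g] that lkV' by auto
  qed
  have CH: "x \<otimes>\<^bsub>?P\<^esub> y = y \<otimes>\<^bsub>?P\<^esub> x" if x: "x \<in> C" and y: "y \<in> H" for x y
  proof -
    obtain g where g: "g \<in> carrier (G v)" "y = ?\<iota> v g" using y by (auto simp: H_def)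
    have "C \<subseteq> {x \<in> carrier ?P. x \<otimes>\<^bsub>?P\<^esub> y = y \<otimes>\<^bsub>?P\<^esub> x}"
      unfolding C_def
    proof (rule graph_product_image_subset[of lk G ?P iC E, OF grpC P iC(1)])
      show "subgroup {x \<in> carrier ?P. x \<otimes>\<^bsub>?P\<^esub> y = y \<otimes>\<^bsub>?P\<^esub> x} ?P"
        using P \<iota>_closed[OF vV g(1)] unfolding g(2) by (rule subgroup_centralizer)
      fix u g' assume u: "u \<in> lk" "g' \<in> carrier (G u)"
      then have uv: "u \<in> V" "{u, v} \<in> E" using V'V by (auto simp: lk_def)
      have "?\<iota> u g' \<otimes>\<^bsub>?P\<^esub> ?\<iota> v g = ?\<iota> v g \<otimes>\<^bsub>?P\<^esub> ?\<iota> u g'"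
        using grp uv(1) vV uv(2) u(2) g(1) by (rule gp_inj_commute)
      then show "iC (gp_inj lk E G u g') \<in> {x \<in> carrier ?P. x \<otimes>\<^bsub>?P\<^esub> y = y \<otimes>\<^bsub>?P\<^esub> x}"
        using iC(2)[OF u] \<iota>_closed[OF uv(1) u(2)] g(2) by simp
    qed
    then show ?thesis using x by blast
  qed
  have \<rho>A: "\<rho> x \<in> A" if "x \<in> carrier ?P" for x
    using that qA(1) by (auto simp: \<rho>_def A_def hom_def)
  have \<rho>_fix: "\<rho> a = a" if "a \<in> A" for a using that qiA by (auto simp: \<rho>_def A_def)
  have \<rho>_v: "\<rho> (?\<iota> v g) = \<one>\<^bsub>?P\<^esub>" if "g \<in> carrier (G v)" for g
    using qA(3)[OF v_lk(2) that] hom_one[OF iA(1) PA P] by (simp add: \<rho>_def)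
  have "\<exists>\<pi>. \<pi> \<one>\<^bsub>?P\<^esub> = [] \<and>
    (\<forall>x\<in>carrier ?P. \<forall>u\<in>V'. \<forall>g\<in>carrier (G u). \<pi> (x \<otimes>\<^bsub>?P\<^esub> ?\<iota> u g) = \<pi> x) \<and>
    (\<forall>x\<in>carrier ?P. \<forall>g\<in>carrier (G v). \<pi> (x \<otimes>\<^bsub>?P\<^esub> ?\<iota> v g) = push ?P (\<rho> x <#\<^bsub>?P\<^esub> C) (?\<iota> v g) (\<pi> x))"
    unfolding V_def
  proof (rule word_map_exists[where A = A])
    show "gp_inj (insert v V') E G u g \<in> C" if "u \<in> V'" "{u, v} \<in> E" "g \<in> carrier (G u)" for u g
      using \<iota>C[of u g] that by (simp add: lk_def V_def)
  qed (use grp v no_loops A C CA \<iota>A \<rho> \<rho>_fix \<rho>_v in \<open>auto simp: V_def\<close>)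
  then obtain \<pi> where \<pi>: "\<pi> \<one>\<^bsub>?P\<^esub> = []"
    "\<And>x u g. \<lbrakk>x \<in> carrier ?P; u \<in> V'; g \<in> carrier (G u)\<rbrakk> \<Longrightarrow> \<pi> (x \<otimes>\<^bsub>?P\<^esub> ?\<iota> u g) = \<pi> x"
    "\<And>x g. \<lbrakk>x \<in> carrier ?P; g \<in> carrier (G v)\<rbrakk> \<Longrightarrow>
      \<pi> (x \<otimes>\<^bsub>?P\<^esub> ?\<iota> v g) = push ?P (\<rho> x <#\<^bsub>?P\<^esub> C) (?\<iota> v g) (\<pi> x)"
    by metis
  have \<pi>_A: "\<pi> (x \<otimes>\<^bsub>?P\<^esub> iA y) = \<pi> x" if x: "x \<in> carrier ?P" and y: "y \<in> carrier ?PA" for x y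
  proof (rule graph_product_induct[of V' G y E "\<lambda>y. \<pi> (x \<otimes>\<^bsub>?P\<^esub> iA y) = \<pi> x", OF grpA y])
    show "\<pi> (x \<otimes>\<^bsub>?P\<^esub> iA \<one>\<^bsub>?PA\<^esub>) = \<pi> x" using hom_one[OF iA(1) PA P] x by simp
    fix y u g assume y: "y \<in> carrier ?PA" and eq: "\<pi> (x \<otimes>\<^bsub>?P\<^esub> iA y) = \<pi> x" and u: "u \<in> V'" "g \<in> carrier (G u)"
    have "gp_inj V' E G u g \<in> carrier ?PA" using grpA u by (rule gp_inj_closed)
    then have "iA (y \<otimes>\<^bsub>?PA\<^esub> gp_inj V' E G u g) = iA y \<otimes>\<^bsub>?P\<^esub> ?\<iota> u g"
      using hom_mult[OF iA(1) y] iA(2)[OF u] by simp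
    moreover have iAy: "iA y \<in> carrier ?P" using iA(1) y by (auto simp: hom_def)
    moreover have "?\<iota> u g \<in> carrier ?P" using \<iota>_closed[of u g] u V'V by blast
    ultimately have "x \<otimes>\<^bsub>?P\<^esub> iA (y \<otimes>\<^bsub>?PA\<^esub> gp_inj V' E G u g) = x \<otimes>\<^bsub>?P\<^esub> iA y \<otimes>\<^bsub>?P\<^esub> ?\<iota> u g"
      using x by (simp add: P.m_assoc)
    then show "\<pi> (x \<otimes>\<^bsub>?P\<^esub> iA (y \<otimes>\<^bsub>?PA\<^esub> gp_inj V' E G u g)) = \<pi> x"
      using \<pi>(2)[OF P.m_closed[OF x iAy] u] eq by simp
  qed
  obtain TA where TA: "finite_generating_set ?PA TA" using fgA by (auto simp: finitely_generated_def)
  obtain TH where TH: "finite_generating_set (G v) TH" using fg[OF vV] by (auto simp: finitely_generated_def)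
  define S where "S = iA ` TA \<union> ?\<iota> v ` TH"
  interpret iA: group_hom ?PA ?P iA using iA(1) by (simp add: group_hom_def group_hom_axioms_def PA P)
  interpret \<iota>v: group_hom "G v" ?P "?\<iota> v" using \<iota>_hom[OF vV] by (simp add: group_hom_def group_hom_axioms_def Gv P)
  have S_AH: "S \<subseteq> A \<union> H"
    using TA TH by (auto simp: S_def A_def H_def finite_generating_set_def)
  have S_P: "S \<subseteq> carrier ?P" using S_AH subgroup.subset[OF A] subgroup.subset[OF H] by blast
  have gen_A: "A \<subseteq> generate ?P S"
  proof -
    have "A = generate ?P (iA ` TA)" using iA.generate_img[of TA] TA by (simp add: A_def finite_generating_set_def)
    also have "\<dots> \<subseteq> generate ?P S" by (rule P.mono_generate) (auto simp: S_def)
    finally show ?thesis .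
  qed
  have gen_H: "H \<subseteq> generate ?P S"
  proof -
    have "H = generate ?P (?\<iota> v ` TH)" using \<iota>v.generate_img[of TH] TH by (simp add: H_def finite_generating_set_def)
    also have "\<dots> \<subseteq> generate ?P S" by (rule P.mono_generate) (auto simp: S_def)
    finally show ?thesis .
  qed
  have "x \<in> generate ?P S" if x: "x \<in> carrier ?P" for x
  proof (rule graph_product_induct[of V G x E "\<lambda>x. x \<in> generate ?P S", OF grp x])
    show "\<one>\<^bsub>?P\<^esub> \<in> generate ?P S" by (rule generate.one)
    show "x \<otimes>\<^bsub>?P\<^esub> ?\<iota> u g \<in> generate ?P S"
      if "x \<in> generate ?P S" "u \<in> V" "g \<in> carrier (G u)" for x u g
      using that gen_A gen_H \<iota>A by (intro generate.eng) (auto simp: V_def H_def)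
  qed
  then have S_gen: "generate ?P S = carrier ?P" using P.generate_incl[OF S_P] by blast
  have S: "finite_generating_set ?P S"
    using TA TH S_P S_gen by (simp add: finite_generating_set_def S_def)
  interpret T: tree_extension ?P S A C H \<rho> \<pi>
  proof (intro tree_extension.intro tree_extension_axioms.intro generated_groupI[OF P S])
    show "\<pi> (x \<otimes>\<^bsub>?P\<^esub> h) = push ?P (\<rho> x <#\<^bsub>?P\<^esub> C) h (\<pi> x)" if "x \<in> carrier ?P" "h \<in> H" for x h
      using that \<pi>(3) by (auto simp: H_def)
    show "\<pi> (x \<otimes>\<^bsub>?P\<^esub> a) = \<pi> x" if "x \<in> carrier ?P" "a \<in> A" for x a
      using that \<pi>_A by (auto simp: A_def)
    show "\<rho> h = \<one>\<^bsub>?P\<^esub>" if "h \<in> H" for h using that \<rho>_v by (auto simp: H_def)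
    show "x \<otimes>\<^bsub>?P\<^esub> y = y \<otimes>\<^bsub>?P\<^esub> x" if "x \<in> C" "y \<in> H" for x y using that by (rule CH)
  qed (use A C H CA \<rho> \<rho>A \<rho>_fix S_AH \<pi>(1) in auto)
  have asA: "uniform_asdim_le T.d (Suc k) {A}"
    unfolding A_def using P S PA fgA iA(1) qA(1) qiA adim_A by (rule uniform_asdim_le_retract)
  have asC: "uniform_asdim_le T.d c {C}"
    unfolding C_def using P S PC fgC iC(1) qC(1) qiC adim_C by (rule uniform_asdim_le_retract)
  have asH: "uniform_asdim_le T.d h {H}"
    unfolding H_def using P S Gv fg[OF vV] \<iota>_hom[OF vV] qv(1) qv(2) adim_H by (rule uniform_asdim_le_retract)
  have asCH: "uniform_asdim_le T.d (c + h) {C <#>\<^bsub>?P\<^esub> H}"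
  proof -
    define \<phi>C where "\<phi>C x = iC (qC x)" for x
    define \<phi>H where "\<phi>H x = ?\<iota> v (qv x)" for x
    have \<phi>C: "\<phi>C \<in> hom ?P ?P" using hom_compose[OF qC(1) iC(1)] by (simp add: comp_def \<phi>C_def[abs_def])
    have \<phi>H: "\<phi>H \<in> hom ?P ?P" using hom_compose[OF qv(1) \<iota>_hom[OF vV]] by (simp add: comp_def \<phi>H_def[abs_def])
    have C_qv: "qv x = \<one>\<^bsub>G v\<^esub>" if "x \<in> C" for x
    proof -
      have hom: "(\<lambda>y. qv (iC y)) \<in> hom ?PC (G v)" using hom_compose[OF iC(1) qv(1)] by (simp add: comp_def)
      have "(\<lambda>y. qv (iC y)) ` carrier ?PC \<subseteq> {\<one>\<^bsub>G v\<^esub>}"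
      proof (rule graph_product_image_subset[of lk G "G v" "\<lambda>y. qv (iC y)" E, OF grpC Gv hom])
        show "subgroup {\<one>\<^bsub>G v\<^esub>} (G v)" using Gv by (rule group.triv_subgroup)
        show "qv (iC (gp_inj lk E G u g)) \<in> {\<one>\<^bsub>G v\<^esub>}" if "u \<in> lk" "g \<in> carrier (G u)" for u g
          using iC(2)[OF that] qv(3)[of u g] that lkV v lkV' by auto
      qed
      then show ?thesis using that by (auto simp: C_def)
    qed
    have proj: "\<phi>C (x \<otimes>\<^bsub>?P\<^esub> y) = x" "\<phi>H (x \<otimes>\<^bsub>?P\<^esub> y) = y" if x: "x \<in> C" and y: "y \<in> H" for x y
    proof -
      obtain g where g: "g \<in> carrier (G v)" "y = ?\<iota> v g" using y by (auto simp: H_def)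
      have "\<phi>C x = x" using x qiC by (auto simp: \<phi>C_def C_def)
      moreover have "\<phi>C y = \<one>\<^bsub>?P\<^esub>" using qC(3)[OF v_lk(1) g(1)] hom_one[OF iC(1) PC P] g(2) by (simp add: \<phi>C_def)
      moreover have "\<phi>H x = \<one>\<^bsub>?P\<^esub>" using C_qv[OF x] \<iota>v.hom_one by (simp add: \<phi>H_def)
      moreover have "\<phi>H y = y" using qv(2) g by (simp add: \<phi>H_def)
      moreover have "x \<in> carrier ?P" "y \<in> carrier ?P" using x y by auto
      ultimately show "\<phi>C (x \<otimes>\<^bsub>?P\<^esub> y) = x" "\<phi>H (x \<otimes>\<^bsub>?P\<^esub> y) = y"
        using hom_mult[OF \<phi>C] hom_mult[OF \<phi>H] by simp_all
    qed
    obtain a where a: "0 \<le> a" "\<And>x y. \<lbrakk>x \<in> carrier ?P; y \<in> carrier ?P\<rbrakk> \<Longrightarrow> T.d (\<phi>C x) (\<phi>C y) \<le> a * T.d x y"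
      using hom_Lipschitz[OF P S P S \<phi>C] by blast
    obtain b where b: "0 \<le> b" "\<And>x y. \<lbrakk>x \<in> carrier ?P; y \<in> carrier ?P\<rbrakk> \<Longrightarrow> T.d (\<phi>H x) (\<phi>H y) \<le> b * T.d x y"
      using hom_Lipschitz[OF P S P S \<phi>H] by blast
    have in_P: "x \<in> carrier ?P" if "x \<in> C <#>\<^bsub>?P\<^esub> H" for x using that by (auto simp: set_mult_def)
    show ?thesis
    proof (rule uniform_asdim_le_product[OF T.Metric_space_axioms T.Metric_space_axioms _ _ asC asH,
          of \<phi>C "C <#>\<^bsub>?P\<^esub> H" \<phi>H "a + b"])
      show "C \<subseteq> carrier ?P" "H \<subseteq> carrier ?P" using subgroup.subset[OF C] subgroup.subset[OF H] by auto
      show "\<phi>C ` (C <#>\<^bsub>?P\<^esub> H) \<subseteq> C" "\<phi>H ` (C <#>\<^bsub>?P\<^esub> H) \<subseteq> H" using proj by (auto simp: set_mult_def)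
      show "0 \<le> a + b" using a(1) b(1) by simp
      fix x y assume xy: "x \<in> C <#>\<^bsub>?P\<^esub> H" "y \<in> C <#>\<^bsub>?P\<^esub> H"
      have "0 \<le> b * T.d x y" "0 \<le> a * T.d x y" using a(1) b(1) by simp_all
      then show "T.d (\<phi>C x) (\<phi>C y) \<le> (a + b) * T.d x y" "T.d (\<phi>H x) (\<phi>H y) \<le> (a + b) * T.d x y"
        using a(2)[OF in_P in_P, OF xy] b(2)[OF in_P in_P, OF xy] by (simp_all add: distrib_right)
      obtain x1 x2 where x: "x1 \<in> C" "x2 \<in> H" "x = x1 \<otimes>\<^bsub>?P\<^esub> x2" using xy(1) unfolding set_mult_def by blast
      obtain y1 y2 where y: "y1 \<in> C" "y2 \<in> H" "y = y1 \<otimes>\<^bsub>?P\<^esub> y2" using xy(2) unfolding set_mult_def by blast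
      have car: "x1 \<in> carrier ?P" "x2 \<in> carrier ?P" "y1 \<in> carrier ?P" "y2 \<in> carrier ?P" using x y by auto
      have "T.d x y \<le> T.d (x1 \<otimes>\<^bsub>?P\<^esub> x2) (y1 \<otimes>\<^bsub>?P\<^esub> x2) + T.d (y1 \<otimes>\<^bsub>?P\<^esub> x2) (y1 \<otimes>\<^bsub>?P\<^esub> y2)"
        using T.triangle car x(3) y(3) by simp
      also have "T.d (x1 \<otimes>\<^bsub>?P\<^esub> x2) (y1 \<otimes>\<^bsub>?P\<^esub> x2) = T.d (x2 \<otimes>\<^bsub>?P\<^esub> x1) (x2 \<otimes>\<^bsub>?P\<^esub> y1)"
        by (simp only: CH[OF x(1,2)] CH[OF y(1) x(2)])
      also have "\<dots> \<le> T.d x1 y1" using car by (intro T.cayley_dist_translate)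
      also have "T.d (y1 \<otimes>\<^bsub>?P\<^esub> x2) (y1 \<otimes>\<^bsub>?P\<^esub> y2) \<le> T.d x2 y2" using car by (intro T.cayley_dist_translate)
      finally show "T.d x y \<le> T.d (\<phi>C x) (\<phi>C y) + T.d (\<phi>H x) (\<phi>H y)"
        using proj x y by simp
    qed
  qed
  have "uniform_asdim_le T.d (Suc k) {carrier ?P}"
  proof (rule T.uniform_asdim_le_carrier)
    show "uniform_asdim_le T.d k {C}"
      using asC ck subgroup.subset[OF C] by (intro T.uniform_asdim_le_mono[OF asC]) auto
    show "uniform_asdim_le T.d (Suc k) {A}" by (rule asA)
    show "uniform_asdim_le T.d (Suc k) {C <#>\<^bsub>?P\<^esub> H}"
      using chk by (intro T.uniform_asdim_le_mono[OF asCH]) (auto simp: set_mult_def)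
  qed
  then show ?thesis using adim_le_iff[OF P S] by blast
qed

section \<open>The clique bound\<close>

lemma adim_graph_product_empty: "adim (graph_product {} E G) \<le> enat n"
proof -
  let ?P = "graph_product {} E G"
  have P: "group ?P" by (rule group_graph_product) simp
  interpret group ?P by (rule P)
  have "x = \<one>\<^bsub>?P\<^esub>" if "x \<in> carrier ?P" for x
    by (rule graph_product_induct[of "{}" G x E "\<lambda>x. x = \<one>\<^bsub>?P\<^esub>", OF _ that]) auto
  then have carrier: "carrier ?P = {\<one>\<^bsub>?P\<^esub>}" by auto
  have S: "finite_generating_set ?P {}"
    using generate_empty carrier by (simp add: finite_generating_set_def)
  have "uniform_asdim_le (cayley_dist ?P {}) n {carrier ?P}"
  proof (rule uniform_colouringI)
    fix r :: real
    let ?B = "cayley_dist ?P {} \<one>\<^bsub>?P\<^esub> \<one>\<^bsub>?P\<^esub>"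
    have "coarsely_discrete (cayley_dist ?P {}) r ?B {\<one>\<^bsub>?P\<^esub>}"
      by (rule coarsely_discreteI[where g = "\<lambda>_. ()"]) auto
    then have "colouring (cayley_dist ?P {}) n (Suc n) r ?B {\<one>\<^bsub>?P\<^esub>}"
      unfolding colouring_def by (intro exI[of _ "\<lambda>_. {\<one>\<^bsub>?P\<^esub>}"]) auto
    then show "\<exists>B. \<forall>Z\<in>{carrier ?P}. colouring (cayley_dist ?P {}) n (Suc n) r B Z"
      using carrier by auto
  qed
  then show ?thesis using adim_le_iff[OF P S] by blast
qed

definition clique_weight :: "'v set set \<Rightarrow> ('v \<Rightarrow> nat) \<Rightarrow> 'v set \<Rightarrow> nat" where
  "clique_weight E k U = Max (sum k ` {C. C \<subseteq> U \<and> clique C E})"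

lemma sum_le_clique_weight:
  "\<lbrakk>finite U; C \<subseteq> U; clique C E\<rbrakk> \<Longrightarrow> sum k C \<le> clique_weight E k U"
  unfolding clique_weight_def by (intro Max_ge) auto

lemma clique_weight_attained:
  assumes "finite U"
  obtains C where "C \<subseteq> U" "clique C E" "clique_weight E k U = sum k C"
proof -
  have "clique_weight E k U \<in> sum k ` {C. C \<subseteq> U \<and> clique C E}"
    unfolding clique_weight_def using assms by (intro Max_in) auto
  then show ?thesis using that by auto
qed

text \<open>The weights are positive, so the weight of \<open>v\<close> accounts both for the dimension of \<open>G v\<close> and for the
  additional \<open>1\<close> that the gluing along the tree costs.\<close>

lemma adim_graph_product_le_clique_weight:
  assumes "finite U" and no_loops: "\<And>u. {u} \<notin> E"
    and "\<And>u. u \<in> U \<Longrightarrow> group (G u)" "\<And>u. u \<in> U \<Longrightarrow> finitely_generated (G u)"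
    and "\<And>u. u \<in> U \<Longrightarrow> adim (G u) \<le> enat (k u)" "\<And>u. u \<in> U \<Longrightarrow> 1 \<le> k u"
  shows "adim (graph_product U E G) \<le> enat (clique_weight E k U)"
  using assms(1,3-)
proof (induction U rule: finite_psubset_induct)
  case (psubset U)
  show ?case
  proof (cases "U = {}")
    case True
    then show ?thesis using adim_graph_product_empty by metis
  next
    case False
    then obtain v where v: "v \<in> U" by blast
    define V' where "V' = U - {v}"
    define lk where "lk = {u \<in> V'. {u, v} \<in> E}"
    have sub: "V' \<subset> U" "lk \<subset> U" and U: "U = insert v V'" "v \<notin> V'" using v by (auto simp: V'_def lk_def)
    have fin: "finite V'" "finite lk" using sub psubset.hyps by (auto intro: finite_subset)
    have IH: "adim (graph_product W E G) \<le> enat (clique_weight E k W)" if "W \<subset> U" for W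
      using psubset.IH[OF that] psubset.prems that by blast
    have V'_le: "clique_weight E k V' \<le> clique_weight E k U"
    proof -
      obtain C where "C \<subseteq> V'" "clique C E" "clique_weight E k V' = sum k C"
        using clique_weight_attained[OF fin(1)] .
      then show ?thesis using sum_le_clique_weight[OF psubset.hyps, of C E k] sub by auto
    qed
    have lk_le: "clique_weight E k lk + k v \<le> clique_weight E k U"
    proof -
      obtain C where C: "C \<subseteq> lk" "clique C E" "clique_weight E k lk = sum k C"
        using clique_weight_attained[OF fin(2)] .
      have "clique (insert v C) E" using C by (auto simp: clique_def lk_def insert_commute)
      moreover have "insert v C \<subseteq> U" using C sub v by auto
      moreover have "sum k (insert v C) = k v + sum k C"
        using C fin(2) U(2) by (intro sum.insert) (auto simp: lk_def intro: finite_subset)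
      ultimately show ?thesis using sum_le_clique_weight[OF psubset.hyps, of "insert v C" E k] C(3) by simp
    qed
    have kv: "1 \<le> k v" using psubset.prems v by blast
    then obtain m where m: "clique_weight E k U = Suc m" using lk_le by (cases "clique_weight E k U") auto
    have "adim (graph_product (insert v V') E G) \<le> enat (Suc m)"
    proof (rule adim_graph_product_insert_vertex[OF fin(1) U(2) no_loops])
      show "adim (graph_product V' E G) \<le> enat (Suc m)"
        using IH[OF sub(1)] V'_le m by (metis enat_ord_simps(1) order_trans)
      show "adim (graph_product {u \<in> V'. {u, v} \<in> E} E G) \<le> enat (clique_weight E k lk)"
        using IH[OF sub(2)] by (simp add: lk_def)
      show "adim (G v) \<le> enat (k v)" using psubset.prems v by blast
      show "clique_weight E k lk \<le> m" "clique_weight E k lk + k v \<le> Suc m" using lk_le kv m by auto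
    qed (use psubset.prems U(1) in auto)
    then show ?thesis using U(1) m by simp
  qed
qed

theorem theorem6p3:
  fixes V :: "'v set" and E :: "'v set set" and G :: "'v \<Rightarrow> ('a, 'b) monoid_scheme"
  assumes "finite V" and "simplicial_graph V E"
    and "\<And>v. v \<in> V \<Longrightarrow> group (G v)"
    and "\<And>v. v \<in> V \<Longrightarrow> finitely_generated (G v)"
  shows "adim (graph_product V E G)
    \<le> (MAX C\<in>{C. C \<subseteq> V \<and> clique C E}. \<Sum>v\<in>C. max 1 (adim (G v)))"
proof -
  let ?f = "\<lambda>C. \<Sum>v\<in>C. max 1 (adim (G v))"
  let ?\<C> = "{C. C \<subseteq> V \<and> clique C E}"
  have le_Max: "?f C \<le> Max (?f ` ?\<C>)" if "C \<subseteq> V" "clique C E" for C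
    using that assms(1) by (intro Max_ge) auto
  show ?thesis
  proof (cases "\<exists>v\<in>V. adim (G v) = \<infinity>")
    case True
    then obtain v where v: "v \<in> V" "adim (G v) = \<infinity>" by blast
    then have "?f {v} = \<infinity>" by simp
    then have "Max (?f ` ?\<C>) = \<infinity>" using le_Max[of "{v}"] v(1) by (simp add: clique_def)
    then show ?thesis by simp
  next
    case False
    define k where "k v = the_enat (max 1 (adim (G v)))" for v
    have k: "max 1 (adim (G v)) = enat (k v)" if "v \<in> V" for v
      using False that by (auto simp: k_def max_def one_enat_def)
    have "{u} \<notin> E" for u using assms(2) by (auto simp: simplicial_graph_def nsets_def)
    moreover have "adim (G v) \<le> enat (k v)" if "v \<in> V" for v
      using k[OF that] by (metis max.cobounded2)
    moreover have "1 \<le> k v" if "v \<in> V" for v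
      using k[OF that] by (metis enat_ord_simps(1) max.cobounded1 one_enat_def)
    ultimately have "adim (graph_product V E G) \<le> enat (clique_weight E k V)"
      using assms by (intro adim_graph_product_le_clique_weight) auto
    also obtain C where C: "C \<subseteq> V" "clique C E" "clique_weight E k V = sum k C"
      using clique_weight_attained[OF assms(1)] .
    have "enat (sum k C) = ?f C"
    proof -
      have "?f C = (\<Sum>v\<in>C. enat (k v))" using k C(1) by (intro sum.cong) auto
      then show ?thesis by (simp flip: of_nat_eq_enat)
    qed
    then have "enat (clique_weight E k V) \<le> Max (?f ` ?\<C>)" using le_Max[OF C(1,2)] C(3) by simp
    finally show ?thesis .
  qed
qed

end
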